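(* Let $(X,r)$ be a finite solution with $|X|>1$. If $(X,r)$ is square-free and the derived monoid $A(X,r)$ is nilpotent, then $(X,r)$ is decomposable.
   Context: "Solution" means finite bijective non-degenerate set-theoretic solution of the Yang--Baxter equation: a pair $(X,r)$ with $X$ a non-empty finite set and $r:X\times X\to X\times X$, $r(x,y)=(\lambda_x(y),\rho_y(x))$, a bijection such that $(r\times \mathrm{id}_X)(\mathrm{id}_X\times r)(r\times \mathrm{id}_X)=(\mathrm{id}_X\times r)(r\times \mathrm{id}_X)(\mathrm{id}_X\times r)$ and all maps $\lambda_x,\rho_x:X\to X$ are bijective. $(X,r)$ is square-free if $r(x,x)=(x,x)$ for all $x\in X$. $(X,r)$ is decomposable if there is a partition $X=Y\cup Z$ with $Y,Z\neq\emptyset$, $r(Y\times Y)\subseteq Y\times Y$ and $r(Z\times Z)\subseteq Z\times Z$. The derived monoid of $(X,r)$ is the monoid with presentation $A(X,r)=\langle x\in X\mid x\oplus y=y\oplus\sigma_y(x)\text{ for all }x,y\in X\rangle$, where $\sigma_y(x)=\lambda_y(\rho_{\lambda_x^{-1}(y)}(x))$. A monoid $A$ (written multiplicatively) is nilpotent, in the sense of Malcev, if there is $n\ge 1$ such that for all $x,y,w_1,\dots,w_n\in A$ one has $x_n=y_n$, where $x_0=x$, $y_0=y$ and $x_{i+1}=x_iw_{i+1}y_i$, $y_{i+1}=y_iw_{i+1}x_i$; for groups this is the usual nilpotency. *)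

theory Defs
  imports "HOL-Algebra.Group"
begin

text \<open>A map \<open>r\<close> on \<open>X \<times> X\<close> is given as a total function on pairs of the ambient type; only its
  values on \<open>X \<times> X\<close> matter. We write \<open>r (x, y) = (lam r x y, rho r y x)\<close>.\<close>

definition lam :: "('a \<times> 'a \<Rightarrow> 'a \<times> 'a) \<Rightarrow> 'a \<Rightarrow> 'a \<Rightarrow> 'a" where
  "lam r x y = fst (r (x, y))"

definition rho :: "('a \<times> 'a \<Rightarrow> 'a \<times> 'a) \<Rightarrow> 'a \<Rightarrow> 'a \<Rightarrow> 'a" where
  "rho r y x = snd (r (x, y))"

definition r_id :: "('a \<times> 'a \<Rightarrow> 'a \<times> 'a) \<Rightarrow> 'a \<times> 'a \<times> 'a \<Rightarrow> 'a \<times> 'a \<times> 'a" where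
  "r_id r = (\<lambda>(x, y, z). let (u, v) = r (x, y) in (u, v, z))"

definition id_r :: "('a \<times> 'a \<Rightarrow> 'a \<times> 'a) \<Rightarrow> 'a \<times> 'a \<times> 'a \<Rightarrow> 'a \<times> 'a \<times> 'a" where
  "id_r r = (\<lambda>(x, y, z). (x, r (y, z)))"

definition solution :: "'a set \<Rightarrow> ('a \<times> 'a \<Rightarrow> 'a \<times> 'a) \<Rightarrow> bool" where
  "solution X r \<longleftrightarrow>
     finite X \<and> X \<noteq> {} \<and>
     bij_betw r (X \<times> X) (X \<times> X) \<and>
     (\<forall>t \<in> X \<times> X \<times> X. (r_id r \<circ> id_r r \<circ> r_id r) t = (id_r r \<circ> r_id r \<circ> id_r r) t) \<and>
     (\<forall>x \<in> X. bij_betw (lam r x) X X) \<and>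
     (\<forall>x \<in> X. bij_betw (rho r x) X X)"

definition square_free :: "'a set \<Rightarrow> ('a \<times> 'a \<Rightarrow> 'a \<times> 'a) \<Rightarrow> bool" where
  "square_free X r \<longleftrightarrow> (\<forall>x \<in> X. r (x, x) = (x, x))"

definition decomposable :: "'a set \<Rightarrow> ('a \<times> 'a \<Rightarrow> 'a \<times> 'a) \<Rightarrow> bool" where
  "decomposable X r \<longleftrightarrow>
     (\<exists>Y Z. X = Y \<union> Z \<and> Y \<inter> Z = {} \<and> Y \<noteq> {} \<and> Z \<noteq> {} \<and>
        r ` (Y \<times> Y) \<subseteq> Y \<times> Y \<and> r ` (Z \<times> Z) \<subseteq> Z \<times> Z)"

text \<open>The free monoid on \<open>X\<close> is \<open>lists X\<close>; the monoid presented by relations \<open>R\<close> is its quotient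
  by the congruence generated by \<open>R\<close>.\<close>

inductive_set pres_cong :: "'a set \<Rightarrow> ('a list \<times> 'a list) set \<Rightarrow> ('a list \<times> 'a list) set"
  for X :: "'a set" and R :: "('a list \<times> 'a list) set" where
  refl: "u \<in> lists X \<Longrightarrow> (u, u) \<in> pres_cong X R"
| rel: "\<lbrakk>(a, b) \<in> R; a \<in> lists X; b \<in> lists X; u \<in> lists X; v \<in> lists X\<rbrakk>
    \<Longrightarrow> (u @ a @ v, u @ b @ v) \<in> pres_cong X R"
| sym: "(u, v) \<in> pres_cong X R \<Longrightarrow> (v, u) \<in> pres_cong X R"
| trans: "\<lbrakk>(u, v) \<in> pres_cong X R; (v, w) \<in> pres_cong X R\<rbrakk> \<Longrightarrow> (u, w) \<in> pres_cong X R"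

definition presented_monoid :: "'a set \<Rightarrow> ('a list \<times> 'a list) set \<Rightarrow> 'a list set monoid" where
  "presented_monoid X R =
     \<lparr>carrier = lists X // pres_cong X R,
      mult = (\<lambda>A B. \<Union>a\<in>A. \<Union>b\<in>B. pres_cong X R `` {a @ b}),
      one = pres_cong X R `` {[]}\<rparr>"

lemma pres_cong_lists:
  assumes "(u, v) \<in> pres_cong X R"
  shows "u \<in> lists X" and "v \<in> lists X"
  using assms by (induction rule: pres_cong.induct) auto

lemma equiv_pres_cong: "equiv (lists X) (pres_cong X R)"
proof (rule equivI)
  show "pres_cong X R \<subseteq> lists X \<times> lists X"
    using pres_cong_lists by fast
  show "refl_on (lists X) (pres_cong X R)"
    by (rule refl_onI) (rule pres_cong.refl)
  show "Relation.sym (pres_cong X R)"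
    by (rule symI) (rule pres_cong.sym)
  show "Relation.trans (pres_cong X R)"
    by (rule transI) (rule pres_cong.trans)
qed

lemma pres_cong_context:
  assumes "(a, b) \<in> pres_cong X R" "u \<in> lists X" "v \<in> lists X"
  shows "(u @ a @ v, u @ b @ v) \<in> pres_cong X R"
  using assms
proof (induction rule: pres_cong.induct)
  case (refl w)
  then show ?case by (intro pres_cong.refl) simp
next
  case (rel a b s t)
  then have "((u @ s) @ a @ (t @ v), (u @ s) @ b @ (t @ v)) \<in> pres_cong X R"
    by (intro pres_cong.rel) simp_all
  then show ?case by simp
next
  case (sym s t)
  then show ?case by (blast intro: pres_cong.sym)
next
  case (trans s t w)
  then show ?case by (blast intro: pres_cong.trans)
qed

lemma pres_cong_append:
  assumes "(a, a') \<in> pres_cong X R" "(b, b') \<in> pres_cong X R"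
  shows "(a @ b, a' @ b') \<in> pres_cong X R"
proof -
  note L = pres_cong_lists[OF assms(1)] pres_cong_lists[OF assms(2)]
  have "(a @ b, a' @ b) \<in> pres_cong X R"
    using pres_cong_context[OF assms(1), of "[]" b] L by simp
  moreover have "(a' @ b, a' @ b') \<in> pres_cong X R"
    using pres_cong_context[OF assms(2), of a' "[]"] L by simp
  ultimately show ?thesis by (rule pres_cong.trans)
qed

lemma presented_monoid_mult:
  assumes "u \<in> lists X" "v \<in> lists X"
  shows "(pres_cong X R `` {u}) \<otimes>\<^bsub>presented_monoid X R\<^esub> (pres_cong X R `` {v}) =
    pres_cong X R `` {u @ v}"
  using assms
  by (auto simp: presented_monoid_def
      intro: pres_cong_append pres_cong.sym pres_cong.trans pres_cong.refl)

lemma monoid_presented_monoid: "monoid (presented_monoid X R)"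
proof -
  have car: "carrier (presented_monoid X R) = (\<lambda>u. pres_cong X R `` {u}) ` lists X"
    by (auto simp: presented_monoid_def quotient_def)
  have one: "\<one>\<^bsub>presented_monoid X R\<^esub> = pres_cong X R `` {[]}"
    by (simp add: presented_monoid_def)
  let ?M = "presented_monoid X R"
  let ?c = "\<lambda>u. pres_cong X R `` {u}"
  show ?thesis
  proof (rule monoidI)
    show "\<one>\<^bsub>?M\<^esub> \<in> carrier ?M"
      unfolding car one by (rule imageI) simp
  next
    fix a b assume "a \<in> carrier ?M" "b \<in> carrier ?M"
    then obtain u v where "a = ?c u" "b = ?c v" "u \<in> lists X" "v \<in> lists X"
      unfolding car by blast
    then show "a \<otimes>\<^bsub>?M\<^esub> b \<in> carrier ?M"
      unfolding car by (simp only: presented_monoid_mult) (rule imageI, simp)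
  next
    fix a b c assume "a \<in> carrier ?M" "b \<in> carrier ?M" "c \<in> carrier ?M"
    then obtain u v w where "a = ?c u" "b = ?c v" "c = ?c w"
        "u \<in> lists X" "v \<in> lists X" "w \<in> lists X"
      unfolding car by blast
    then show "a \<otimes>\<^bsub>?M\<^esub> b \<otimes>\<^bsub>?M\<^esub> c = a \<otimes>\<^bsub>?M\<^esub> (b \<otimes>\<^bsub>?M\<^esub> c)"
      by (simp only: presented_monoid_mult append_in_lists_conv append_assoc simp_thms)
  next
    fix a assume "a \<in> carrier ?M"
    then obtain u where "a = ?c u" "u \<in> lists X"
      unfolding car by blast
    then show "\<one>\<^bsub>?M\<^esub> \<otimes>\<^bsub>?M\<^esub> a = a" "a \<otimes>\<^bsub>?M\<^esub> \<one>\<^bsub>?M\<^esub> = a"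
      by (simp_all only: one presented_monoid_mult lists.Nil append_Nil append_Nil2)
  qed
qed

definition sigma :: "'a set \<Rightarrow> ('a \<times> 'a \<Rightarrow> 'a \<times> 'a) \<Rightarrow> 'a \<Rightarrow> 'a \<Rightarrow> 'a" where
  "sigma X r y x = lam r y (rho r (inv_into X (lam r x) y) x)"

definition derived_monoid :: "'a set \<Rightarrow> ('a \<times> 'a \<Rightarrow> 'a \<times> 'a) \<Rightarrow> 'a list set monoid" where
  "derived_monoid X r =
     presented_monoid X {([x, y], [y, sigma X r y x]) | x y. x \<in> X \<and> y \<in> X}"

text \<open>\<open>malcev_seq A w x y i\<close> is the pair \<open>(x\<^sub>i, y\<^sub>i)\<close>.\<close>

primrec malcev_seq :: "('a, 'b) monoid_scheme \<Rightarrow> (nat \<Rightarrow> 'a) \<Rightarrow> 'a \<Rightarrow> 'a \<Rightarrow> nat \<Rightarrow> 'a \<times> 'a" where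
  "malcev_seq A w x y 0 = (x, y)"
| "malcev_seq A w x y (Suc i) =
     (let (a, b) = malcev_seq A w x y i
      in (a \<otimes>\<^bsub>A\<^esub> w (Suc i) \<otimes>\<^bsub>A\<^esub> b, b \<otimes>\<^bsub>A\<^esub> w (Suc i) \<otimes>\<^bsub>A\<^esub> a))"

definition malcev_nilpotent :: "('a, 'b) monoid_scheme \<Rightarrow> bool" where
  "malcev_nilpotent A \<longleftrightarrow>
     (\<exists>n\<ge>1. \<forall>x \<in> carrier A. \<forall>y \<in> carrier A. \<forall>w. (\<forall>i \<in> {1..n}. w i \<in> carrier A) \<longrightarrow>
        fst (malcev_seq A w x y n) = snd (malcev_seq A w x y n))"

end

theory Submission
  imports Defs "Jordan_Normal_Form.Schur_Decomposition" "HOL-Computational_Algebra.Computational_Algebra"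
    "HOL-Algebra.Group_Action" "HOL-Algebra.Multiplicative_Group" "HOL-Algebra.Sylow" "HOL-Algebra.Bij"
begin

text \<open>Let \<open>L\<close> and \<open>N\<close> be the groups of permutations of \<open>X\<close> generated by the maps \<open>\<lambda>\<^sub>x\<close> and
by the maps \<open>\<sigma>\<^sub>x\<close>. If a proper non-empty subset \<open>Y\<close> is invariant under both groups, then
\<open>Y\<close> and \<open>X - Y\<close> decompose the solution (\<open>decomposable_of_invariant\<close>). So suppose that there
is no such subset. Square-freeness says that \<open>\<lambda>\<^sub>x\<close> and \<open>\<sigma>\<^sub>x\<close> fix \<open>x\<close>, and the idea is that a
nilpotent group acting transitively on more than one point cannot be generated by elements
with fixed points: they lie in conjugates of a point stabilizer, and in a nilpotent group all
conjugates of a proper subgroup lie in one proper normal subgroup.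

The maps \<open>\<sigma>\<^sub>x\<^sup>-\<^sup>1\<close> satisfy the defining relations of the derived monoid, so \<open>N\<close> is nilpotent
(\<open>rack_image_hypercentral\<close>) and therefore intransitive. Let \<open>O\<close> be an orbit of \<open>N\<close>. As \<open>L\<close>
normalizes \<open>N\<close>, it permutes the orbits of \<open>N\<close>, and it does so transitively. The stabilizer
\<open>M\<close> of \<open>O\<close> in \<open>L\<close> is thus a proper subgroup, and every \<open>\<lambda>\<^sub>x\<close>, having a fixed point, lies in a
conjugate of \<open>M\<close>.

This would finish the proof if \<open>L\<close> were nilpotent, but what the nilpotency of the derived
monoid gives for \<open>L\<close> is weaker. The maps \<open>\<tau>\<^sub>x(g) = \<lambda>\<^bsub>g(x)\<^esub> g\<close> on the set \<open>L\<close>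
again satisfy the relations of the derived monoid, by an identity for square-free solutions
(\<open>l_exchange\<close>), and so generate a nilpotent group of permutations of \<open>L\<close>. For each prime
\<open>p\<close>, the subgroup \<open>L\<^sub>p\<close> of \<open>L\<close> generated by the \<open>p\<close>-parts of the \<open>\<lambda>\<^sub>x\<close> is the orbit of the
identity under a \<open>p\<close>-group of such permutations, hence a \<open>p\<close>-group itself (\<open>H_prime_card\<close>),
and these subgroups permute with each other and have product \<open>L\<close>.

For a group with such a family of permutable \<open>p\<close>-subgroups, a proper subgroup still cannot
have conjugates that contain generators of all \<open>L\<^sub>p\<close>
(\<open>conjugates_of_proper_subgroup\<close>), which is the desired contradiction. That
theorem rests on the solubility of the products \<open>L\<^sub>p L\<^sub>q\<close>, that is, on Burnside's theorem on
groups of order \<open>p\<^sup>a q\<^sup>b\<close>. It is derived from the fact that a class of prime power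
size is degenerate (\<open>prime_power_class_differences_generate_proper\<close>), which is proved with the
spectral decomposition of the class sum on the functions on the group in place
of character theory.\<close>
hide_const (open) Polynomial.order up_ring.coeff up_ring.monom

section \<open>Algebraic integers\<close>

lemma eigenvalue_of_integer_matrix_is_algebraic_int:
  fixes B :: "int mat"
  assumes B: "B \<in> carrier_mat n n" and ev: "eigenvalue (map_mat complex_of_int B) z"
  shows "algebraic_int z"
proof -
  have C: "map_mat complex_of_int B \<in> carrier_mat n n" using B by simp
  have "poly (char_poly (map_mat complex_of_int B)) z = 0"
    using eigenvalue_root_char_poly[OF C] ev by simp
  moreover have "char_poly (map_mat complex_of_int B) = map_poly complex_of_int (char_poly B)"
    by (rule of_int_hom.char_poly_hom[OF B])
  ultimately show ?thesis
    using degree_monic_char_poly[OF B]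
    by (intro algebraic_int.intros[of "map_poly complex_of_int (char_poly B)"])
       (auto simp: coeff_map_poly degree_map_poly)
qed

text \<open>The vector \<open>v\<close> is an eigenvector of the integer matrix \<open>a\<close>.\<close>
lemma algebraic_int_by_finite_module:
  fixes z :: complex and v :: "'i \<Rightarrow> complex" and a :: "'i \<Rightarrow> 'i \<Rightarrow> int"
  assumes fin: "finite I" and nz: "i0 \<in> I" "v i0 \<noteq> 0"
    and mult: "\<And>i. i \<in> I \<Longrightarrow> z * v i = (\<Sum>j\<in>I. of_int (a i j) * v j)"
  shows "algebraic_int z"
proof -
  define n where "n = card I"
  obtain e where e: "bij_betw e {0..<n} I"
    using ex_bij_betw_nat_finite[OF fin] unfolding n_def by blast
  define B where "B = mat n n (\<lambda>(i,j). a (e i) (e j))"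
  define w where "w = vec n (\<lambda>i. v (e i))"
  have B: "B \<in> carrier_mat n n" unfolding B_def by simp
  have eI: "e i \<in> I" if "i < n" for i
    using e that by (auto simp: bij_betw_def)
  obtain k where k: "k < n" "e k = i0"
    using e nz(1) by (force simp: bij_betw_def)
  have "map_mat complex_of_int B *\<^sub>v w = z \<cdot>\<^sub>v w"
  proof (rule eq_vecI)
    fix i assume "i < dim_vec (z \<cdot>\<^sub>v w)"
    then have i: "i < n" by (simp add: w_def)
    have "(map_mat complex_of_int B *\<^sub>v w) $ i = (\<Sum>j\<in>{0..<n}. of_int (a (e i) (e j)) * v (e j))"
      using i by (simp add: B_def w_def scalar_prod_def)
    also have "\<dots> = (\<Sum>j\<in>I. of_int (a (e i) j) * v j)"
      by (rule sum.reindex_bij_betw[OF e])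
    also have "\<dots> = z * v (e i)" using mult[OF eI[OF i]] by simp
    finally show "(map_mat complex_of_int B *\<^sub>v w) $ i = (z \<cdot>\<^sub>v w) $ i"
      using i by (simp add: w_def)
  qed (simp add: B_def w_def)
  moreover have "w \<noteq> 0\<^sub>v n"
  proof
    assume "w = 0\<^sub>v n"
    then have "w $ k = 0" using k by simp
    then show False using k nz by (simp add: w_def)
  qed
  ultimately have "eigenvalue (map_mat complex_of_int B) z"
    unfolding eigenvalue_def eigenvector_def using B by (intro exI[of _ w]) (auto simp: w_def)
  then show ?thesis
    by (rule eigenvalue_of_integer_matrix_is_algebraic_int[OF B])
qed

text \<open>The matrix \<open>a\<close> is a companion matrix: multiplication by \<open>x\<close> shifts the powers of \<open>x\<close>, and a monic
integer polynomial with root \<open>x\<close> rewrites the top power.\<close>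
lemma algebraic_int_power_module:
  fixes x :: complex
  assumes "algebraic_int x"
  obtains d and a :: "nat \<Rightarrow> nat \<Rightarrow> int" where "d > 0"
    "\<And>m. m < d \<Longrightarrow> x * x ^ m = (\<Sum>k<d. of_int (a m k) * x ^ k)"
proof -
  from assms obtain p where p: "poly p x = 0" "\<forall>i. coeff p i \<in> \<int>" "lead_coeff p = 1"
    by (auto simp: algebraic_int.simps)
  define d where "d = degree p"
  have "\<exists>c. \<forall>i. coeff p i = of_int (c i)"
    using p(2) by (intro choice) (auto elim!: Ints_cases)
  then obtain c where c: "\<And>i. coeff p i = of_int (c i)" by blast
  have d0: "d > 0"
  proof (rule ccontr)
    assume "\<not> d > 0"
    then obtain a where a: "p = [:a:]" unfolding d_def by (metis degree_eq_zeroE not_gr0)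
    then show False using p by simp
  qed
  have "0 = (\<Sum>k\<le>d. coeff p k * x ^ k)" using p(1) by (simp add: poly_altdef d_def)
  also have "{..d} = insert d {..<d}" by auto
  also have "(\<Sum>k\<in>\<dots>. coeff p k * x ^ k) = x ^ d + (\<Sum>k<d. of_int (c k) * x ^ k)"
    using p(3) by (simp add: d_def c)
  finally have top: "x ^ d = (\<Sum>k<d. of_int (- c k) * x ^ k)"
    by (simp add: sum_negf eq_neg_iff_add_eq_0)
  define a where "a m k = (if Suc m < d then (if k = Suc m then 1 else 0) else - c k)" for m k
  have "x * x ^ m = (\<Sum>k<d. of_int (a m k) * x ^ k)" if m: "m < d" for m
  proof (cases "Suc m < d")
    case True
    then have "(\<Sum>k<d. of_int (a m k) * x ^ k) = (\<Sum>k<d. if k = Suc m then x ^ k else 0)"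
      by (intro sum.cong) (auto simp: a_def)
    then show ?thesis using True by simp
  next
    case False
    then have "d = Suc m" using m by simp
    then show ?thesis using top by (simp add: a_def)
  qed
  with d0 show ?thesis by (rule that)
qed

text \<open>The finitely many monomials \<open>x\<^sup>i y\<^sup>j\<close> below the degrees of \<open>x\<close> and \<open>y\<close> span a module that is stable
under both numbers, hence under their sum and their product.\<close>
lemma algebraic_int_add_mult:
  fixes x y :: complex
  assumes "algebraic_int x" "algebraic_int y"
  shows algebraic_int_add: "algebraic_int (x + y)"
    and algebraic_int_mult: "algebraic_int (x * y)"
proof -
  obtain d and \<alpha> :: "nat \<Rightarrow> nat \<Rightarrow> int" where d: "d > 0"
    and \<alpha>: "\<And>m. m < d \<Longrightarrow> x * x ^ m = (\<Sum>k<d. of_int (\<alpha> m k) * x ^ k)"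
    using algebraic_int_power_module[OF assms(1)] by metis
  obtain d' and \<beta> :: "nat \<Rightarrow> nat \<Rightarrow> int" where d': "d' > 0"
    and \<beta>: "\<And>m. m < d' \<Longrightarrow> y * y ^ m = (\<Sum>k<d'. of_int (\<beta> m k) * y ^ k)"
    using algebraic_int_power_module[OF assms(2)] by metis
  define I where "I = {..<d} \<times> {..<d'}"
  define v where "v = (\<lambda>(i,j). x ^ i * y ^ j)"
  define a :: "nat \<times> nat \<Rightarrow> nat \<times> nat \<Rightarrow> int"
    where "a = (\<lambda>(i,j) (i',j'). if j' = j then \<alpha> i i' else 0)"
  define b :: "nat \<times> nat \<Rightarrow> nat \<times> nat \<Rightarrow> int"
    where "b = (\<lambda>(i,j) (i',j'). if i' = i then \<beta> j j' else 0)"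
  have fin: "finite I" by (simp add: I_def)
  have z: "(0,0) \<in> I" "v (0,0) \<noteq> 0" using d d' by (auto simp: I_def v_def)
  have X: "x * v i = (\<Sum>j\<in>I. of_int (a i j) * v j)" if "i \<in> I" for i
  proof -
    obtain m n where i: "i = (m,n)" by force
    have mn: "m < d" "n < d'" using that by (auto simp: i I_def)
    have "(\<Sum>j\<in>I. of_int (a i j) * v j) =
      (\<Sum>k<d. \<Sum>l<d'. if l = n then of_int (\<alpha> m k) * (x ^ k * y ^ l) else 0)"
      unfolding I_def sum.cartesian_product by (intro sum.cong HOL.refl) (auto simp: i a_def v_def)
    also have "\<dots> = (\<Sum>k<d. of_int (\<alpha> m k) * x ^ k) * y ^ n"
      using mn by (simp add: sum_distrib_right mult.assoc)
    finally show ?thesis by (simp add: i v_def \<alpha>[OF mn(1), symmetric] mult.assoc)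
  qed
  have Y: "y * v i = (\<Sum>j\<in>I. of_int (b i j) * v j)" if "i \<in> I" for i
  proof -
    obtain m n where i: "i = (m,n)" by force
    have mn: "m < d" "n < d'" using that by (auto simp: i I_def)
    have "(\<Sum>j\<in>I. of_int (b i j) * v j) =
      (\<Sum>k<d. \<Sum>l<d'. if k = m then of_int (\<beta> n l) * (x ^ k * y ^ l) else 0)"
      unfolding I_def sum.cartesian_product by (intro sum.cong HOL.refl) (auto simp: i b_def v_def)
    also have "\<dots> = (\<Sum>k<d. if k = m then (\<Sum>l<d'. of_int (\<beta> n l) * (x ^ k * y ^ l)) else 0)"
      by (intro sum.cong HOL.refl) auto
    also have "\<dots> = (\<Sum>l<d'. of_int (\<beta> n l) * y ^ l) * x ^ m"
      using mn by (simp add: sum_distrib_right sum_distrib_left mult.assoc mult.commute mult.left_commute)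
    also have "(\<Sum>l<d'. of_int (\<beta> n l) * y ^ l) = y * y ^ n" by (rule \<beta>[OF mn(2), symmetric])
    finally show ?thesis by (simp add: i v_def mult_ac)
  qed
  show "algebraic_int (x + y)"
  proof (rule algebraic_int_by_finite_module[where v = v and a = "\<lambda>i j. a i j + b i j", OF fin z])
    fix i assume "i \<in> I"
    then show "(x + y) * v i = (\<Sum>j\<in>I. of_int (a i j + b i j) * v j)"
      using X Y by (simp add: distrib_right sum.distrib)
  qed
  show "algebraic_int (x * y)"
  proof (rule algebraic_int_by_finite_module[where v = v and a = "\<lambda>i k. \<Sum>j\<in>I. b i j * a j k", OF fin z])
    fix i assume i: "i \<in> I"
    have "x * y * v i = x * (y * v i)" by (simp add: mult.assoc)
    also have "\<dots> = (\<Sum>j\<in>I. of_int (b i j) * (x * v j))"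
      by (simp add: Y[OF i] sum_distrib_left mult.left_commute)
    also have "\<dots> = (\<Sum>j\<in>I. \<Sum>k\<in>I. of_int (b i j * a j k) * v k)"
      by (intro sum.cong HOL.refl) (simp add: X sum_distrib_left mult.assoc)
    also have "\<dots> = (\<Sum>k\<in>I. \<Sum>j\<in>I. of_int (b i j * a j k) * v k)" by (rule sum.swap)
    also have "\<dots> = (\<Sum>k\<in>I. of_int (\<Sum>j\<in>I. b i j * a j k) * v k)" by (simp add: sum_distrib_right)
    finally show "x * y * v i = (\<Sum>k\<in>I. of_int (\<Sum>j\<in>I. b i j * a j k) * v k)" .
  qed
qed

lemma algebraic_int_sum:
  fixes f :: "'i \<Rightarrow> complex"
  shows "(\<And>i. i \<in> I \<Longrightarrow> algebraic_int (f i)) \<Longrightarrow> algebraic_int (sum f I)"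
  by (induction I rule: infinite_finite_induct) (auto intro: algebraic_int_add)

lemma algebraic_int_power:
  fixes x :: complex
  shows "algebraic_int x \<Longrightarrow> algebraic_int (x ^ n)"
  by (induction n) (auto intro: algebraic_int_mult)

lemma algebraic_int_prod_list:
  fixes xs :: "complex list"
  shows "(\<And>x. x \<in> set xs \<Longrightarrow> algebraic_int x) \<Longrightarrow> algebraic_int (prod_list xs)"
  by (induction xs) (auto intro: algebraic_int_mult)


lemma norm_prod_list_less_1:
  fixes xs :: "complex list"
  assumes "xs \<noteq> []" "\<And>x. x \<in> set xs \<Longrightarrow> norm x < 1"
  shows "norm (prod_list xs) < 1"
  using assms
proof (induction xs)
  case (Cons x xs)
  have le: "norm (prod_list xs) \<le> 1"
    using Cons by (cases "xs = []") (auto simp: less_imp_le)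
  have "norm (prod_list (x # xs)) = norm x * norm (prod_list xs)" by (simp add: norm_mult)
  also have "\<dots> \<le> norm x * 1" using le by (intro mult_left_mono) auto
  also have "\<dots> < 1" using Cons by simp
  finally show ?case .
qed simp

text \<open>The conjugates of \<open>\<alpha>\<close> are roots of \<open>g\<close>, and \<open>1\<close> is not among them, so they all have absolute
value below one. Their product is, up to sign, the constant coefficient of the minimal
polynomial: a rational algebraic integer of absolute value below one, that is, zero.\<close>
lemma small_conjugates_imp_zero:
  fixes \<alpha> :: complex and g :: "rat poly"
  assumes ai: "algebraic_int \<alpha>" and g: "g \<noteq> 0" "poly (map_poly of_rat g) \<alpha> = 0"
    and small: "\<And>z::complex. poly (map_poly of_rat g) z = 0 \<Longrightarrow> norm z < 1 \<or> z = 1"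
    and ne1: "\<alpha> \<noteq> 1"
  shows "\<alpha> = 0"
proof -
  let ?h = "map_poly (of_rat :: rat \<Rightarrow> complex)"
  interpret hr: field_hom "of_rat :: rat \<Rightarrow> complex" by unfold_locales (auto simp: of_rat_add of_rat_mult)
  interpret map: map_poly_inj_comm_ring_hom "of_rat :: rat \<Rightarrow> complex" ..
  have poly_h: "poly (?h q) (of_rat t) = of_rat (poly q t)" for q t
    by (induction q) (auto simp: of_rat_add of_rat_mult map_poly_pCons)
  define Q where "Q = (\<lambda>p::rat poly. p \<noteq> 0 \<and> poly (?h p) \<alpha> = 0)"
  \<comment> \<open>\<open>p\<close> is a minimal polynomial of \<open>\<alpha>\<close> over the rationals.\<close>
  obtain p where p: "Q p" and min: "\<And>p'. Q p' \<Longrightarrow> degree p \<le> degree p'"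
    using exists_least_iff[of "\<lambda>n. \<exists>p. Q p \<and> degree p = n"] g unfolding Q_def
    by (metis (no_types, lifting) linorder_le_less_linear)
  have dvd: "p dvd p'" if "poly (?h p') \<alpha> = 0" for p'
  proof (rule ccontr)
    assume nd: "\<not> p dvd p'"
    then have nz: "p' mod p \<noteq> 0" by (simp add: dvd_eq_mod_eq_0)
    have "?h p' = ?h p * ?h (p' div p) + ?h (p' mod p)"
      by (metis map.hom_add map.hom_mult mult_div_mod_eq)
    then have "poly (?h (p' mod p)) \<alpha> = 0" using that p by (simp add: Q_def)
    then have "Q (p' mod p)" using nz by (simp add: Q_def)
    from min[OF this] show False using degree_mod_less'[of p p'] nz p by (auto simp: Q_def)
  qed
  have no_root: "poly p t \<noteq> 0" if "\<alpha> \<noteq> of_rat t" for t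
  proof
    assume "poly p t = 0"
    then have "[:-t, 1:] dvd p" by (simp add: poly_eq_0_iff_dvd)
    then obtain k where k: "p = [:-t, 1:] * k" by (elim dvdE)
    have k0: "k \<noteq> 0" using p k by (auto simp: Q_def)
    have "?h p = ?h [:-t, 1:] * ?h k" by (simp only: k map.hom_mult)
    then have "poly (?h k) \<alpha> = 0"
      using p that by (simp add: Q_def map_poly_pCons of_rat_minus)
    then have "Q k" using k0 by (simp add: Q_def)
    from min[OF this] show False using k0 by (simp add: k degree_mult_eq del: mult_pCons_left)
  qed
  show ?thesis
  proof (rule ccontr)
    assume nz: "\<alpha> \<noteq> 0"
    from ai obtain f where f: "poly f \<alpha> = 0" "\<forall>i. coeff f i \<in> \<int>" "lead_coeff f = 1"
      by (auto simp: algebraic_int.simps)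
    have "\<exists>c. \<forall>i. coeff f i = of_int (c i)"
      using f(2) by (intro choice) (auto elim!: Ints_cases)
    then obtain c where c: "\<And>i. coeff f i = of_int (c i)" by blast
    define f' where "f' = map_poly (\<lambda>z. of_int \<lfloor>Re z\<rfloor> :: rat) f"
    have ff': "?h f' = f"
      by (intro poly_eqI) (simp add: f'_def coeff_map_poly c)
    have root: "norm z < 1" "algebraic_int z" if "poly (?h p) z = 0" for z
    proof -
      have "p dvd g" using dvd g by blast
      then have "?h p dvd ?h g" by auto
      then have "poly (?h g) z = 0" using that by (auto elim!: dvdE)
      moreover have "z \<noteq> 1"
      proof
        assume "z = 1"
        then have "of_rat (poly p 1) = (0::complex)" using that poly_h[of p 1] by simp
        then show False using no_root[of 1] ne1 by simp
      qed
      ultimately show "norm z < 1" using small by blast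
      have "p dvd f'" using dvd ff' f by metis
      then have "?h p dvd f" using ff' map.hom_dvd by metis
      then have "poly f z = 0" using that by (auto elim!: dvdE)
      then show "algebraic_int z" using f by (intro algebraic_int.intros[of f]) auto
    qed
    obtain as where as: "Polynomial.smult (lead_coeff (?h p)) (\<Prod>a\<leftarrow>as. [:- a, 1:]) = ?h p"
        "length as = degree (?h p)"
      using fundamental_theorem_algebra_factorized by blast
    have lc: "lead_coeff (?h p) \<noteq> 0" using p by (auto simp: Q_def)
    have root_as: "poly (?h p) a = 0" if "a \<in> set as" for a
    proof -
      have "poly (\<Prod>a\<leftarrow>as. [:- a, 1:]) a = 0"
        using that by (induction as) auto
      then show ?thesis by (subst as(1)[symmetric]) simp
    qed
    have "degree p > 0"
    proof (rule ccontr)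
      assume "\<not> degree p > 0"
      then obtain b where "p = [:b:]" by (metis degree_eq_zeroE not_gr0)
      then show False using p by (auto simp: Q_def map_poly_pCons)
    qed
    then have "as \<noteq> []" using as(2) by auto
    then have small': "norm (prod_list as) < 1"
      using root root_as by (intro norm_prod_list_less_1) auto
    have p0: "poly (\<Prod>a\<leftarrow>as. [:- a, 1:]) 0 = (-1) ^ length as * prod_list as" for as :: "complex list"
      by (induction as) auto
    have "of_rat (poly p 0) = poly (?h p) 0"
      using poly_h[of p 0] by simp
    also have "\<dots> = lead_coeff (?h p) * ((-1) ^ length as * prod_list as)"
      by (subst as(1)[symmetric]) (simp add: p0)
    also have "lead_coeff (?h p) = of_rat (lead_coeff p)" by simp
    finally have "of_rat (poly p 0) = of_rat (lead_coeff p) * ((-1) ^ length as * prod_list as)" .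
    then have "prod_list as = of_rat (poly p 0 / lead_coeff p * (-1) ^ length as)"
      using lc by (simp add: of_rat_divide of_rat_mult of_rat_power of_rat_minus divide_simps)
    then have "prod_list as \<in> \<rat>" by simp
    moreover have "algebraic_int (prod_list as)"
      using root root_as by (intro algebraic_int_prod_list) auto
    ultimately have "prod_list as \<in> \<int>" using rational_algebraic_int_is_int by blast
    then obtain z where z: "prod_list as = of_int z" by (elim Ints_cases)
    then have "z = 0" using small' by simp
    then have "0 \<in> set as" using z by (simp add: prod_list_zero_iff)
    then have "poly (?h p) 0 = 0" by (rule root_as)
    then have "poly p 0 = 0" using poly_h[of p 0] by simp
    then show False using no_root[of 0] nz by simp
  qed
qed

section \<open>Spectral decomposition of normal matrices\<close>

definition mat_trace :: "complex mat \<Rightarrow> complex" where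
  "mat_trace A = (\<Sum>i<dim_row A. A $$ (i,i))"

lemma mat_trace_mult_commute:
  assumes "A \<in> carrier_mat n n" "B \<in> carrier_mat n n"
  shows "mat_trace (A * B) = mat_trace (B * A)"
proof -
  have "mat_trace (A * B) = (\<Sum>i<n. \<Sum>k<n. A $$ (i,k) * B $$ (k,i))"
    using assms by (auto simp: mat_trace_def scalar_prod_def atLeast0LessThan intro!: sum.cong)
  also have "\<dots> = (\<Sum>k<n. \<Sum>i<n. A $$ (i,k) * B $$ (k,i))" by (rule sum.swap)
  also have "\<dots> = mat_trace (B * A)"
    using assms by (auto simp: mat_trace_def scalar_prod_def atLeast0LessThan mult.commute intro!: sum.cong)
  finally show ?thesis .
qed

text \<open>The eigenvalues are read off the diagonal of a Schur triangular form.\<close>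
lemma mat_trace_eq_sum_of_eigenvalues:
  assumes A: "A \<in> carrier_mat n n"
  obtains d :: "nat \<Rightarrow> complex" where "mat_trace A = (\<Sum>i<n. d i)" "\<And>i. i < n \<Longrightarrow> eigenvalue A (d i)"
proof -
  obtain es where es: "char_poly A = (\<Prod>a\<leftarrow>es. [:- a, 1:])"
    using char_poly_factorized[OF A] by blast
  obtain B where B: "B \<in> carrier_mat n n" "upper_triangular B" "similar_mat A B"
    using schur_decomposition_exists[OF A es] by blast
  obtain P Q where w: "similar_mat_wit A B P Q" using B(3) by (auto simp: similar_mat_def)
  note W = similar_mat_witD2[OF A w]
  have "mat_trace A = mat_trace (P * (B * Q))" using W by (simp add: assoc_mult_mat[of P n n B n Q n])
  also have "\<dots> = mat_trace ((B * Q) * P)" by (rule mat_trace_mult_commute) (use W in auto)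
  also have "(B * Q) * P = B" using W by (simp add: assoc_mult_mat[of B n n Q n P n])
  finally have "mat_trace A = (\<Sum>i<n. B $$ (i,i))" using B by (simp add: mat_trace_def)
  moreover have "eigenvalue A (B $$ (i,i))" if i: "i < n" for i
  proof -
    have "poly (char_poly A) (B $$ (i,i)) = poly (\<Prod>a\<leftarrow>diag_mat B. [:- a, 1:]) (B $$ (i,i))"
      using char_poly_similar[OF B(3)] char_poly_upper_triangular[OF B(1,2)] by simp
    also have "\<dots> = 0"
    proof -
      have mem: "B $$ (i,i) \<in> set (diag_mat B)" using i B by (auto simp: diag_mat_def)
      have "a \<in> set as \<Longrightarrow> poly (\<Prod>a\<leftarrow>as. [:- a, 1:]) a = 0" for a :: complex and as
        by (induction as) auto
      then show ?thesis using mem by blast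
    qed
    finally show ?thesis using eigenvalue_root_char_poly[OF A] by simp
  qed
  ultimately show ?thesis by (rule that)
qed

lemma eigenvalue_of_power_identity:
  assumes A: "A \<in> carrier_mat n n" and pow: "A ^\<^sub>m Suc N = (A :: complex mat)" and ev: "eigenvalue A k"
  shows "k ^ Suc N = k"
proof -
  obtain v where v: "eigenvector A v k" using ev by (auto simp: eigenvalue_def)
  then have vc: "v \<in> carrier_vec n" "v \<noteq> 0\<^sub>v n" "A *\<^sub>v v = k \<cdot>\<^sub>v v"
    using A by (auto simp: eigenvector_def)
  have eq: "k ^ Suc N \<cdot>\<^sub>v v = k \<cdot>\<^sub>v v"
    using eigenvector_pow[OF A v, of "Suc N"] unfolding pow vc(3) by (rule HOL.sym)
  obtain i where i: "i < n" "v $ i \<noteq> 0"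
    using vc by (metis carrier_vecD eq_vecI index_zero_vec)
  then have "(k ^ Suc N \<cdot>\<^sub>v v) $ i = (k \<cdot>\<^sub>v v) $ i" using eq by simp
  then show ?thesis using i vc by simp
qed

text \<open>The eigenvalues of such a matrix are zero or roots of unity.\<close>
lemma mat_trace_algebraic_int:
  assumes A: "A \<in> carrier_mat n n" and pow: "A ^\<^sub>m Suc N = A" and N: "N \<ge> 1"
  shows "algebraic_int (mat_trace A)"
proof -
  obtain d where d: "mat_trace A = (\<Sum>i<n. d i)" "\<And>i. i < n \<Longrightarrow> eigenvalue A (d i)"
    using mat_trace_eq_sum_of_eigenvalues[OF A] by blast
  have "algebraic_int (d i)" if "i < n" for i
  proof (cases "d i = 0")
    case False
    have "d i ^ Suc N = d i" by (rule eigenvalue_of_power_identity[OF A pow d(2)[OF that]])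
    then have "d i ^ N = 1" using False by simp
    then have "poly (monom 1 N) (d i) = 1" by (simp add: poly_monom)
    then show ?thesis
      by (rule algebraic_int_root[rotated]) (use N in \<open>simp_all add: degree_monom_eq\<close>)
  qed simp
  then show ?thesis unfolding d(1) by (intro algebraic_int_sum) auto
qed

lemma mat_trace_idempotent:
  assumes A: "A \<in> carrier_mat n n" and idem: "A * A = A"
  shows "mat_trace A \<in> \<nat>"
proof -
  obtain d where d: "mat_trace A = (\<Sum>i<n. d i)" "\<And>i. i < n \<Longrightarrow> eigenvalue A (d i)"
    using mat_trace_eq_sum_of_eigenvalues[OF A] by blast
  have pow: "A ^\<^sub>m Suc 1 = A" using A idem by simp
  have "d i \<in> \<nat>" if "i < n" for i
  proof -
    have "d i * d i = d i * 1"
      using eigenvalue_of_power_identity[OF A pow d(2)[OF that]] by simp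
    then have "d i = 0 \<or> d i = 1" by (simp only: mult_cancel_left)
    then show ?thesis by auto
  qed
  moreover have "finite I \<Longrightarrow> (\<And>i. i \<in> I \<Longrightarrow> f i \<in> \<nat>) \<Longrightarrow> sum f I \<in> (\<nat> :: complex set)"
    for I :: "nat set" and f
    by (induction I rule: finite_induct) auto
  ultimately show ?thesis unfolding d(1) by auto
qed

definition shift :: "complex mat \<Rightarrow> complex \<Rightarrow> complex mat" where
  "shift M w = M - w \<cdot>\<^sub>m 1\<^sub>m (dim_row M)"

lemma shift_carrier [simp, intro]: "M \<in> carrier_mat n n \<Longrightarrow> shift M w \<in> carrier_mat n n"
  unfolding shift_def by (intro minus_carrier_mat) auto

lemma shift_index:
  "M \<in> carrier_mat n n \<Longrightarrow> i < n \<Longrightarrow> j < n \<Longrightarrow>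
   shift M w $$ (i,j) = M $$ (i,j) - (if i = j then w else 0)"
  unfolding shift_def by auto

lemma shift_mult:
  assumes "M \<in> carrier_mat n n" "X \<in> carrier_mat n n"
  shows "shift M w * X = M * X - w \<cdot>\<^sub>m X"
proof -
  have "shift M w * X = M * X - (w \<cdot>\<^sub>m 1\<^sub>m n) * X"
    unfolding shift_def using assms by (simp add: minus_mult_distrib_mat[of M n n])
  also have "(w \<cdot>\<^sub>m 1\<^sub>m n) * X = w \<cdot>\<^sub>m X"
    using assms by (simp add: mult_smult_assoc_mat[of _ n n])
  finally show ?thesis .
qed

lemma mult_shift:
  assumes "M \<in> carrier_mat n n" "X \<in> carrier_mat n n"
  shows "X * shift M w = X * M - w \<cdot>\<^sub>m X"
proof -
  have "X * shift M w = X * M - X * (w \<cdot>\<^sub>m 1\<^sub>m n)"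
    unfolding shift_def using assms by (simp add: mult_minus_distrib_mat[of X n n M n])
  also have "X * (w \<cdot>\<^sub>m 1\<^sub>m n) = w \<cdot>\<^sub>m X"
    using assms by (simp add: mult_smult_distrib[OF assms(2) one_carrier_mat])
  finally show ?thesis .
qed

text \<open>The product \<open>(M - w\<^sub>k) \<dots> (M - w\<^sub>1) X\<close> for the list \<open>[w\<^sub>1, \<dots>, w\<^sub>k]\<close>. The argument \<open>X\<close> absorbs the factors
one at a time, which suits induction on the list.\<close>
fun shift_product :: "complex mat \<Rightarrow> complex list \<Rightarrow> complex mat \<Rightarrow> complex mat" where
  "shift_product M [] X = X"
| "shift_product M (w # ws) X = shift_product M ws (shift M w * X)"

lemma shift_product_carrier [simp]:
  "M \<in> carrier_mat n n \<Longrightarrow> X \<in> carrier_mat n n \<Longrightarrow> shift_product M ws X \<in> carrier_mat n n"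
  by (induction ws arbitrary: X) (simp_all add: mult_carrier_mat[of _ n n])

lemma shift_product_snoc:
  "M \<in> carrier_mat n n \<Longrightarrow> X \<in> carrier_mat n n \<Longrightarrow>
   shift_product M (ws @ [w]) X = shift M w * shift_product M ws X"
  by (induction ws arbitrary: X) (simp_all add: mult_carrier_mat[of _ n n])

lemma shift_product_similar:
  assumes "similar_mat_wit M B P Q" "M \<in> carrier_mat n n" "X \<in> carrier_mat n n"
  shows "shift_product M ws (P * X) = P * shift_product B ws X"
proof -
  note W = similar_mat_witD2[OF assms(2,1)]
  have P: "P \<in> carrier_mat n n" and Q: "Q \<in> carrier_mat n n" and B: "B \<in> carrier_mat n n"
    and QP: "Q * P = 1\<^sub>m n" and M: "M = P * B * Q" using W by auto
  have MP: "M * P = P * B"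
    unfolding M by (simp add: assoc_mult_mat[OF mult_carrier_mat[OF P B] Q P] QP)
      (use P B in simp)
  have step: "shift M w * (P * X) = P * (shift B w * X)" if X: "X \<in> carrier_mat n n" for w X
  proof -
    have "shift M w * (P * X) = (shift M w * P) * X"
      using P X assms(2) by (simp add: assoc_mult_mat[of "shift M w" n n P n X n])
    also have "shift M w * P = P * shift B w"
      using P B assms(2) MP by (simp add: shift_mult mult_shift)
    also have "\<dots> * X = P * (shift B w * X)"
      using P X B by (simp add: assoc_mult_mat[of P n n "shift B w" n X n])
    finally show ?thesis .
  qed
  show ?thesis using assms(3)
    by (induction ws arbitrary: X) (use assms(2) B in \<open>simp_all add: step mult_carrier_mat[of _ n n]\<close>)
qed

text \<open>Working through the diagonal from the bottom, every factor makes one more row vanish.\<close>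
lemma shift_product_upper_triangular:
  assumes B: "B \<in> carrier_mat n n" and ut: "upper_triangular B"
  shows "shift_product B (rev (diag_mat B)) (1\<^sub>m n) = 0\<^sub>m n n"
proof -
  have len: "length (diag_mat B) = n" using B by (simp add: diag_mat_def)
  have nth: "diag_mat B ! i = B $$ (i,i)" if "i < n" for i using that B by (simp add: diag_mat_def)
  have "k \<le> n \<Longrightarrow> \<forall>i j. n - k \<le> i \<longrightarrow> i < n \<longrightarrow> j < n \<longrightarrow>
      shift_product B (take k (rev (diag_mat B))) (1\<^sub>m n) $$ (i,j) = 0" for k
  proof (induction k)
    case (Suc k)
    let ?X = "shift_product B (take k (rev (diag_mat B))) (1\<^sub>m n)"
    let ?w = "B $$ (n - Suc k, n - Suc k)"
    have X: "?X \<in> carrier_mat n n" using B by simp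
    have "take (Suc k) (rev (diag_mat B)) = take k (rev (diag_mat B)) @ [?w]"
      using Suc.prems len by (simp add: take_Suc_conv_app_nth rev_nth nth)
    then have eq: "shift_product B (take (Suc k) (rev (diag_mat B))) (1\<^sub>m n) = shift B ?w * ?X"
      using B by (simp add: shift_product_snoc[of B n])
    show ?case
    proof (intro allI impI)
      fix i j assume ij: "n - Suc k \<le> i" "i < n" "j < n"
      have "(shift B ?w * ?X) $$ (i,j) = (\<Sum>l<n. shift B ?w $$ (i,l) * ?X $$ (l,j))"
        using ij shift_carrier[OF B, of ?w] X
        by (simp add: scalar_prod_def atLeast0LessThan del: shift_carrier)
      also have "\<dots> = 0"
      proof (rule sum.neutral, rule ballI)
        fix l assume "l \<in> {..<n}"
        then have l: "l < n" by simp
        show "shift B ?w $$ (i,l) * ?X $$ (l,j) = 0"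
        proof (cases "n - k \<le> l")
          case True
          then show ?thesis using Suc l ij by simp
        next
          case False
          have "shift B ?w $$ (i,l) = 0"
          proof (cases "l = i")
            case True
            then have "i = n - Suc k" using False ij by linarith
            then show ?thesis using True l B by (simp add: shift_index)
          next
            case ne: False
            then have "l < i" using False ij by linarith
            then show ?thesis using ut ij l B ne by (auto simp: upper_triangular_def shift_index)
          qed
          then show ?thesis by simp
        qed
      qed
      finally show "shift_product B (take (Suc k) (rev (diag_mat B))) (1\<^sub>m n) $$ (i,j) = 0" using eq by simp
    qed
  qed auto
  from this[of n] have "\<forall>i j. i < n \<longrightarrow> j < n \<longrightarrow> shift_product B (rev (diag_mat B)) (1\<^sub>m n) $$ (i,j) = 0"
    using len by simp
  then show ?thesis using shift_product_carrier[OF B one_carrier_mat, of "rev (diag_mat B)"] by (intro eq_matI) auto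
qed

text \<open>The theorem of Cayley and Hamilton in factored form, transported from a triangular form of \<open>M\<close>.\<close>
lemma shift_product_annihilates:
  assumes M: "M \<in> carrier_mat n n"
  obtains ws where "shift_product M ws (1\<^sub>m n) = 0\<^sub>m n n"
proof -
  obtain es where es: "char_poly M = (\<Prod>a\<leftarrow>es. [:- a, 1:])"
    using char_poly_factorized[OF M] by blast
  obtain B where B: "B \<in> carrier_mat n n" "upper_triangular B" "similar_mat M B"
    using schur_decomposition_exists[OF M es] by blast
  obtain P Q where w: "similar_mat_wit M B P Q" using B(3) by (auto simp: similar_mat_def)
  note W = similar_mat_witD2[OF M w]
  let ?ws = "rev (diag_mat B)"
  have "shift_product B ?ws Q = shift_product B ?ws (1\<^sub>m n) * Q"
  proof -
    have "X \<in> carrier_mat n n \<Longrightarrow> shift_product B ws (X * Q) = shift_product B ws X * Q" for X ws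
    proof (induction ws arbitrary: X)
      case (Cons w ws)
      let ?K = "shift B w"
      have "?K * (X * Q) = (?K * X) * Q"
        using Cons.prems B W(7) by (simp add: assoc_mult_mat[of ?K n n X n Q n])
      moreover have "shift_product B ws ((?K * X) * Q) = shift_product B ws (?K * X) * Q"
        by (rule Cons.IH) (use Cons.prems B in \<open>simp add: mult_carrier_mat[of _ n n]\<close>)
      ultimately show ?case using B by simp
    qed simp
    from this[of "1\<^sub>m n" ?ws] show ?thesis using W by simp
  qed
  also have "\<dots> = 0\<^sub>m n n" using W by (simp add: shift_product_upper_triangular[OF B(1,2)])
  finally have "P * shift_product B ?ws Q = 0\<^sub>m n n" using W by simp
  moreover have "shift_product M ?ws (P * Q) = P * shift_product B ?ws Q"
    by (rule shift_product_similar[OF w M]) (use W in auto)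
  ultimately have "shift_product M ?ws (1\<^sub>m n) = 0\<^sub>m n n" using W by simp
  then show ?thesis by (rule that)
qed


lemma mat_adjoint_eq:
  "mat_adjoint A = mat (dim_col A) (dim_row A) (\<lambda>(i,j). cnj (A $$ (j,i)))" for A :: "complex mat"
  by (intro eq_matI) (auto simp: mat_adjoint_def mat_of_rows_def)

lemma mat_adjoint_carrier [simp, intro]: "(A :: complex mat) \<in> carrier_mat n m \<Longrightarrow> mat_adjoint A \<in> carrier_mat m n"
  by (auto simp: mat_adjoint_eq)

lemma mat_adjoint_mult:
  fixes A B :: "complex mat"
  assumes "A \<in> carrier_mat n n" "B \<in> carrier_mat n n"
  shows "mat_adjoint (A * B) = mat_adjoint B * mat_adjoint A"
  using assms by (intro eq_matI) (auto simp: mat_adjoint_eq scalar_prod_def mult.commute)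

lemma mat_adjoint_mult_self_eq_0:
  fixes A :: "complex mat"
  assumes A: "A \<in> carrier_mat n n" and 0: "mat_adjoint A * A = 0\<^sub>m n n"
  shows "A = 0\<^sub>m n n"
proof (intro eq_matI)
  fix i j assume "i < dim_row (0\<^sub>m n n)" "j < dim_col (0\<^sub>m n n :: complex mat)"
  then have ij: "i < n" "j < n" by auto
  have "(mat_adjoint A * A) $$ (j,j) = (\<Sum>k<n. cnj (A $$ (k,j)) * A $$ (k,j))"
    using ij A by (simp add: mat_adjoint_eq scalar_prod_def atLeast0LessThan)
  also have "\<dots> = of_real (\<Sum>k<n. (cmod (A $$ (k,j)))\<^sup>2)"
    unfolding of_real_sum by (intro sum.cong HOL.refl) (simp only: complex_norm_square mult.commute)
  finally have "of_real (\<Sum>k<n. (cmod (A $$ (k,j)))\<^sup>2) = (0 :: complex)" using 0 ij by simp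
  then have "(\<Sum>k<n. (cmod (A $$ (k,j)))\<^sup>2) = 0" by (simp only: of_real_eq_0_iff)
  then have "(cmod (A $$ (i,j)))\<^sup>2 = 0"
    by (subst (asm) sum_nonneg_eq_0_iff) (use ij in auto)
  then show "A $$ (i,j) = 0\<^sub>m n n $$ (i,j)" using ij by simp
qed (use A in auto)

text \<open>A normal matrix has no nilpotent part. For \<open>W = K X\<close> and the adjoint \<open>K'\<close> of \<open>K\<close>, normality turns
\<open>(K' W)' (K' W)\<close> into \<open>W' K' K W\<close>, which is zero; so \<open>K' W = 0\<close>, and \<open>W' W = X' K' W = 0\<close>.\<close>
lemma normal_square_annihilates:
  fixes K X :: "complex mat"
  assumes K: "K \<in> carrier_mat n n" and X: "X \<in> carrier_mat n n"
    and normal: "mat_adjoint K * K = K * mat_adjoint K" and 0: "K * (K * X) = 0\<^sub>m n n"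
  shows "K * X = 0\<^sub>m n n"
proof -
  define W where "W = K * X"
  have W: "W \<in> carrier_mat n n" using K X by (simp add: W_def)
  have aK: "mat_adjoint K \<in> carrier_mat n n" and aW: "mat_adjoint W \<in> carrier_mat n n" and aX: "mat_adjoint X \<in> carrier_mat n n"
    using K W X by auto
  have aKW: "mat_adjoint K * W \<in> carrier_mat n n" using aK W by simp
  have aaK: "mat_adjoint (mat_adjoint K) = K" using K by (intro eq_matI) (auto simp: mat_adjoint_eq)
  have "mat_adjoint (mat_adjoint K * W) * (mat_adjoint K * W) = mat_adjoint W * (K * (mat_adjoint K * W))"
    using aK W K aW by (simp add: mat_adjoint_mult[OF aK W] aaK assoc_mult_mat[OF aW K aKW])
  also have "K * (mat_adjoint K * W) = (mat_adjoint K * K) * W"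
    using K aK W normal by (simp add: assoc_mult_mat[OF K aK W])
  also have "\<dots> = mat_adjoint K * (K * W)" using K aK W by (simp add: assoc_mult_mat[OF aK K W])
  also have "K * W = 0\<^sub>m n n" using 0 by (simp add: W_def)
  finally have "mat_adjoint (mat_adjoint K * W) * (mat_adjoint K * W) = 0\<^sub>m n n" using aK aW by simp
  then have z: "mat_adjoint K * W = 0\<^sub>m n n" by (rule mat_adjoint_mult_self_eq_0[OF aKW])
  have "mat_adjoint W * W = mat_adjoint X * (mat_adjoint K * W)"
    using K X W by (simp add: W_def mat_adjoint_mult[OF K X] assoc_mult_mat[OF aX aK mult_carrier_mat[OF K X]])
  also have "\<dots> = 0\<^sub>m n n" using z aX by simp
  finally show ?thesis using mat_adjoint_mult_self_eq_0[OF W] by (simp add: W_def)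
qed

lemma commute_shift:
  assumes "M \<in> carrier_mat n n" "A \<in> carrier_mat n n" "A * M = M * A"
  shows "A * shift M w = shift M w * A"
  using assms by (simp add: shift_mult mult_shift)

lemma shift_normal:
  assumes M: "M \<in> carrier_mat n n" and normal: "mat_adjoint M * M = M * mat_adjoint M"
  shows "mat_adjoint (shift M w) * shift M w = shift M w * mat_adjoint (shift M w)"
proof -
  have aM: "mat_adjoint M \<in> carrier_mat n n" using M by auto
  have eq: "mat_adjoint (shift M w) = shift (mat_adjoint M) (cnj w)"
    using M by (intro eq_matI) (auto simp: mat_adjoint_eq shift_def)
  have "mat_adjoint M * shift M w = shift M w * mat_adjoint M" by (rule commute_shift[OF M aM normal])
  then have "shift M w * shift (mat_adjoint M) (cnj w) = shift (mat_adjoint M) (cnj w) * shift M w"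
    by (intro commute_shift) (use M aM in auto)
  then show ?thesis by (simp add: eq)
qed

lemma shift_mult_eq_0_iff:
  assumes "M \<in> carrier_mat n n" "X \<in> carrier_mat n n"
  shows "shift M w * X = 0\<^sub>m n n \<longleftrightarrow> M * X = w \<cdot>\<^sub>m X"
proof -
  have MX: "M * X \<in> carrier_mat n n" using assms by simp
  have "M * X - w \<cdot>\<^sub>m X = 0\<^sub>m n n \<longleftrightarrow> M * X = w \<cdot>\<^sub>m X"
  proof
    assume eq: "M * X - w \<cdot>\<^sub>m X = 0\<^sub>m n n"
    show "M * X = w \<cdot>\<^sub>m X"
    proof (rule eq_matI)
      fix i j assume "i < dim_row (w \<cdot>\<^sub>m X)" "j < dim_col (w \<cdot>\<^sub>m X)"
      then have ij: "i < n" "j < n" using assms by auto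
      have "(M * X - w \<cdot>\<^sub>m X) $$ (i,j) = 0" using eq ij by simp
      then show "(M * X) $$ (i,j) = (w \<cdot>\<^sub>m X) $$ (i,j)" using ij assms MX by simp
    qed (use assms in auto)
  qed (use assms in \<open>auto intro!: eq_matI\<close>)
  then show ?thesis using assms by (simp add: shift_mult)
qed

definition mat_sum :: "nat \<Rightarrow> (complex \<Rightarrow> complex mat) \<Rightarrow> complex set \<Rightarrow> complex mat" where
  "mat_sum n f V = mat n n (\<lambda>ij. \<Sum>v\<in>V. f v $$ ij)"

lemma mat_sum_carrier [simp, intro]: "mat_sum n f V \<in> carrier_mat n n"
  by (simp add: mat_sum_def)

lemma mult_mat_sum:
  assumes A: "A \<in> carrier_mat n n" and f: "\<And>v. v \<in> V \<Longrightarrow> f v \<in> carrier_mat n n"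
  shows "A * mat_sum n f V = mat_sum n (\<lambda>v. A * f v) V"
proof (intro eq_matI)
  fix i j assume "i < dim_row (mat_sum n (\<lambda>v. A * f v) V)" "j < dim_col (mat_sum n (\<lambda>v. A * f v) V)"
  then have ij: "i < n" "j < n" by (auto simp: mat_sum_def)
  have "(A * mat_sum n f V) $$ (i,j) = (\<Sum>l<n. \<Sum>v\<in>V. A $$ (i,l) * f v $$ (l,j))"
    using ij A by (simp add: mat_sum_def scalar_prod_def atLeast0LessThan sum_distrib_left)
  also have "\<dots> = (\<Sum>v\<in>V. \<Sum>l<n. A $$ (i,l) * f v $$ (l,j))" by (rule sum.swap)
  also have "\<dots> = (\<Sum>v\<in>V. (A * f v) $$ (i,j))"
    using ij A f by (intro sum.cong HOL.refl) (force simp: scalar_prod_def atLeast0LessThan)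
  finally show "(A * mat_sum n f V) $$ (i,j) = mat_sum n (\<lambda>v. A * f v) V $$ (i,j)"
    using ij by (simp add: mat_sum_def)
qed (use A in \<open>auto simp: mat_sum_def\<close>)

lemma mat_sum_mult:
  assumes A: "A \<in> carrier_mat n n" and f: "\<And>v. v \<in> V \<Longrightarrow> f v \<in> carrier_mat n n"
  shows "mat_sum n f V * A = mat_sum n (\<lambda>v. f v * A) V"
proof (intro eq_matI)
  fix i j assume "i < dim_row (mat_sum n (\<lambda>v. f v * A) V)" "j < dim_col (mat_sum n (\<lambda>v. f v * A) V)"
  then have ij: "i < n" "j < n" by (auto simp: mat_sum_def)
  have "(mat_sum n f V * A) $$ (i,j) = (\<Sum>l<n. \<Sum>v\<in>V. f v $$ (i,l) * A $$ (l,j))"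
    using ij A by (simp add: mat_sum_def scalar_prod_def atLeast0LessThan sum_distrib_right)
  also have "\<dots> = (\<Sum>v\<in>V. \<Sum>l<n. f v $$ (i,l) * A $$ (l,j))" by (rule sum.swap)
  also have "\<dots> = (\<Sum>v\<in>V. (f v * A) $$ (i,j))"
    using ij A f by (intro sum.cong HOL.refl) (force simp: scalar_prod_def atLeast0LessThan)
  finally show "(mat_sum n f V * A) $$ (i,j) = mat_sum n (\<lambda>v. f v * A) V $$ (i,j)"
    using ij by (simp add: mat_sum_def)
qed (use A in \<open>auto simp: mat_sum_def\<close>)

lemma mat_sum_cong:
  "(\<And>v. v \<in> V \<Longrightarrow> f v = g v) \<Longrightarrow> mat_sum n f V = mat_sum n g V"
  unfolding mat_sum_def by (auto intro!: sum.cong)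

text \<open>The case \<open>X = 1\<close> is the resolution of the identity into spectral projections of a normal matrix.
The general \<open>X\<close> carries the induction on \<open>ws\<close>: the decomposition of \<open>(M - w) X\<close>, with the part for
\<open>v\<close> divided by \<open>v - w\<close>, is subtracted from \<open>X\<close>, and the rest is annihilated by \<open>(M - w)\<^sup>2\<close>, hence by
\<open>M - w\<close>. The clause on commuting matrices records that the parts are built from \<open>M\<close> and \<open>X\<close> alone, so
that every symmetry of \<open>M\<close> is a symmetry of its spectral projections.\<close>
lemma normal_spectral_decomposition:
  assumes M: "M \<in> carrier_mat n n" and normal: "mat_adjoint M * M = M * mat_adjoint M"
  shows "X \<in> carrier_mat n n \<Longrightarrow> shift_product M ws X = 0\<^sub>m n n \<Longrightarrow>
    \<exists>e. (\<forall>w\<in>set ws. e w \<in> carrier_mat n n \<and> M * e w = w \<cdot>\<^sub>m e w \<and>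
          (\<forall>A\<in>carrier_mat n n. A * M = M * A \<longrightarrow> A * X = X * A \<longrightarrow> A * e w = e w * A)) \<and>
        X = mat_sum n e (set ws)"
proof (induction ws arbitrary: X)
  case Nil
  then show ?case by (intro exI[of _ "\<lambda>_. 0\<^sub>m n n"] conjI) (auto simp: mat_sum_def intro!: eq_matI)
next
  case (Cons w ws)
  let ?K = "shift M w"
  let ?Y = "?K * X"
  note X = Cons.prems(1)
  have K: "?K \<in> carrier_mat n n" by (rule shift_carrier[OF M])
  have Y: "?Y \<in> carrier_mat n n" by (rule mult_carrier_mat[OF K X])
  have "shift_product M ws ?Y = 0\<^sub>m n n" using Cons.prems by simp
  from Cons.IH[OF Y this] obtain e where
    E: "\<forall>w\<in>set ws. e w \<in> carrier_mat n n \<and> M * e w = w \<cdot>\<^sub>m e w \<and>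
          (\<forall>A\<in>carrier_mat n n. A * M = M * A \<longrightarrow> A * ?Y = ?Y * A \<longrightarrow> A * e w = e w * A)"
    and Ysum: "?Y = mat_sum n e (set ws)" by blast
  have
    e: "\<And>v. v \<in> set ws \<Longrightarrow> e v \<in> carrier_mat n n" "\<And>v. v \<in> set ws \<Longrightarrow> M * e v = v \<cdot>\<^sub>m e v"
    and com: "\<And>v A. v \<in> set ws \<Longrightarrow> A \<in> carrier_mat n n \<Longrightarrow> A * M = M * A \<Longrightarrow> A * ?Y = ?Y * A \<Longrightarrow> A * e v = e v * A"
    using E by blast+
  define V where "V = set ws - {w}"
  define f where "f v = (1 / (v - w)) \<cdot>\<^sub>m e v" for v
  have f: "f v \<in> carrier_mat n n" if "v \<in> V" for v using that e by (simp add: f_def V_def)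
  have Kf: "?K * f v = e v" if v: "v \<in> V" for v
  proof -
    have ev: "e v \<in> carrier_mat n n" "M * e v = v \<cdot>\<^sub>m e v" "v \<noteq> w" using v e by (auto simp: V_def)
    have "?K * e v = (v - w) \<cdot>\<^sub>m e v"
      using ev M by (auto simp: shift_mult left_diff_distrib intro!: eq_matI)
    then show ?thesis using ev K unfolding f_def
      by (auto simp: mult_smult_distrib[OF K ev(1)] intro!: eq_matI)
  qed
  define S where "S = mat_sum n f V"
  define Z where "Z = X - S"
  have S: "S \<in> carrier_mat n n" by (simp add: S_def)
  have Z: "Z \<in> carrier_mat n n" unfolding Z_def by (rule minus_carrier_mat[OF S])
  have KS: "?K * S = mat_sum n e V"
    unfolding S_def using f Kf by (subst mult_mat_sum[OF K]) (auto intro: mat_sum_cong)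
  have KZ: "?K * Z = ?Y - mat_sum n e V"
    unfolding Z_def using KS by (simp add: mult_minus_distrib_mat[OF K X S])
  \<comment> \<open>A repeated \<open>w\<close> leaves the part \<open>e w\<close>, which cannot be divided by \<open>w - w\<close>; it is an eigenvector for \<open>w\<close>,
    so \<open>M - w\<close> annihilates it.\<close>
  define e0 where "e0 = (if w \<in> set ws then e w else 0\<^sub>m n n)"
  have e0: "e0 \<in> carrier_mat n n" "M * e0 = w \<cdot>\<^sub>m e0"
    using e M by (auto simp: e0_def intro!: eq_matI)
  have "?K * Z = e0"
  proof (cases "w \<in> set ws")
    case True
    then have sw: "set ws = insert w V" "w \<notin> V" "finite V" by (auto simp: V_def)
    show ?thesis unfolding KZ Ysum sw(1)
      using True e0 sw(2,3) by (auto simp: mat_sum_def e0_def intro!: eq_matI)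
  next
    case False
    then have "set ws = V" by (auto simp: V_def)
    then show ?thesis unfolding KZ Ysum using False by (auto simp: mat_sum_def e0_def intro!: eq_matI)
  qed
  then have "?K * (?K * Z) = 0\<^sub>m n n" using e0 shift_mult_eq_0_iff[OF M e0(1)] by simp
  then have KZ0: "?K * Z = 0\<^sub>m n n"
    by (intro normal_square_annihilates[OF K Z shift_normal[OF M normal]])
  then have MZ: "M * Z = w \<cdot>\<^sub>m Z" using shift_mult_eq_0_iff[OF M Z] by simp
  define e' where "e' v = (if v = w then Z else f v)" for v
  have in_V: "v \<in> V" if "v \<in> set (w # ws)" "v \<noteq> w" for v using that by (auto simp: V_def)
  show ?case
  proof (intro exI[of _ e'] conjI ballI impI)
    fix v assume v: "v \<in> set (w # ws)"
    show "e' v \<in> carrier_mat n n" using v in_V f Z by (auto simp: e'_def)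
    show "M * e' v = v \<cdot>\<^sub>m e' v"
    proof (cases "v = w")
      case True then show ?thesis using MZ by (simp add: e'_def)
    next
      case False
      then have "v \<in> set ws" using v by simp
      then show ?thesis using e[of v] M False
        by (auto simp: e'_def f_def mult_smult_distrib[of M n n] intro!: eq_matI)
    qed
    fix A assume A: "A \<in> carrier_mat n n" "A * M = M * A" "A * X = X * A"
    have AK: "A * ?K = ?K * A" by (rule commute_shift[OF M A(1,2)])
    have "A * ?Y = (A * ?K) * X" using A K X by (simp add: assoc_mult_mat[OF A(1) K X])
    also have "\<dots> = ?K * (A * X)" unfolding AK using A K X by (simp add: assoc_mult_mat[OF K A(1) X])
    also have "\<dots> = ?Y * A" unfolding A(3) using A K X by (simp add: assoc_mult_mat[OF K X A(1)])
    finally have AY: "A * ?Y = ?Y * A" .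
    have Af: "A * f u = f u * A" if "u \<in> V" for u
    proof -
      have u: "u \<in> set ws" using that by (simp add: V_def)
      show ?thesis unfolding f_def
        using com[OF u A(1,2) AY] e(1)[OF u] A(1)
        by (simp add: mult_smult_distrib[OF A(1) e(1)[OF u]] mult_smult_assoc_mat[OF e(1)[OF u] A(1)])
    qed
    have "A * S = S * A" unfolding S_def
      using f Af A(1) by (simp add: mult_mat_sum mat_sum_mult cong: mat_sum_cong)
    then have "A * Z = Z * A" unfolding Z_def
      using A(3) by (simp add: mult_minus_distrib_mat[OF A(1) X S] minus_mult_distrib_mat[OF X S A(1)])
    then show "A * e' v = e' v * A" using Af in_V[OF v] by (auto simp: e'_def)
  next
    have sw: "set (w # ws) = insert w V" "w \<notin> V" "finite V" by (auto simp: V_def)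
    have "X = mat_sum n e' (insert w V)"
    proof (intro eq_matI)
      fix i j assume "i < dim_row (mat_sum n e' (insert w V))" "j < dim_col (mat_sum n e' (insert w V))"
      then have ij: "i < n" "j < n" by (auto simp: mat_sum_def)
      have "(\<Sum>v\<in>V. e' v $$ (i,j)) = (\<Sum>v\<in>V. f v $$ (i,j))"
        using sw by (intro sum.cong HOL.refl) (auto simp: e'_def)
      then show "X $$ (i,j) = mat_sum n e' (insert w V) $$ (i,j)"
        using ij sw X S by (simp add: mat_sum_def e'_def Z_def S_def)
    qed (use X in \<open>auto simp: mat_sum_def\<close>)
    then show "X = mat_sum n e' (set (w # ws))" using sw by simp
  qed
qed

section \<open>Spectral projections of an integer kernel\<close>

definition kernel_eigenvalue :: "'s set \<Rightarrow> ('s \<Rightarrow> 's \<Rightarrow> int) \<Rightarrow> complex \<Rightarrow> bool" where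
  "kernel_eigenvalue S m z \<longleftrightarrow>
     (\<exists>f. (\<exists>x\<in>S. f x \<noteq> 0) \<and> (\<forall>x\<in>S. (\<Sum>w\<in>S. of_int (m x w) * f w) = z * f x))"

lemma mat_pow_commuting_idempotent:
  assumes U: "U \<in> carrier_mat n n" and e: "e \<in> carrier_mat n n"
    and com: "U * e = e * U" and idem: "e * e = (e :: complex mat)"
  shows "(U * e) ^\<^sub>m Suc k = U ^\<^sub>m Suc k * e"
proof (induction k)
  case (Suc k)
  have Uk: "U ^\<^sub>m Suc k \<in> carrier_mat n n" using U by (rule pow_carrier_mat)
  have Ue: "U * e \<in> carrier_mat n n" using U e by simp
  have "(U * e) ^\<^sub>m Suc (Suc k) = (U ^\<^sub>m Suc k * e) * (U * e)" using Suc by simp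
  also have "\<dots> = U ^\<^sub>m Suc k * (e * (U * e))" by (rule assoc_mult_mat[OF Uk e Ue])
  also have "e * (U * e) = U * e"
    using com idem assoc_mult_mat[OF e U e] assoc_mult_mat[OF U e e] by simp
  also have "U ^\<^sub>m Suc k * (U * e) = U ^\<^sub>m Suc (Suc k) * e"
    using assoc_mult_mat[OF Uk U e] by simp
  finally show ?case .
qed (use U e in simp)

text \<open>The spectral theorem for an integer matrix \<open>m\<close> with rows and columns indexed by \<open>S\<close>, stated without
an enumeration of \<open>S\<close>. Here \<open>\<Omega>\<close> is the spectrum, \<open>E \<omega>\<close> is the projection to the eigenspace of
\<open>\<omega>\<close>, and the roots of the rational polynomial \<open>g\<close> are the eigenvalues, so that the spectrum is closed
under conjugation over the rationals. Permutations \<open>\<pi>\<close> of \<open>S\<close> that preserve \<open>m\<close> commute with the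
projections. Therefore \<open>\<pi>\<close> times \<open>E \<omega>\<close> has only roots of unity and zero as eigenvalues, and its trace is
an algebraic integer.\<close>
locale kernel_spectrum =
  fixes S :: "'s set" and m :: "'s \<Rightarrow> 's \<Rightarrow> int" and \<Omega> :: "complex set"
    and E :: "complex \<Rightarrow> 's \<Rightarrow> 's \<Rightarrow> complex" and g :: "rat poly"
  assumes finite_spectrum: "finite \<Omega>"
    and g_nonzero: "g \<noteq> 0"
    and root_iff: "\<And>z. poly (map_poly of_rat g) z = 0 \<longleftrightarrow> kernel_eigenvalue S m z"
    and spectrum_algebraic_int: "\<And>\<omega>. \<omega> \<in> \<Omega> \<Longrightarrow> algebraic_int \<omega>"
    and spectrum_eigenvalue: "\<And>\<omega>. \<omega> \<in> \<Omega> \<Longrightarrow> kernel_eigenvalue S m \<omega>"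
    and eigen: "\<And>\<omega> x y. \<omega> \<in> \<Omega> \<Longrightarrow> x \<in> S \<Longrightarrow> y \<in> S \<Longrightarrow> (\<Sum>w\<in>S. of_int (m x w) * E \<omega> w y) = \<omega> * E \<omega> x y"
    and resolution: "\<And>x y. x \<in> S \<Longrightarrow> y \<in> S \<Longrightarrow> (\<Sum>\<omega>\<in>\<Omega>. E \<omega> x y) = (if x = y then 1 else 0)"
    and invariant: "\<And>\<omega> \<pi> x y. \<omega> \<in> \<Omega> \<Longrightarrow> bij_betw \<pi> S S \<Longrightarrow> (\<And>x y. x \<in> S \<Longrightarrow> y \<in> S \<Longrightarrow> m (\<pi> x) (\<pi> y) = m x y) \<Longrightarrow>
        x \<in> S \<Longrightarrow> y \<in> S \<Longrightarrow> E \<omega> (\<pi> x) (\<pi> y) = E \<omega> x y"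
    and trace_Nats: "\<And>\<omega>. \<omega> \<in> \<Omega> \<Longrightarrow> (\<Sum>x\<in>S. E \<omega> x x) \<in> \<nat>"
    and twisted_trace: "\<And>\<omega> \<pi> N. \<omega> \<in> \<Omega> \<Longrightarrow> bij_betw \<pi> S S \<Longrightarrow> (\<And>x y. x \<in> S \<Longrightarrow> y \<in> S \<Longrightarrow> m (\<pi> x) (\<pi> y) = m x y) \<Longrightarrow>
        N \<ge> 1 \<Longrightarrow> (\<And>x. x \<in> S \<Longrightarrow> (\<pi> ^^ N) x = x) \<Longrightarrow> algebraic_int (\<Sum>x\<in>S. E \<omega> (\<pi> x) x)"

text \<open>The hypothesis says that the integer matrix commutes with its transpose, which is its adjoint.\<close>
theorem kernel_spectrum_exists:
  fixes S :: "'s set" and m :: "'s \<Rightarrow> 's \<Rightarrow> int"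
  assumes fin: "finite S"
    and normal: "\<And>x y. x \<in> S \<Longrightarrow> y \<in> S \<Longrightarrow> (\<Sum>w\<in>S. m x w * m y w) = (\<Sum>w\<in>S. m w x * m w y)"
  shows "\<exists>\<Omega> E g. kernel_spectrum S m \<Omega> E g"
proof -
  define n where "n = card S"
  obtain e where e: "bij_betw e {0..<n} S"
    using ex_bij_betw_nat_finite[OF fin] unfolding n_def by blast
  define d where "d = the_inv_into {0..<n} e"
  have inj: "inj_on e {0..<n}" using e by (simp add: bij_betw_def)
  have eS: "e i \<in> S" if "i < n" for i using e that by (auto simp: bij_betw_def)
  have dn: "d x < n" and ed: "e (d x) = x" if "x \<in> S" for x
    using e that the_inv_into_into[OF inj, of x "{0..<n}"] f_the_inv_into_f[OF inj, of x]
    by (auto simp: bij_betw_def d_def)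
  have de: "d (e i) = i" if "i < n" for i
    using the_inv_into_f_f[OF inj, of i] that by (simp add: d_def)
  have sumS: "(\<Sum>x\<in>S. h x) = (\<Sum>i<n. h (e i))" for h :: "'s \<Rightarrow> complex"
    using sum.reindex_bij_betw[OF e, of h] by (simp add: atLeast0LessThan)
  define B where "B = mat n n (\<lambda>(i,j). m (e i) (e j))"
  define M where "M = map_mat complex_of_int B"
  have B: "B \<in> carrier_mat n n" by (simp add: B_def)
  have M: "M \<in> carrier_mat n n" by (simp add: M_def B_def)
  have Mi: "M $$ (i,j) = of_int (m (e i) (e j))" if "i < n" "j < n" for i j
    using that by (simp add: M_def B_def)
  have normalM: "mat_adjoint M * M = M * mat_adjoint M"
  proof (rule eq_matI)
    fix i j assume "i < dim_row (M * mat_adjoint M)" "j < dim_col (M * mat_adjoint M)"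
    then have ij: "i < n" "j < n" using M by (auto simp: mat_adjoint_eq)
    have sumSi: "(\<Sum>x\<in>S. h x) = (\<Sum>i<n. h (e i))" for h :: "'s \<Rightarrow> int"
      using sum.reindex_bij_betw[OF e, of h] by (simp add: atLeast0LessThan)
    have "(mat_adjoint M * M) $$ (i,j) = of_int (\<Sum>k<n. m (e k) (e i) * m (e k) (e j))"
      using ij M by (simp add: mat_adjoint_eq scalar_prod_def atLeast0LessThan Mi)
    also have "(\<Sum>k<n. m (e k) (e i) * m (e k) (e j)) = (\<Sum>k<n. m (e i) (e k) * m (e j) (e k))"
      using normal[OF eS[OF ij(1)] eS[OF ij(2)]] by (simp add: sumSi)
    also have "of_int \<dots> = (M * mat_adjoint M) $$ (i,j)"
      using ij M by (simp add: mat_adjoint_eq scalar_prod_def atLeast0LessThan Mi)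
    finally show "(mat_adjoint M * M) $$ (i,j) = (M * mat_adjoint M) $$ (i,j)" .
  qed (use M in \<open>auto simp: mat_adjoint_eq\<close>)
  have eigen: "kernel_eigenvalue S m z \<longleftrightarrow> eigenvalue M z" for z
  proof
    assume "kernel_eigenvalue S m z"
    then obtain f x where f: "x \<in> S" "f x \<noteq> 0"
      "\<And>x. x \<in> S \<Longrightarrow> (\<Sum>w\<in>S. of_int (m x w) * f w) = z * f x" by (auto simp: kernel_eigenvalue_def)
    define v where "v = vec n (\<lambda>i. f (e i))"
    have "v $ d x \<noteq> 0" using f dn ed by (simp add: v_def)
    then have "v \<noteq> 0\<^sub>v n" using dn[OF f(1)] by auto
    moreover have "M *\<^sub>v v = z \<cdot>\<^sub>v v"
    proof (rule eq_vecI)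
      fix i assume "i < dim_vec (z \<cdot>\<^sub>v v)"
      then have i: "i < n" by (simp add: v_def)
      show "(M *\<^sub>v v) $ i = (z \<cdot>\<^sub>v v) $ i"
        using i M f(3)[OF eS[OF i]] by (simp add: v_def scalar_prod_def sumS atLeast0LessThan Mi)
    qed (use M in \<open>auto simp: v_def\<close>)
    ultimately show "eigenvalue M z"
      unfolding eigenvalue_def eigenvector_def using M by (intro exI[of _ v]) (auto simp: v_def)
  next
    assume "eigenvalue M z"
    then obtain v where v: "v \<in> carrier_vec n" "v \<noteq> 0\<^sub>v n" "M *\<^sub>v v = z \<cdot>\<^sub>v v"
      using M by (auto simp: eigenvalue_def eigenvector_def)
    obtain i where i: "i < n" "v $ i \<noteq> 0"
      using v by (metis carrier_vecD eq_vecI index_zero_vec)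
    show "kernel_eigenvalue S m z" unfolding kernel_eigenvalue_def
    proof (intro exI[of _ "\<lambda>x. v $ d x"] conjI ballI)
      show "\<exists>x\<in>S. v $ d x \<noteq> 0" using i eS de by (intro bexI[of _ "e i"]) auto
      fix x assume x: "x \<in> S"
      have "(\<Sum>w\<in>S. of_int (m x w) * v $ d w) = (M *\<^sub>v v) $ d x"
        using v(1) M dn[OF x] by (simp add: scalar_prod_def sumS atLeast0LessThan Mi de ed[OF x])
      also have "\<dots> = (z \<cdot>\<^sub>v v) $ d x" by (simp only: v(3))
      also have "\<dots> = z * v $ d x" using v dn[OF x] by simp
      finally show "(\<Sum>w\<in>S. of_int (m x w) * v $ d w) = z * v $ d x" .
    qed
  qed
  define g where "g = char_poly (map_mat (of_int :: int \<Rightarrow> rat) B)"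
  have cB: "map_mat (of_int :: int \<Rightarrow> rat) B \<in> carrier_mat n n" using B by simp
  have g0: "g \<noteq> 0" using degree_monic_char_poly[OF cB] by (auto simp: g_def)
  have "map_poly of_rat g = char_poly (map_mat of_rat (map_mat (of_int :: int \<Rightarrow> rat) B) :: complex mat)"
    unfolding g_def by (rule of_rat_hom.char_poly_hom[OF cB, symmetric])
  also have "map_mat of_rat (map_mat (of_int :: int \<Rightarrow> rat) B) = M"
    by (intro eq_matI) (auto simp: M_def)
  finally have gM: "map_poly of_rat g = char_poly M" .
  have groot: "poly (map_poly of_rat g) z = 0 \<longleftrightarrow> kernel_eigenvalue S m z" for z
    unfolding gM eigen by (rule eigenvalue_root_char_poly[OF M, symmetric])
  obtain ws where ws: "shift_product M ws (1\<^sub>m n) = 0\<^sub>m n n" by (rule shift_product_annihilates[OF M])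
  obtain P where P: "\<forall>w\<in>set ws. P w \<in> carrier_mat n n \<and> M * P w = w \<cdot>\<^sub>m P w \<and>
          (\<forall>A\<in>carrier_mat n n. A * M = M * A \<longrightarrow> A * 1\<^sub>m n = 1\<^sub>m n * A \<longrightarrow> A * P w = P w * A)"
      and Psum: "1\<^sub>m n = mat_sum n P (set ws)"
    using normal_spectral_decomposition[OF M normalM one_carrier_mat ws] by blast
  have Pc: "P w \<in> carrier_mat n n" and PM: "M * P w = w \<cdot>\<^sub>m P w" if "w \<in> set ws" for w
    using P that by auto
  have Pcom: "A * P w = P w * A" if "w \<in> set ws" "A \<in> carrier_mat n n" "A * M = M * A" for w A
    using P that by auto
  \<comment> \<open>\<open>P v\<close> commutes with \<open>M\<close>, so \<open>M\<close> acts on \<open>P v P w\<close> both as \<open>v\<close> and as \<open>w\<close>.\<close>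
  have orth: "P v * P w = 0\<^sub>m n n" if "v \<in> set ws" "w \<in> set ws" "v \<noteq> w" for v w
  proof -
    note c = Pc[OF that(1)] Pc[OF that(2)]
    have c2: "P v * P w \<in> carrier_mat n n" using c by simp
    have "v \<cdot>\<^sub>m (P v * P w) = (M * P v) * P w" using c by (simp add: PM[OF that(1)] mult_smult_assoc_mat[OF c])
    also have "\<dots> = (P v * M) * P w" using Pcom[OF that(1) M] by simp
    also have "\<dots> = P v * (M * P w)" by (rule assoc_mult_mat[OF c(1) M c(2)])
    also have "\<dots> = w \<cdot>\<^sub>m (P v * P w)" by (simp add: PM[OF that(2)] mult_smult_distrib[OF c])
    finally have eq: "v \<cdot>\<^sub>m (P v * P w) = w \<cdot>\<^sub>m (P v * P w)" .
    show ?thesis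
    proof (rule eq_matI)
      fix i j assume "i < dim_row (0\<^sub>m n n)" "j < dim_col (0\<^sub>m n n :: complex mat)"
      then have ij: "i < n" "j < n" by auto
      have "(v \<cdot>\<^sub>m (P v * P w)) $$ (i,j) = (w \<cdot>\<^sub>m (P v * P w)) $$ (i,j)" using eq by simp
      then have "v * (P v * P w) $$ (i,j) = w * (P v * P w) $$ (i,j)" using ij c2 c by (simp del: index_mult_mat(1))
      then show "(P v * P w) $$ (i,j) = 0\<^sub>m n n $$ (i,j)" using that ij by (simp del: index_mult_mat(1))
    qed (use c in auto)
  qed
  have idem: "P w * P w = P w" if w: "w \<in> set ws" for w
  proof -
    note c = Pc[OF w]
    have "P w = mat_sum n P (set ws) * P w" using c by (simp flip: Psum)
    also have "\<dots> = mat_sum n (\<lambda>v. P v * P w) (set ws)" by (rule mat_sum_mult[OF c Pc])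
    also have "\<dots> = mat_sum n (\<lambda>v. if v = w then P w * P w else 0\<^sub>m n n) (set ws)"
      by (rule mat_sum_cong) (use orth w in auto)
    also have "\<dots> = P w * P w"
    proof (rule eq_matI)
      fix i j assume "i < dim_row (P w * P w)" "j < dim_col (P w * P w)"
      then have ij: "i < n" "j < n" using c by auto
      have "(\<Sum>v\<in>set ws. (if v = w then P w * P w else 0\<^sub>m n n) $$ (i,j))
          = (\<Sum>v\<in>set ws. if v = w then (P w * P w) $$ (i,j) else 0)"
        using ij by (intro sum.cong HOL.refl) auto
      also have "\<dots> = (P w * P w) $$ (i,j)" using w by simp
      finally show "mat_sum n (\<lambda>v. if v = w then P w * P w else 0\<^sub>m n n) (set ws) $$ (i,j) = (P w * P w) $$ (i,j)"
        using ij by (simp add: mat_sum_def)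
    qed (use c in \<open>auto simp: mat_sum_def\<close>)
    finally show ?thesis by simp
  qed
  define \<Omega> where "\<Omega> = {w \<in> set ws. P w \<noteq> 0\<^sub>m n n}"
  define E where "E w x y = P w $$ (d x, d y)" for w x y
  have \<Omega>ws: "w \<in> set ws" if "w \<in> \<Omega>" for w using that by (simp add: \<Omega>_def)
  have E_eq: "(\<Sum>w\<in>S. of_int (m x w) * E \<omega> w y) = \<omega> * E \<omega> x y"
    if "\<omega> \<in> \<Omega>" "x \<in> S" "y \<in> S" for \<omega> x y
  proof -
    note c = Pc[OF \<Omega>ws[OF that(1)]]
    have "(\<Sum>w\<in>S. of_int (m x w) * E \<omega> w y) = (M * P \<omega>) $$ (d x, d y)"
      using M c dn that by (simp add: sumS scalar_prod_def atLeast0LessThan Mi de ed E_def)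
    also have "\<dots> = \<omega> * E \<omega> x y"
      using c dn that by (simp add: PM[OF \<Omega>ws[OF that(1)]] E_def)
    finally show ?thesis .
  qed
  have \<Omega>_eigen: "kernel_eigenvalue S m \<omega>" if w: "\<omega> \<in> \<Omega>" for \<omega>
  proof -
    note c = Pc[OF \<Omega>ws[OF w]]
    have "\<exists>i j. i < n \<and> j < n \<and> P \<omega> $$ (i,j) \<noteq> 0"
    proof (rule ccontr)
      assume "\<nexists>i j. i < n \<and> j < n \<and> P \<omega> $$ (i,j) \<noteq> 0"
      then have "P \<omega> = 0\<^sub>m n n" using c by (intro eq_matI) auto
      then show False using w by (simp add: \<Omega>_def)
    qed
    then obtain i j where ij: "i < n" "j < n" "P \<omega> $$ (i,j) \<noteq> 0" by blast
    show ?thesis unfolding kernel_eigenvalue_def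
      using ij eS E_eq[OF w _ eS[OF ij(2)]]
      by (intro exI[of _ "\<lambda>x. E \<omega> x (e j)"]) (auto simp: E_def de intro!: bexI[of _ "e i"])
  qed
  \<comment> \<open>\<open>U\<close> is the permutation matrix of \<open>\<pi>\<close>; multiplication by it permutes rows or columns.\<close>
  have U: "\<exists>U. U \<in> carrier_mat n n \<and> U * M = M * U \<and>
      (\<forall>A\<in>carrier_mat n n. \<forall>i<n. \<forall>j<n. (U * A) $$ (i,j) = A $$ (d (\<pi> (e i)), j)
          \<and> (A * U) $$ (i, d (\<pi> (e j))) = A $$ (i,j))
      \<and> (\<forall>k. U ^\<^sub>m k = mat n n (\<lambda>(i,j). if e j = (\<pi> ^^ k) (e i) then 1 else 0))"
    if \<pi>: "bij_betw \<pi> S S" and inv: "\<And>x y. x \<in> S \<Longrightarrow> y \<in> S \<Longrightarrow> m (\<pi> x) (\<pi> y) = m x y" for \<pi>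
  proof -
    define U :: "complex mat" where "U = mat n n (\<lambda>(i,j). if e j = \<pi> (e i) then 1 else 0)"
    have Uc: "U \<in> carrier_mat n n" by (simp add: U_def)
    have \<pi>S: "\<pi> x \<in> S" if "x \<in> S" for x using \<pi> that by (auto simp: bij_betw_def)
    have UA: "(U * A) $$ (i,j) = A $$ (d (\<pi> (e i)), j)"
      if "A \<in> carrier_mat n n" "i < n" "j < n" for A i j
    proof -
      have "(U * A) $$ (i,j) = (\<Sum>k<n. (if e k = \<pi> (e i) then 1 else 0) * A $$ (k,j))"
        using that by (simp add: U_def scalar_prod_def atLeast0LessThan)
      also have "\<dots> = (\<Sum>k<n. if k = d (\<pi> (e i)) then A $$ (k,j) else 0)"
        using that \<pi>S eS de ed by (intro sum.cong HOL.refl) (auto, metis)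
      also have "\<dots> = A $$ (d (\<pi> (e i)), j)" using that \<pi>S eS dn by simp
      finally show ?thesis .
    qed
    have AU: "(A * U) $$ (i, d (\<pi> (e j))) = A $$ (i,j)"
      if "A \<in> carrier_mat n n" "i < n" "j < n" for A i j
    proof -
      have dj: "d (\<pi> (e j)) < n" using that \<pi>S eS dn by simp
      have "(A * U) $$ (i, d (\<pi> (e j))) = (\<Sum>k<n. A $$ (i,k) * (if \<pi> (e j) = \<pi> (e k) then 1 else 0))"
        using that dj \<pi>S eS ed by (simp add: U_def scalar_prod_def atLeast0LessThan)
      also have "\<dots> = (\<Sum>k<n. if k = j then A $$ (i,k) else 0)"
      proof (rule sum.cong[OF HOL.refl])
        fix k assume "k \<in> {..<n}"
        then have k: "k < n" by simp
        have "\<pi> (e j) = \<pi> (e k) \<longleftrightarrow> k = j"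
          using \<pi> k that eS inj by (auto simp: bij_betw_def inj_on_def)
        then show "A $$ (i,k) * (if \<pi> (e j) = \<pi> (e k) then 1 else 0) = (if k = j then A $$ (i,k) else 0)" by simp
      qed
      also have "\<dots> = A $$ (i,j)" using that by simp
      finally show ?thesis .
    qed
    have "U * M = M * U"
    proof (rule eq_matI)
      fix i j assume "i < dim_row (M * U)" "j < dim_col (M * U)"
      then have ij: "i < n" "j < n" using M Uc by auto
      have "e j \<in> \<pi> ` S" using \<pi> eS[OF ij(2)] by (simp add: bij_betw_def)
      then obtain x where x: "x \<in> S" "e j = \<pi> x" by blast
      define k where "k = d x"
      have k: "k < n" "e k = x" using x dn ed by (auto simp: k_def)
      then have j: "j = d (\<pi> (e k))" using x de[OF ij(2)] by simp
      have "(U * M) $$ (i,j) = of_int (m (\<pi> (e i)) (\<pi> (e k)))"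
        using UA[OF M ij] Mi[OF dn ij(2)] \<pi>S eS ij ed x k by simp
      also have "\<dots> = of_int (m (e i) (e k))" using inv[OF eS[OF ij(1)] x(1)] k by simp
      also have "\<dots> = (M * U) $$ (i,j)" using AU[OF M ij(1) k(1)] Mi ij k j by simp
      finally show "(U * M) $$ (i,j) = (M * U) $$ (i,j)" .
    qed (use M Uc in auto)
    moreover have "U ^\<^sub>m k = mat n n (\<lambda>(i,j). if e j = (\<pi> ^^ k) (e i) then 1 else 0)" for k
    proof (induction k)
      case 0
      show ?case using Uc inj by (auto simp: inj_on_def intro!: eq_matI)
    next
      case (Suc k)
      have Uk: "U ^\<^sub>m k \<in> carrier_mat n n" using Uc by (rule pow_carrier_mat)
      show ?case
      proof (rule eq_matI)
        fix i j assume "i < dim_row (mat n n (\<lambda>(i,j). if e j = (\<pi> ^^ Suc k) (e i) then 1 else (0::complex)))"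
          "j < dim_col (mat n n (\<lambda>(i,j). if e j = (\<pi> ^^ Suc k) (e i) then 1 else (0::complex)))"
        then have ij: "i < n" "j < n" by auto
        have "e j \<in> \<pi> ` S" using \<pi> eS[OF ij(2)] by (simp add: bij_betw_def)
        then obtain x where x: "x \<in> S" "e j = \<pi> x" by blast
        define l where "l = d x"
        have l: "l < n" "e l = x" using x dn ed by (auto simp: l_def)
        then have j: "j = d (\<pi> (e l))" using x de[OF ij(2)] by simp
        have kS: "(\<pi> ^^ k) (e i) \<in> S" using eS[OF ij(1)] by (induction k) (auto intro: \<pi>S)
        have "(U ^\<^sub>m Suc k) $$ (i,j) = (U ^\<^sub>m k) $$ (i,l)" using AU[OF Uk ij(1) l(1)] j by simp
        also have "\<dots> = (if e l = (\<pi> ^^ k) (e i) then 1 else 0)" using ij l by (simp add: Suc.IH)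
        also have "e l = (\<pi> ^^ k) (e i) \<longleftrightarrow> e j = (\<pi> ^^ Suc k) (e i)"
          using x l kS \<pi> by (auto simp: bij_betw_def inj_on_def)
        finally show "(U ^\<^sub>m Suc k) $$ (i,j) = mat n n (\<lambda>(i,j). if e j = (\<pi> ^^ Suc k) (e i) then 1 else 0) $$ (i,j)"
          using ij by simp
      qed (use Uc Uk in auto)
    qed
    ultimately show ?thesis using Uc UA AU by (intro exI[of _ U]) auto
  qed
  have E_inv: "E \<omega> (\<pi> x) (\<pi> y) = E \<omega> x y"
    if "\<omega> \<in> \<Omega>" "bij_betw \<pi> S S" "\<And>x y. x \<in> S \<Longrightarrow> y \<in> S \<Longrightarrow> m (\<pi> x) (\<pi> y) = m x y" "x \<in> S" "y \<in> S"
    for \<omega> \<pi> x y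
  proof -
    note c = Pc[OF \<Omega>ws[OF that(1)]]
    note ex = U[OF that(2,3)]
    obtain U where UM: "U \<in> carrier_mat n n" "U * M = M * U"
      and UA: "\<forall>A\<in>carrier_mat n n. \<forall>i<n. \<forall>j<n. (U * A) $$ (i,j) = A $$ (d (\<pi> (e i)), j)
          \<and> (A * U) $$ (i, d (\<pi> (e j))) = A $$ (i,j)"
      using ex by blast
    have \<pi>S: "\<pi> u \<in> S" if "u \<in> S" for u using \<open>bij_betw \<pi> S S\<close> that by (auto simp: bij_betw_def)
    have "E \<omega> (\<pi> x) (\<pi> y) = (U * P \<omega>) $$ (d x, d (\<pi> y))"
      using UA c dn \<pi>S ed that(4,5) by (simp add: E_def)
    also have "U * P \<omega> = P \<omega> * U" by (rule Pcom[OF \<Omega>ws[OF that(1)] UM])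
    also have "\<dots> $$ (d x, d (\<pi> y)) = P \<omega> $$ (d x, d y)"
      using UA c dn[OF that(4)] dn[OF that(5)] ed[OF that(5)] by (metis (no_types))
    finally show ?thesis by (simp add: E_def)
  qed
  have E_tr: "(\<Sum>x\<in>S. E \<omega> (\<pi> x) x) = mat_trace (U * P \<omega>)"
    if "\<omega> \<in> \<Omega>" "U \<in> carrier_mat n n"
      "\<forall>A\<in>carrier_mat n n. \<forall>i<n. \<forall>j<n. (U * A) $$ (i,j) = A $$ (d (\<pi> (e i)), j)" for \<omega> U \<pi>
    using that Pc[OF \<Omega>ws[OF that(1)]] by (simp add: sumS mat_trace_def E_def de)
  have "kernel_spectrum S m \<Omega> E g"
  proof
    show "finite \<Omega>" by (simp add: \<Omega>_def)
    show "algebraic_int \<omega>" if "\<omega> \<in> \<Omega>" for \<omega>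
      using \<Omega>_eigen[OF that] eigenvalue_of_integer_matrix_is_algebraic_int[OF B, of \<omega>]
      unfolding eigen M_def by blast
    show "(\<Sum>\<omega>\<in>\<Omega>. E \<omega> x y) = (if x = y then 1 else 0)" if "x \<in> S" "y \<in> S" for x y
    proof -
      have "(\<Sum>\<omega>\<in>\<Omega>. E \<omega> x y) = (\<Sum>\<omega>\<in>set ws. E \<omega> x y)"
        by (rule sum.mono_neutral_left) (use dn that in \<open>auto simp: \<Omega>_def E_def\<close>)
      also have "\<dots> = mat_sum n P (set ws) $$ (d x, d y)" using dn that by (simp add: mat_sum_def E_def)
      also have "\<dots> = (if d x = d y then 1 else 0)" using dn that by (simp flip: Psum)
      finally show ?thesis using ed that by metis
    qed
    show "(\<Sum>x\<in>S. E \<omega> x x) \<in> \<nat>" if "\<omega> \<in> \<Omega>" for \<omega>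
    proof -
      note c = Pc[OF \<Omega>ws[OF that]]
      have "(\<Sum>x\<in>S. E \<omega> x x) = mat_trace (P \<omega>)" using c by (simp add: sumS mat_trace_def E_def de)
      then show ?thesis using mat_trace_idempotent[OF c idem[OF \<Omega>ws[OF that]]] by simp
    qed
    show "algebraic_int (\<Sum>x\<in>S. E \<omega> (\<pi> x) x)"
      if w: "\<omega> \<in> \<Omega>" and \<pi>: "bij_betw \<pi> S S" "\<And>x y. x \<in> S \<Longrightarrow> y \<in> S \<Longrightarrow> m (\<pi> x) (\<pi> y) = m x y"
        and N: "N \<ge> 1" "\<And>x. x \<in> S \<Longrightarrow> (\<pi> ^^ N) x = x" for \<omega> \<pi> N
    proof -
      note c = Pc[OF \<Omega>ws[OF w]]
      obtain U where U: "U \<in> carrier_mat n n" "U * M = M * U"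
        and UA: "\<forall>A\<in>carrier_mat n n. \<forall>i<n. \<forall>j<n. (U * A) $$ (i,j) = A $$ (d (\<pi> (e i)), j)"
        and UN: "U ^\<^sub>m N = mat n n (\<lambda>(i,j). if e j = (\<pi> ^^ N) (e i) then 1 else 0)"
        using U[OF \<pi>] by blast
      have "U ^\<^sub>m N = 1\<^sub>m n" unfolding UN using N(2) eS inj by (intro eq_matI) (auto simp: inj_on_def)
      then have "(U * P \<omega>) ^\<^sub>m Suc N = U * P \<omega>"
        using mat_pow_commuting_idempotent[OF U(1) c Pcom[OF \<Omega>ws[OF w] U] idem[OF \<Omega>ws[OF w]], of N] U(1) by simp
      then have "algebraic_int (mat_trace (U * P \<omega>))"
        using mat_trace_algebraic_int[of "U * P \<omega>" n N] U(1) c N(1) by simp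
      then show ?thesis using E_tr[OF w U(1) UA] by simp
    qed
  qed (fact g0 groot \<Omega>_eigen E_eq E_inv)+
  then show ?thesis by blast
qed

section \<open>Conjugacy classes of prime power size\<close>

text \<open>Nilpotency modulo \<open>q\<close> in the ring of algebraic integers is membership in all prime ideals above
\<open>q\<close>. It is closed under sums, and no such ideal has to be constructed.\<close>
definition nilpotent_mod :: "nat \<Rightarrow> complex \<Rightarrow> bool" where
  "nilpotent_mod q t \<longleftrightarrow> algebraic_int t \<and> (\<exists>N b. algebraic_int b \<and> t ^ N = of_nat q * b)"

lemma nilpotent_mod_add:
  assumes "nilpotent_mod q t" "nilpotent_mod q u"
  shows "nilpotent_mod q (t + u)"
proof -
  obtain i b where t: "algebraic_int t" "algebraic_int b" "t ^ i = of_nat q * b"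
    using assms(1) by (auto simp: nilpotent_mod_def)
  obtain j c where u: "algebraic_int u" "algebraic_int c" "u ^ j = of_nat q * c"
    using assms(2) by (auto simp: nilpotent_mod_def)
  have "\<exists>a. algebraic_int a \<and> of_nat ((i+j) choose k) * t ^ k * u ^ (i+j-k) = of_nat q * a"
    if "k \<le> i + j" for k
  proof (cases "i \<le> k")
    case True
    then have "t ^ k = of_nat q * (b * t ^ (k - i))"
      using t(3) by (metis le_add_diff_inverse mult.assoc power_add)
    then show ?thesis using t u
      by (intro exI[of _ "of_nat ((i+j) choose k) * (b * t ^ (k - i)) * u ^ (i+j-k)"])
         (auto intro!: algebraic_int_mult algebraic_int_power)
  next
    case False
    then have "i + j - k = j + (i - k)" by simp
    then have "u ^ (i + j - k) = of_nat q * (c * u ^ (i - k))"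
      using u(3) by (simp add: power_add)
    then show ?thesis using t u
      by (intro exI[of _ "of_nat ((i+j) choose k) * t ^ k * (c * u ^ (i-k))"])
         (auto intro!: algebraic_int_mult algebraic_int_power)
  qed
  then obtain a where a: "\<And>k. k \<le> i + j \<Longrightarrow> algebraic_int (a k)"
    "\<And>k. k \<le> i + j \<Longrightarrow> of_nat ((i+j) choose k) * t ^ k * u ^ (i+j-k) = of_nat q * a k" by metis
  have "(t + u) ^ (i + j) = (\<Sum>k\<le>i+j. of_nat q * a k)"
    using a(2) by (simp add: binomial_ring)
  also have "\<dots> = of_nat q * (\<Sum>k\<le>i+j. a k)" by (simp add: sum_distrib_left)
  finally have "(t + u) ^ (i + j) = of_nat q * (\<Sum>k\<le>i+j. a k)" .
  moreover have "algebraic_int (\<Sum>k\<le>i+j. a k)" using a(1) by (intro algebraic_int_sum) auto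
  ultimately show ?thesis using t(1) u(1) by (auto simp: nilpotent_mod_def intro: algebraic_int_add)
qed

lemma nilpotent_mod_sum:
  "finite I \<Longrightarrow> (\<And>i. i \<in> I \<Longrightarrow> nilpotent_mod q (t i)) \<Longrightarrow> nilpotent_mod q (sum t I)"
proof (induction I rule: finite_induct)
  case empty
  have "(0::complex) ^ 1 = of_nat q * 0" by simp
  then show ?case unfolding nilpotent_mod_def sum.empty by (metis algebraic_int_0)
qed (auto intro: nilpotent_mod_add)

lemma not_nilpotent_mod_minus_one:
  assumes "q > 1" shows "\<not> nilpotent_mod q (- 1 :: complex)"
proof
  assume "nilpotent_mod q (- 1 :: complex)"
  then obtain N and b :: complex where b: "algebraic_int b" "(-1) ^ N = of_nat q * b"
    by (auto simp: nilpotent_mod_def)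
  then have "b = of_rat ((-1) ^ N / of_nat q)" using assms
    by (simp add: of_rat_divide of_rat_power of_rat_minus field_simps)
  then have "b \<in> \<rat>" by simp
  then have "b \<in> \<int>" using b rational_algebraic_int_is_int by blast
  then obtain k where "b = of_int k" by (elim Ints_cases)
  then have "of_int ((-1) ^ N) = (of_int (int q * k) :: complex)" using b by simp
  then have "(-1) ^ N = int q * k" by (simp only: of_int_eq_iff)
  then have "int q dvd 1" by (metis dvd_triv_left minus_one_power_iff dvd_minus_iff)
  then show False using assms by simp
qed

text \<open>The equality case of the triangle inequality: the numbers \<open>\<bar>u\<bar>\<^sup>2 - Re (cnj u * f h)\<close> are non-negative and
their sum is zero.\<close>
lemma complex_average_extremal:
  fixes u :: complex and f :: "'i \<Rightarrow> complex"
  assumes "finite C" "\<And>h. h \<in> C \<Longrightarrow> cmod (f h) \<le> cmod u" "(\<Sum>h\<in>C. f h) = of_nat (card C) * u" "h \<in> C"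
  shows "f h = u"
proof -
  define r where "r h = (cmod u)\<^sup>2 - Re (cnj u * f h)" for h
  have r0: "r h \<ge> 0" if "h \<in> C" for h
  proof -
    have "Re (cnj u * f h) \<le> cmod (cnj u * f h)" by (rule complex_Re_le_cmod)
    also have "\<dots> \<le> cmod u * cmod u" using assms(2)[OF that] by (simp add: norm_mult mult_left_mono)
    finally show ?thesis by (simp add: r_def power2_eq_square)
  qed
  have "(\<Sum>h\<in>C. r h) = of_nat (card C) * (cmod u)\<^sup>2 - Re (cnj u * (\<Sum>h\<in>C. f h))"
    by (simp add: r_def sum_subtractf sum_distrib_left Re_sum)
  also have "cnj u * (\<Sum>h\<in>C. f h) = of_nat (card C) * of_real ((cmod u)\<^sup>2)"
    using complex_norm_square[of u] by (simp add: assms(3))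
  finally have "(\<Sum>h\<in>C. r h) = 0" by simp
  then have "r h = 0" using r0 assms(1,4) by (simp add: sum_nonneg_eq_0_iff)
  then have re: "Re (cnj u * f h) = (cmod u)\<^sup>2" by (simp add: r_def)
  have "(cmod (f h - u))\<^sup>2 = (cmod (f h))\<^sup>2 + (cmod u)\<^sup>2 - 2 * Re (cnj u * f h)"
    unfolding cmod_power2 by (simp add: power2_eq_square algebra_simps)
  also have "\<dots> \<le> 0" using power_mono[OF assms(2)[OF assms(4)], of 2] unfolding re by simp
  finally show ?thesis by simp
qed

context group
begin

definition conj_class :: "'a \<Rightarrow> 'a set" where
  "conj_class z = (\<lambda>k. k \<otimes> z \<otimes> inv k) ` carrier G"

lemma inv_mult_cancel [simp]:
  "x \<in> carrier G \<Longrightarrow> y \<in> carrier G \<Longrightarrow> inv x \<otimes> (x \<otimes> y) = y"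
  "x \<in> carrier G \<Longrightarrow> y \<in> carrier G \<Longrightarrow> x \<otimes> (inv x \<otimes> y) = y"
  by (simp_all flip: m_assoc)

lemma bij_left_mult: "g \<in> carrier G \<Longrightarrow> bij_betw (\<lambda>x. g \<otimes> x) (carrier G) (carrier G)"
  by (rule bij_betwI[where g = "\<lambda>x. inv g \<otimes> x"]) auto

lemma bij_right_mult: "g \<in> carrier G \<Longrightarrow> bij_betw (\<lambda>x. x \<otimes> g) (carrier G) (carrier G)"
  by (rule bij_betwI[where g = "\<lambda>x. x \<otimes> inv g"]) (auto simp: m_assoc)

lemma conj_class_carrier: "z \<in> carrier G \<Longrightarrow> conj_class z \<subseteq> carrier G"
  by (auto simp: conj_class_def)

lemma conj_class_conj:
  assumes "z \<in> carrier G" "h \<in> conj_class z" "k \<in> carrier G"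
  shows "k \<otimes> h \<otimes> inv k \<in> conj_class z"
proof -
  obtain l where l: "l \<in> carrier G" "h = l \<otimes> z \<otimes> inv l" using assms by (auto simp: conj_class_def)
  have "k \<otimes> h \<otimes> inv k = (k \<otimes> l) \<otimes> z \<otimes> inv (k \<otimes> l)"
    using assms l by (simp add: inv_mult_group m_assoc)
  then show ?thesis using assms l by (auto simp: conj_class_def)
qed

lemma conj_class_conj_iff:
  assumes "z \<in> carrier G" "h \<in> carrier G" "k \<in> carrier G"
  shows "k \<otimes> h \<otimes> inv k \<in> conj_class z \<longleftrightarrow> h \<in> conj_class z"
proof
  assume "k \<otimes> h \<otimes> inv k \<in> conj_class z"
  from conj_class_conj[OF assms(1) this, of "inv k"] show "h \<in> conj_class z"
    using assms by (simp add: m_assoc)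
qed (use assms conj_class_conj in auto)

text \<open>A maximum principle. Where \<open>\<bar>f\<bar>\<close> is maximal, the sum over \<open>C\<close> is as large as it can be, so that
\<open>f (h x) = \<zeta> f x\<close> with the same \<open>\<zeta>\<close> for all \<open>h\<close> in \<open>C\<close>. Hence \<open>f\<close> is invariant under all quotients
\<open>h\<^sup>-\<^sup>1 h'\<close>, and these generate the group.\<close>
lemma extremal_eigenfunction_constant:
  assumes fin: "finite (carrier G)" and C: "C \<subseteq> carrier G" "C \<noteq> {}"
    and gen: "generate G {inv h \<otimes> h' |h h'. h \<in> C \<and> h' \<in> C} = carrier G"
    and f: "\<And>x. x \<in> carrier G \<Longrightarrow> (\<Sum>h\<in>C. f (h \<otimes> x)) = \<omega> * f x"
    and nz: "x1 \<in> carrier G" "f x1 \<noteq> (0::complex)"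
    and big: "cmod \<omega> \<ge> card C"
  shows "\<omega> = of_nat (card C)" "\<And>x y. x \<in> carrier G \<Longrightarrow> y \<in> carrier G \<Longrightarrow> f x = f y"
proof -
  define c where "c = card C"
  have finC: "finite C" using fin C finite_subset by blast
  have c0: "c > 0" using finC C by (simp add: c_def card_gt_0_iff)
  obtain x0 where x0: "x0 \<in> carrier G" "\<And>x. x \<in> carrier G \<Longrightarrow> cmod (f x) \<le> cmod (f x0)"
  proof -
    have "Max ((\<lambda>x. cmod (f x)) ` carrier G) \<in> (\<lambda>x. cmod (f x)) ` carrier G"
      using fin nz by (intro Max_in) auto
    then obtain x0 where "x0 \<in> carrier G" "cmod (f x0) = Max ((\<lambda>x. cmod (f x)) ` carrier G)" by auto
    then show ?thesis using fin by (intro that[of x0]) auto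
  qed
  define u where "u = cmod (f x0)"
  have u0: "u > 0" using x0(2)[OF nz(1)] nz(2) unfolding u_def
    by (meson less_le_trans zero_less_norm_iff)
  have hC: "h \<otimes> x \<in> carrier G" if "h \<in> C" "x \<in> carrier G" for h x using that C by auto
  have "cmod \<omega> * u = cmod (\<Sum>h\<in>C. f (h \<otimes> x0))" using f[OF x0(1)] by (simp add: u_def norm_mult)
  also have "\<dots> \<le> (\<Sum>h\<in>C. u)" using x0 hC by (intro sum_norm_le) (auto simp: u_def)
  finally have "cmod \<omega> \<le> c" using u0 by (simp add: c_def)
  then have mod_\<omega>: "cmod \<omega> = c" using big by (simp add: c_def)
  define \<zeta> where "\<zeta> = \<omega> / c"
  have \<zeta>: "cmod \<zeta> = 1" using c0 by (simp add: \<zeta>_def norm_divide mod_\<omega>)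
  define A where "A = {x \<in> carrier G. cmod (f x) = u}"
  have finA: "finite A" using fin by (simp add: A_def)
  have step: "f (h \<otimes> x) = \<zeta> * f x" "h \<otimes> x \<in> A" if "x \<in> A" "h \<in> C" for x h
  proof -
    have x: "x \<in> carrier G" "cmod (f x) = u" using that by (auto simp: A_def)
    show eq: "f (h \<otimes> x) = \<zeta> * f x"
    proof (rule complex_average_extremal[OF finC _ _ that(2)])
      show "cmod (f (h \<otimes> x)) \<le> cmod (\<zeta> * f x)" if "h \<in> C" for h
        using x0(2)[OF hC[OF that x(1)]] x by (simp add: norm_mult \<zeta> u_def)
      show "(\<Sum>h\<in>C. f (h \<otimes> x)) = of_nat (card C) * (\<zeta> * f x)"
        using f[OF x(1)] c0 by (simp add: \<zeta>_def c_def)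
    qed
    show "h \<otimes> x \<in> A" using that hC[OF that(2) x(1)] x by (simp add: A_def eq norm_mult \<zeta>)
  qed
  have pull: "\<exists>y'\<in>A. y = g \<otimes> y'" if "g \<in> carrier G" "\<And>x. x \<in> A \<Longrightarrow> g \<otimes> x \<in> A" "y \<in> A" for g y
  proof -
    have "inj_on (\<lambda>x. g \<otimes> x) A" using that(1) by (auto simp: inj_on_def A_def)
    then have "(\<lambda>x. g \<otimes> x) ` A = A" using that(2) finA by (intro endo_inj_surj) auto
    then show ?thesis using that(3) by blast
  qed
  have D: "\<forall>x\<in>A. g \<otimes> x \<in> A \<and> f (g \<otimes> x) = f x"
    if "g \<in> generate G {inv h \<otimes> h' |h h'. h \<in> C \<and> h' \<in> C}" for g
    using that
  proof (induction rule: generate.induct)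
    case one
    then show ?case by (auto simp: A_def)
  next
    case (incl g)
    then obtain h h' where g: "g = inv h \<otimes> h'" "h \<in> C" "h' \<in> C" by blast
    have hc: "h \<in> carrier G" "h' \<in> carrier G" using g C by auto
    show ?case
    proof
      fix x assume x: "x \<in> A"
      then have xc: "x \<in> carrier G" by (simp add: A_def)
      obtain y where y: "y \<in> A" "h' \<otimes> x = h \<otimes> y"
        using pull[OF hc(1) step(2)[OF _ g(2)] step(2)[OF x g(3)]] by blast
      have yc: "y \<in> carrier G" using y by (simp add: A_def)
      have "g \<otimes> x = inv h \<otimes> (h' \<otimes> x)" using hc xc unfolding g(1) by (simp add: m_assoc)
      also have "\<dots> = y" using y hc yc by simp
      finally have gx: "g \<otimes> x = y" .
      have "\<zeta> * f y = \<zeta> * f x" using step(1)[OF y(1) g(2)] step(1)[OF x g(3)] y(2) by simp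
      then have "f y = f x" using \<zeta> by auto
      then show "g \<otimes> x \<in> A \<and> f (g \<otimes> x) = f x" using gx y by simp
    qed
  next
    case (inv g)
    then obtain h h' where g: "g = inv h \<otimes> h'" "h \<in> C" "h' \<in> C" by blast
    have hc: "h \<in> carrier G" "h' \<in> carrier G" using g C by auto
    have eq: "inv g = inv h' \<otimes> h" using hc unfolding g(1) by (simp add: inv_mult_group)
    show ?case
    proof
      fix x assume x: "x \<in> A"
      then have xc: "x \<in> carrier G" by (simp add: A_def)
      obtain y where y: "y \<in> A" "h \<otimes> x = h' \<otimes> y"
        using pull[OF hc(2) step(2)[OF _ g(3)] step(2)[OF x g(2)]] by blast
      have yc: "y \<in> carrier G" using y by (simp add: A_def)
      have "inv g \<otimes> x = inv h' \<otimes> (h \<otimes> x)" using eq hc xc by (simp add: m_assoc)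
      also have "\<dots> = y" using y hc yc by simp
      finally have gx: "inv g \<otimes> x = y" .
      have "\<zeta> * f y = \<zeta> * f x" using step(1)[OF y(1) g(3)] step(1)[OF x g(2)] y(2) by simp
      then have "f y = f x" using \<zeta> by auto
      then show "inv g \<otimes> x \<in> A \<and> f (inv g \<otimes> x) = f x" using gx y by simp
    qed
  next
    case (eng g1 g2)
    have "{inv h \<otimes> h' |h h'. h \<in> C \<and> h' \<in> C} \<subseteq> carrier G" using C by auto
    then have gc: "g1 \<in> carrier G" "g2 \<in> carrier G" using eng generate_in_carrier by blast+
    then show ?case using eng.IH by (auto simp: A_def m_assoc)
  qed
  have const: "f x = f x0" if x: "x \<in> carrier G" for x
  proof -
    have "x \<otimes> inv x0 \<in> generate G {inv h \<otimes> h' |h h'. h \<in> C \<and> h' \<in> C}" using gen x x0 by simp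
    from D[OF this] have "f (x \<otimes> inv x0 \<otimes> x0) = f x0" using x0 by (auto simp: A_def u_def)
    then show ?thesis using x x0 by (simp add: m_assoc)
  qed
  show "f x = f y" if "x \<in> carrier G" "y \<in> carrier G" for x y using const that by metis
  have "(\<Sum>h\<in>C. f (h \<otimes> x0)) = (\<Sum>h\<in>C. f x0)"
    by (rule sum.cong) (use const[OF hC] x0(1) in auto)
  then have "\<omega> * f x0 = of_nat c * f x0" using f[OF x0(1)] by (simp add: c_def)
  then show "\<omega> = of_nat (card C)" using u0 by (auto simp: u_def c_def)
qed

text \<open>This replaces the character-theoretic lemma in Burnside's theorem. Suppose that the quotients
generate the group. The class sum of \<open>C = conj_class z\<close>, acting on the functions on the group, is a
normal integer matrix that commutes with left and right translations. For its spectral projection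
\<open>E \<omega>\<close>, let \<open>D\<close> be the trace of \<open>E \<omega>\<close>, let \<open>T\<close> be the trace of \<open>E \<omega>\<close> followed by the translation by
\<open>z\<close>, and let \<open>\<tau>\<close> be the trace of \<open>E \<omega>\<close> followed by the translation by \<open>z\<close> on both sides. They are
algebraic integers, \<open>D\<close> is a natural number, and averaging over the class gives \<open>\<bar>C\<bar> T = \<omega> D\<close> and
\<open>\<bar>C\<bar> \<tau> = \<omega> T\<close>, so \<open>T\<^sup>2 = D \<tau>\<close>.

If \<open>q\<close> divides \<open>D\<close>, it divides \<open>T\<^sup>2\<close>. Otherwise \<open>D\<close> is coprime to \<open>\<bar>C\<bar>\<close>, and \<open>\<omega> / \<bar>C\<bar>\<close> is an integral
combination of \<open>\<omega>\<close> and \<open>T\<close>, hence an algebraic integer. By the maximum principle every eigenvalue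
other than \<open>\<bar>C\<bar>\<close> is smaller than \<open>\<bar>C\<bar>\<close> in absolute value, so for \<open>\<omega> \<noteq> \<bar>C\<bar>\<close> all conjugates of this
quotient are small, and it vanishes together with \<open>T\<close>. In both cases \<open>T\<close> is nilpotent modulo \<open>q\<close>.
But \<open>T = 1\<close> for \<open>\<omega> = \<bar>C\<bar>\<close>, and the sum of all \<open>T\<close> is the trace of the translation by \<open>z \<noteq> 1\<close>, which
is zero. So \<open>- 1\<close> would be nilpotent modulo \<open>q\<close>.\<close>
theorem prime_power_class_differences_generate_proper:
  assumes fin: "finite (carrier G)" and z: "z \<in> carrier G" "z \<noteq> \<one>"
    and q: "prime (q::nat)" and card: "card (conj_class z) = q ^ k"
  shows "generate G {inv h \<otimes> h' |h h'. h \<in> conj_class z \<and> h' \<in> conj_class z} \<noteq> carrier G"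
proof
  assume gen: "generate G {inv h \<otimes> h' |h h'. h \<in> conj_class z \<and> h' \<in> conj_class z} = carrier G"
  define C where "C = conj_class z"
  define S where "S = carrier G"
  define c where "c = card C"
  have finS: "finite S" using fin by (simp add: S_def)
  have CS: "C \<subseteq> S" using conj_class_carrier[OF z(1)] by (simp add: C_def S_def)
  have finC: "finite C" using CS finS finite_subset by blast
  have zC: "z \<in> C" using z by (auto simp: C_def conj_class_def intro!: image_eqI[of _ _ \<one>])
  have c0: "c > 0" using zC finC by (auto simp: c_def card_gt_0_iff)
  have ck: "c = q ^ k" using card by (simp add: c_def C_def)
  have [simp]: "x \<in> carrier G" if "x \<in> S" for x using that by (simp add: S_def)
  have mS [simp]: "x \<otimes> y \<in> S" if "x \<in> S" "y \<in> S" for x y using that by (simp add: S_def)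
  have iS [simp]: "inv x \<in> S" if "x \<in> S" for x using that by (simp add: S_def)
  have oS [simp]: "\<one> \<in> S" by (simp add: S_def)
  have zS [simp]: "z \<in> S" using z by (simp add: S_def)
  have hS [simp]: "h \<in> S" if "h \<in> C" for h using CS that by auto
  have Cconj: "j \<otimes> h \<otimes> inv j \<in> C \<longleftrightarrow> h \<in> C" if "h \<in> S" "j \<in> S" for h j
    using conj_class_conj_iff[OF z(1)] that by (simp add: C_def S_def)
  define m :: "'a \<Rightarrow> 'a \<Rightarrow> int" where "m x y = (if y \<otimes> inv x \<in> C then 1 else 0)" for x y
  \<comment> \<open>The substitution \<open>w \<mapsto> y w\<^sup>-\<^sup>1 x\<close> matches the two sums up to a conjugation, which preserves \<open>C\<close>.\<close>
  have normal: "(\<Sum>w\<in>S. m x w * m y w) = (\<Sum>w\<in>S. m w x * m w y)" if xy: "x \<in> S" "y \<in> S" for x y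
  proof -
    let ?\<phi> = "\<lambda>w. y \<otimes> inv w \<otimes> x"
    have bij: "bij_betw ?\<phi> S S"
    proof (rule bij_betwI[where g = "\<lambda>w. x \<otimes> inv w \<otimes> y"])
      fix w assume w: "w \<in> S"
      show "x \<otimes> inv (y \<otimes> inv w \<otimes> x) \<otimes> y = w" "y \<otimes> inv (x \<otimes> inv w \<otimes> y) \<otimes> x = w"
        using w xy by (simp_all add: inv_mult_group m_assoc)
    qed (use xy in auto)
    have "(\<Sum>w\<in>S. m w x * m w y) = (\<Sum>w\<in>S. m (?\<phi> w) x * m (?\<phi> w) y)"
      by (rule sum.reindex_bij_betw[OF bij, symmetric])
    also have "\<dots> = (\<Sum>w\<in>S. m x w * m y w)"
    proof (rule sum.cong[OF HOL.refl])
      fix w assume w: "w \<in> S"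
      have 1: "x \<otimes> inv (?\<phi> w) = w \<otimes> inv y" using w xy by (simp add: inv_mult_group m_assoc)
      have "y \<otimes> inv (?\<phi> w) = (y \<otimes> inv x) \<otimes> (w \<otimes> inv x) \<otimes> inv (y \<otimes> inv x)"
        using w xy by (simp add: inv_mult_group m_assoc)
      then have 2: "y \<otimes> inv (?\<phi> w) \<in> C \<longleftrightarrow> w \<otimes> inv x \<in> C" using Cconj w xy by simp
      show "m (?\<phi> w) x * m (?\<phi> w) y = m x w * m y w" unfolding m_def 1 2 by simp
    qed
    finally show ?thesis by simp
  qed
  have sum_m: "(\<Sum>w\<in>S. of_int (m x w) * f w) = (\<Sum>h\<in>C. f (h \<otimes> x))"
    if x: "x \<in> S" for x and f :: "'a \<Rightarrow> complex"
  proof -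
    have "(\<Sum>w\<in>S. of_int (m x w) * f w) = (\<Sum>w\<in>(\<lambda>h. h \<otimes> x) ` C. of_int (m x w) * f w)"
    proof (rule sum.mono_neutral_right[OF finS])
      show "(\<lambda>h. h \<otimes> x) ` C \<subseteq> S" using x by auto
      show "\<forall>i\<in>S - (\<lambda>h. h \<otimes> x) ` C. of_int (m x i) * f i = 0"
      proof
        fix w assume w: "w \<in> S - (\<lambda>h. h \<otimes> x) ` C"
        then have "w = (w \<otimes> inv x) \<otimes> x" using x by (simp add: m_assoc)
        then have "w \<otimes> inv x \<notin> C" using w by blast
        then show "of_int (m x w) * f w = 0" by (simp add: m_def)
      qed
    qed
    also have "\<dots> = (\<Sum>h\<in>C. of_int (m x (h \<otimes> x)) * f (h \<otimes> x))"
      by (subst sum.reindex) (use x in \<open>auto simp: inj_on_def\<close>)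
    also have "\<dots> = (\<Sum>h\<in>C. f (h \<otimes> x))"
      by (rule sum.cong) (use x in \<open>auto simp: m_def m_assoc\<close>)
    finally show ?thesis .
  qed
  obtain \<Omega> E g where "kernel_spectrum S m \<Omega> E g"
    using kernel_spectrum_exists[OF finS normal] by blast
  then interpret sp: kernel_spectrum S m \<Omega> E g .
  note \<Omega> = sp.finite_spectrum and g = sp.g_nonzero sp.root_iff and ai = sp.spectrum_algebraic_int
    and ev = sp.spectrum_eigenvalue and eig = sp.eigen and one = sp.resolution and inv = sp.invariant
    and Dnat = sp.trace_Nats and Tai = sp.twisted_trace
  have eig_large: "\<omega> = of_nat c \<and> (\<forall>x\<in>S. \<forall>y\<in>S. f x = f y)"
    if "\<And>x. x \<in> S \<Longrightarrow> (\<Sum>w\<in>S. of_int (m x w) * f w) = \<omega> * f x" "x1 \<in> S" "f x1 \<noteq> 0" "cmod \<omega> \<ge> c"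
    for \<omega> and f :: "'a \<Rightarrow> complex" and x1
  proof -
    have f: "(\<Sum>h\<in>C. f (h \<otimes> x)) = \<omega> * f x" if "x \<in> carrier G" for x
      using that \<open>\<And>x. x \<in> S \<Longrightarrow> (\<Sum>w\<in>S. of_int (m x w) * f w) = \<omega> * f x\<close>[of x] sum_m[of x f] by (simp add: S_def)
    have C: "C \<subseteq> carrier G" "C \<noteq> {}" using CS zC by (auto simp: S_def)
    have x1: "x1 \<in> carrier G" using that(2) by simp
    note ext = extremal_eigenfunction_constant[of C f \<omega> x1, OF fin C gen[folded C_def] f x1 that(3) that(4)[unfolded c_def]]
    show ?thesis unfolding c_def S_def using ext by blast
  qed
  have ev_small: "cmod \<omega> < c \<or> \<omega> = of_nat c" if "kernel_eigenvalue S m \<omega>" for \<omega>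
  proof (cases "cmod \<omega> < c")
    case False
    from that obtain f x1 where f: "x1 \<in> S" "f x1 \<noteq> 0" "\<forall>x\<in>S. (\<Sum>w\<in>S. of_int (m x w) * f w) = \<omega> * f x"
      unfolding kernel_eigenvalue_def by blast
    have "\<omega> = of_nat c"
      using False by (intro eig_large[of f \<omega> x1, OF bspec[OF f(3)] f(1,2), THEN conjunct1]) auto
    then show ?thesis by simp
  qed simp
  have m_left: "m (j \<otimes> x) (j \<otimes> y) = m x y" if "j \<in> S" "x \<in> S" "y \<in> S" for j x y
  proof -
    have "(j \<otimes> y) \<otimes> inv (j \<otimes> x) = j \<otimes> (y \<otimes> inv x) \<otimes> inv j"
      using that by (simp add: inv_mult_group m_assoc)
    then show ?thesis using Cconj that by (simp add: m_def)
  qed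
  have m_right: "m (x \<otimes> j) (y \<otimes> j) = m x y" if "j \<in> S" "x \<in> S" "y \<in> S" for j x y
  proof -
    have "(y \<otimes> j) \<otimes> inv (x \<otimes> j) = y \<otimes> inv x"
      using that by (simp add: inv_mult_group m_assoc)
    then show ?thesis by (simp add: m_def)
  qed
  have bijL: "bij_betw (\<lambda>x. j \<otimes> x) S S" and bijR: "bij_betw (\<lambda>x. x \<otimes> j) S S" if "j \<in> S" for j
    using bij_left_mult bij_right_mult that by (auto simp: S_def)
  have E_left: "E \<omega> (j \<otimes> x) (j \<otimes> y) = E \<omega> x y" if "\<omega> \<in> \<Omega>" "j \<in> S" "x \<in> S" "y \<in> S" for \<omega> j x y
    by (rule inv[OF that(1) bijL[OF that(2)] m_left[OF that(2)] that(3,4)])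
  have E_right: "E \<omega> (x \<otimes> j) (y \<otimes> j) = E \<omega> x y" if "\<omega> \<in> \<Omega>" "j \<in> S" "x \<in> S" "y \<in> S" for \<omega> j x y
    by (rule inv[OF that(1) bijR[OF that(2)] m_right[OF that(2)] that(3,4)])
  \<comment> \<open>Translation invariance reduces \<open>E \<omega>\<close> to the class function \<open>\<epsilon> \<omega>\<close>.\<close>
  define \<epsilon> where "\<epsilon> \<omega> x = E \<omega> x \<one>" for \<omega> x
  have E\<epsilon>: "E \<omega> x y = \<epsilon> \<omega> (x \<otimes> inv y)" if "\<omega> \<in> \<Omega>" "x \<in> S" "y \<in> S" for \<omega> x y
    using E_right[OF that(1) iS[OF that(3)] that(2,3)] that by (simp add: \<epsilon>_def)
  have \<epsilon>_conj: "\<epsilon> \<omega> (j \<otimes> x \<otimes> inv j) = \<epsilon> \<omega> x" if "\<omega> \<in> \<Omega>" "j \<in> S" "x \<in> S" for \<omega> j x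
    using E_left[OF that(1,2,3) oS] E\<epsilon>[OF that(1), of "j \<otimes> x" j] that by (simp add: \<epsilon>_def)
  have \<epsilon>_eig: "(\<Sum>h\<in>C. \<epsilon> \<omega> (h \<otimes> x)) = \<omega> * \<epsilon> \<omega> x" if "\<omega> \<in> \<Omega>" "x \<in> S" for \<omega> x
    using eig[OF that oS] sum_m[OF that(2), of "\<lambda>w. E \<omega> w \<one>"] by (simp add: \<epsilon>_def)
  define n where "n = card S"
  define D where "D \<omega> = (\<Sum>x\<in>S. E \<omega> x x)" for \<omega>
  define T where "T \<omega> = (\<Sum>x\<in>S. E \<omega> (z \<otimes> x) x)" for \<omega>
  define \<tau> where "\<tau> \<omega> = (\<Sum>x\<in>S. E \<omega> (z \<otimes> x \<otimes> z) x)" for \<omega>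
  have D_eq: "D \<omega> = of_nat n * \<epsilon> \<omega> \<one>" if "\<omega> \<in> \<Omega>" for \<omega>
    using that by (simp add: D_def n_def E\<epsilon> cong: sum.cong)
  have T_eq: "T \<omega> = of_nat n * \<epsilon> \<omega> z" if "\<omega> \<in> \<Omega>" for \<omega>
  proof -
    have "T \<omega> = (\<Sum>x\<in>S. \<epsilon> \<omega> z)" unfolding T_def
      by (rule sum.cong[OF HOL.refl]) (simp add: E\<epsilon>[OF that] m_assoc)
    then show ?thesis by (simp add: n_def)
  qed
  have conj_eq: "\<epsilon> \<omega> h = \<epsilon> \<omega> z" if "\<omega> \<in> \<Omega>" "h \<in> C" for \<omega> h
    using that \<epsilon>_conj[OF that(1) _ zS] by (auto simp: C_def conj_class_def S_def)
  have cT: "of_nat c * T \<omega> = \<omega> * D \<omega>" if w: "\<omega> \<in> \<Omega>" for \<omega>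
  proof -
    have "(\<Sum>h\<in>C. \<epsilon> \<omega> (h \<otimes> \<one>)) = (\<Sum>h\<in>C. \<epsilon> \<omega> z)"
      by (rule sum.cong[OF HOL.refl]) (use conj_eq[OF w] in simp)
    then have "of_nat c * \<epsilon> \<omega> z = \<omega> * \<epsilon> \<omega> \<one>" using \<epsilon>_eig[OF w oS] by (simp add: c_def)
    then show ?thesis using D_eq[OF w] T_eq[OF w] by (simp add: mult.left_commute)
  qed
  have c\<tau>: "of_nat c * \<tau> \<omega> = \<omega> * T \<omega>" if w: "\<omega> \<in> \<Omega>" for \<omega>
  proof -
    have \<tau>h: "\<tau> \<omega> = (\<Sum>x\<in>S. \<epsilon> \<omega> (h \<otimes> (x \<otimes> z \<otimes> inv x)))" if h: "h \<in> C" for h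
    proof -
      obtain j where j: "j \<in> S" "h = j \<otimes> z \<otimes> inv j" using h by (auto simp: C_def conj_class_def S_def)
      have "\<tau> \<omega> = (\<Sum>x\<in>S. \<epsilon> \<omega> (h \<otimes> ((j \<otimes> x) \<otimes> z \<otimes> inv (j \<otimes> x))))" unfolding \<tau>_def
      proof (rule sum.cong[OF HOL.refl])
        fix x assume x: "x \<in> S"
        have "E \<omega> (z \<otimes> x \<otimes> z) x = \<epsilon> \<omega> (z \<otimes> x \<otimes> z \<otimes> inv x)" using E\<epsilon>[OF w] x by simp
        also have "\<dots> = \<epsilon> \<omega> (j \<otimes> (z \<otimes> x \<otimes> z \<otimes> inv x) \<otimes> inv j)" using \<epsilon>_conj[OF w j(1)] x by simp
        also have "j \<otimes> (z \<otimes> x \<otimes> z \<otimes> inv x) \<otimes> inv j = h \<otimes> ((j \<otimes> x) \<otimes> z \<otimes> inv (j \<otimes> x))"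
          using x j(1) unfolding j(2) by (simp add: inv_mult_group m_assoc)
        finally show "E \<omega> (z \<otimes> x \<otimes> z) x = \<epsilon> \<omega> (h \<otimes> ((j \<otimes> x) \<otimes> z \<otimes> inv (j \<otimes> x)))" .
      qed
      also have "\<dots> = (\<Sum>x\<in>S. \<epsilon> \<omega> (h \<otimes> (x \<otimes> z \<otimes> inv x)))"
        by (rule sum.reindex_bij_betw[OF bijL[OF j(1)]])
      finally show ?thesis .
    qed
    have "of_nat c * \<tau> \<omega> = (\<Sum>h\<in>C. \<tau> \<omega>)" by (simp add: c_def)
    also have "\<dots> = (\<Sum>h\<in>C. \<Sum>x\<in>S. \<epsilon> \<omega> (h \<otimes> (x \<otimes> z \<otimes> inv x)))"
      by (rule sum.cong[OF HOL.refl]) (rule \<tau>h)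
    also have "\<dots> = (\<Sum>x\<in>S. \<Sum>h\<in>C. \<epsilon> \<omega> (h \<otimes> (x \<otimes> z \<otimes> inv x)))" by (rule sum.swap)
    also have "\<dots> = (\<Sum>x\<in>S. \<omega> * \<epsilon> \<omega> z)"
      by (rule sum.cong[OF HOL.refl]) (simp add: \<epsilon>_eig[OF w] \<epsilon>_conj[OF w])
    also have "\<dots> = \<omega> * T \<omega>" by (simp add: T_eq[OF w] n_def)
    finally show ?thesis .
  qed
  have ordz: "ord z \<ge> 1" "z [^] ord z = \<one>"
    using z fin ord_ge_1 pow_ord_eq_1 by auto
  have T_ai: "algebraic_int (T \<omega>)" if w: "\<omega> \<in> \<Omega>" for \<omega>
    unfolding T_def
  proof (rule Tai[OF w bijL[OF zS] m_left[OF zS] ordz(1)])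
    fix x assume x: "x \<in> S"
    have "((\<lambda>x. z \<otimes> x) ^^ i) x = z [^] i \<otimes> x" for i :: nat
    proof (induction i)
      case (Suc i)
      have "z [^] Suc i = z \<otimes> z [^] i" by (rule nat_pow_Suc2) simp
      then show ?case using x Suc by (simp add: m_assoc)
    qed (use x in simp)
    then show "((\<lambda>x. z \<otimes> x) ^^ ord z) x = x" using x ordz by simp
  qed
  have \<tau>_ai: "algebraic_int (\<tau> \<omega>)" if w: "\<omega> \<in> \<Omega>" for \<omega>
    unfolding \<tau>_def
  proof (rule Tai[OF w _ _ ordz(1)])
    show "bij_betw (\<lambda>x. z \<otimes> x \<otimes> z) S S"
      using bij_betw_trans[OF bijL[OF zS] bijR[OF zS]] by (simp add: comp_def)
    show "m (z \<otimes> x \<otimes> z) (z \<otimes> y \<otimes> z) = m x y" if "x \<in> S" "y \<in> S" for x y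
      using that by (simp add: m_left m_right)
    fix x assume x: "x \<in> S"
    have "((\<lambda>x. z \<otimes> x \<otimes> z) ^^ i) x = z [^] i \<otimes> x \<otimes> z [^] i" for i :: nat
    proof (induction i)
      case (Suc i)
      have "z \<otimes> (z [^] i \<otimes> x \<otimes> z [^] i) \<otimes> z = (z \<otimes> z [^] i) \<otimes> x \<otimes> (z [^] i \<otimes> z)"
        using x by (simp add: m_assoc)
      also have "z \<otimes> z [^] i = z [^] Suc i" by (rule nat_pow_Suc2[symmetric]) simp
      finally show ?case using Suc by simp
    qed (use x in simp)
    then show "((\<lambda>x. z \<otimes> x \<otimes> z) ^^ ord z) x = x" using x ordz by simp
  qed
  have sumT: "(\<Sum>\<omega>\<in>\<Omega>. T \<omega>) = 0"
  proof -
    have "(\<Sum>\<omega>\<in>\<Omega>. T \<omega>) = (\<Sum>\<omega>\<in>\<Omega>. of_nat n * E \<omega> z \<one>)"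
      by (rule sum.cong[OF HOL.refl]) (simp add: T_eq \<epsilon>_def)
    also have "\<dots> = of_nat n * (\<Sum>\<omega>\<in>\<Omega>. E \<omega> z \<one>)" by (simp add: sum_distrib_left)
    also have "\<dots> = 0" using one[OF zS oS] z by simp
    finally show ?thesis .
  qed
  \<comment> \<open>\<open>s \<omega>\<close> is the value of the constant function \<open>1\<close> under \<open>E \<omega>\<close>. As the constant functions belong to the
    eigenvalue \<open>c\<close>, only that eigenvalue contributes, and its projection consists of constant functions.\<close>
  define s where "s \<omega> = (\<Sum>y\<in>S. E \<omega> \<one> y)" for \<omega>
  have s_row: "(\<Sum>y\<in>S. E \<omega> x y) = s \<omega>" if "\<omega> \<in> \<Omega>" "x \<in> S" for \<omega> x
  proof -
    have "s \<omega> = (\<Sum>y\<in>S. E \<omega> (\<one> \<otimes> x) (y \<otimes> x))" unfolding s_def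
      by (rule sum.cong[OF HOL.refl]) (use E_right[OF that(1,2) oS] that in simp)
    also have "\<dots> = (\<Sum>y\<in>S. E \<omega> x y)"
      using sum.reindex_bij_betw[OF bijR[OF that(2)], of "E \<omega> x"] that by simp
    finally show ?thesis by simp
  qed
  have s0: "s \<omega> = 0" if w: "\<omega> \<in> \<Omega>" and ne: "\<omega> \<noteq> of_nat c" for \<omega>
  proof -
    have "\<omega> * s \<omega> = (\<Sum>y\<in>S. \<Sum>w\<in>S. of_int (m \<one> w) * E \<omega> w y)"
      by (simp add: s_def sum_distrib_left eig[OF w oS])
    also have "\<dots> = (\<Sum>w\<in>S. of_int (m \<one> w) * (\<Sum>y\<in>S. E \<omega> w y))"
      by (subst sum.swap) (simp add: sum_distrib_left)
    also have "\<dots> = (\<Sum>w\<in>S. of_int (m \<one> w) * s \<omega>)"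
      by (rule sum.cong[OF HOL.refl]) (simp add: s_row[OF w])
    also have "\<dots> = of_nat c * s \<omega>" using sum_m[OF oS, of "\<lambda>_. s \<omega>"] by (simp add: c_def)
    finally show ?thesis using ne by simp
  qed
  have sum_s: "(\<Sum>\<omega>\<in>\<Omega>. s \<omega>) = 1"
  proof -
    have "(\<Sum>\<omega>\<in>\<Omega>. s \<omega>) = (\<Sum>y\<in>S. \<Sum>\<omega>\<in>\<Omega>. E \<omega> \<one> y)" unfolding s_def by (rule sum.swap)
    also have "\<dots> = (\<Sum>y\<in>S. if \<one> = y then 1 else 0)" by (rule sum.cong[OF HOL.refl]) (simp add: one)
    also have "\<dots> = 1" using finS by simp
    finally show ?thesis .
  qed
  have c\<Omega>: "of_nat c \<in> \<Omega>"
  proof (rule ccontr)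
    assume "of_nat c \<notin> \<Omega>"
    then have "(\<Sum>\<omega>\<in>\<Omega>. s \<omega>) = 0" using s0 by (intro sum.neutral) auto
    then show False using sum_s by simp
  qed
  have "(\<Sum>\<omega>\<in>\<Omega>. s \<omega>) = s (of_nat c) + (\<Sum>\<omega>\<in>\<Omega> - {of_nat c}. s \<omega>)"
    by (rule sum.remove[OF \<Omega> c\<Omega>])
  also have "(\<Sum>\<omega>\<in>\<Omega> - {of_nat c}. s \<omega>) = 0" using s0 by (intro sum.neutral) auto
  finally have sc: "s (of_nat c) = 1" using sum_s by simp
  have Tc: "T (of_nat c) = 1"
  proof -
    have "E (of_nat c) (z \<otimes> y) y = E (of_nat c) \<one> y" if y: "y \<in> S" for y
    proof (cases "\<exists>x1\<in>S. E (of_nat c) x1 y \<noteq> 0")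
      case True
      then show ?thesis using eig_large[OF eig[OF c\<Omega> _ y]] y by (metis mS norm_of_nat oS order_refl zS)
    qed (use y in auto)
    then have "T (of_nat c) = s (of_nat c)" unfolding T_def s_def by (intro sum.cong HOL.refl) auto
    then show ?thesis using sc by simp
  qed
  have "T \<omega> * T \<omega> = D \<omega> * \<tau> \<omega>" if w: "\<omega> \<in> \<Omega>" for \<omega>
  proof -
    have "of_nat c * (T \<omega> * T \<omega>) = (\<omega> * D \<omega>) * T \<omega>" by (simp only: cT[OF w, symmetric] mult.assoc)
    also have "\<dots> = D \<omega> * (\<omega> * T \<omega>)" by simp
    also have "\<dots> = of_nat c * (D \<omega> * \<tau> \<omega>)" by (simp add: c\<tau>[OF w, symmetric])
    finally show ?thesis using c0 by simp
  qed
  note TT = this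
  have nil: "nilpotent_mod q (T \<omega>)" if w: "\<omega> \<in> \<Omega> - {of_nat c}" for \<omega>
  proof -
    have w1: "\<omega> \<in> \<Omega>" and w2: "\<omega> \<noteq> of_nat c" using w by auto
    obtain d where d: "D \<omega> = of_nat d" using Dnat[OF w1] by (auto simp: D_def elim: Nats_cases)
    have "\<exists>b. algebraic_int b \<and> (T \<omega>) ^ 2 = of_nat q * b"
    proof (cases "q dvd d")
      case True
      then obtain d' where "d = q * d'" by (elim dvdE)
      then have "(T \<omega>) ^ 2 = of_nat q * (of_nat d' * \<tau> \<omega>)"
        using TT[OF w1] d by (simp add: power2_eq_square)
      then show ?thesis using \<tau>_ai[OF w1] by (blast intro: algebraic_int_mult algebraic_int_of_nat)
    next
      case False
      then have "coprime q d" using q by (rule prime_imp_coprime[rotated])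
      then have cop: "coprime (int c) (int d)" by (simp add: ck)
      obtain a b where ab: "a * int c + b * int d = 1"
        using cop by (metis bezout_int coprime_imp_gcd_eq_1)
      define \<alpha> where "\<alpha> = \<omega> / of_nat c"
      have c_nz: "(of_nat c :: complex) \<noteq> 0" using c0 by simp
      have Ta: "T \<omega> = \<alpha> * of_nat d" using cT[OF w1] d c_nz by (simp add: \<alpha>_def field_simps)
      have "\<alpha> = \<alpha> * of_int (a * int c + b * int d)" by (simp add: ab)
      also have "\<dots> = of_int a * \<omega> + of_int b * T \<omega>"
        using c_nz by (simp add: Ta \<alpha>_def field_simps)
      finally have "algebraic_int \<alpha>"
        using ai[OF w1] T_ai[OF w1] by (metis algebraic_int_add algebraic_int_mult algebraic_int_of_int)
      moreover have "\<alpha> \<noteq> 1" using w2 c_nz by (simp add: \<alpha>_def)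
      \<comment> \<open>The roots of \<open>g (c y)\<close> are the eigenvalues divided by \<open>c\<close>, so they include all conjugates of \<open>\<alpha>\<close>.\<close>
      moreover have "pcompose g [:0, of_nat c:] \<noteq> 0"
      proof
        assume "pcompose g [:0, of_nat c:] = 0"
        then show False using g(1) c0 by (subst (asm) pcompose_eq_0_iff) (auto)
      qed
      moreover have p: "poly (map_poly of_rat (pcompose g [:0, of_nat c:])) y
            = poly (map_poly of_rat g) (of_nat c * y)" for y :: complex
      proof -
        have "poly (map_poly of_rat (pcompose h [:0, of_nat c:])) y
            = poly (map_poly of_rat h) (of_nat c * y)" for h :: "rat poly"
          by (simp add: of_rat_hom.map_poly_pcompose poly_pcompose of_rat_hom.map_poly_pCons_hom mult.commute)
        then show ?thesis .
      qed
      moreover have "poly (map_poly of_rat (pcompose g [:0, of_nat c:])) \<alpha> = 0"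
        unfolding p using ev[OF w1] g(2)[of \<omega>] c_nz by (simp add: \<alpha>_def)
      moreover have "cmod y < 1 \<or> y = 1" if "poly (map_poly of_rat (pcompose g [:0, of_nat c:])) y = 0" for y
        using ev_small[of "of_nat c * y"] g(2)[of "of_nat c * y"] that c0 unfolding p
        by (auto simp: norm_mult)
      ultimately have "\<alpha> = 0" by (intro small_conjugates_imp_zero[of \<alpha> "pcompose g [:0, of_nat c:]"]) auto
      then show ?thesis using Ta by (intro exI[of _ 0]) auto
    qed
    then show ?thesis using T_ai[OF w1] by (auto simp: nilpotent_mod_def)
  qed
  have "(\<Sum>\<omega>\<in>\<Omega>. T \<omega>) = T (of_nat c) + (\<Sum>\<omega>\<in>\<Omega> - {of_nat c}. T \<omega>)"
    by (rule sum.remove[OF \<Omega> c\<Omega>])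
  then have "(\<Sum>\<omega>\<in>\<Omega> - {of_nat c}. T \<omega>) = - 1" using sumT Tc by (simp add: add_eq_0_iff)
  moreover have "nilpotent_mod q (\<Sum>\<omega>\<in>\<Omega> - {of_nat c}. T \<omega>)"
    using \<Omega> nil by (intro nilpotent_mod_sum) auto
  ultimately show False using not_nilpotent_mod_minus_one prime_gt_1_nat[OF q] by simp
qed

end

section \<open>Groups whose order has two prime divisors\<close>

lemma (in group_hom) normal_preimage:
  assumes N: "N \<lhd> H"
  shows "{g \<in> carrier G. h g \<in> N} \<lhd> G"
proof (rule G.normal_invI)
  interpret N: normal N H by (rule N)
  show "subgroup {g \<in> carrier G. h g \<in> N} G"
    by (rule G.subgroupI) (auto intro!: exI[of _ "\<one>\<^bsub>G\<^esub>"])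
  fix x k assume "x \<in> carrier G" "k \<in> {g \<in> carrier G. h g \<in> N}"
  then show "x \<otimes>\<^bsub>G\<^esub> k \<otimes>\<^bsub>G\<^esub> inv\<^bsub>G\<^esub> x \<in> {g \<in> carrier G. h g \<in> N}"
    using N.inv_op_closed2[of "h x" "h k"] by auto
qed

lemma product_of_powers_of_two_prime_divisors:
  fixes n r s :: nat
  assumes "n > 0" "\<And>t. prime t \<Longrightarrow> t dvd n \<Longrightarrow> t = r \<or> t = s"
  shows "\<exists>i j. n = r ^ i * s ^ j"
  using assms
proof (induction n rule: less_induct)
  case (less n)
  show ?case
  proof (cases "n = 1")
    case True
    then show ?thesis by (intro exI[of _ 0]) simp
  next
    case False
    then obtain t where t: "prime t" "t dvd n" using prime_factor_nat by blast
    then obtain k where k: "n = t * k" by (elim dvdE)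
    have "k < n" "k > 0" using k less.prems(1) prime_gt_1_nat[OF t(1)] by auto
    moreover have "t' = r \<or> t' = s" if "prime t'" "t' dvd k" for t'
      using less.prems(2)[OF that(1)] that(2) k by auto
    ultimately obtain i j where "k = r ^ i * s ^ j" using less.IH by blast
    then have "n = t * (r ^ i * s ^ j)" using k by simp
    moreover have "t = r \<or> t = s" using less.prems(2) t by blast
    ultimately show ?thesis
      by (metis mult.assoc mult.left_commute power_Suc)
  qed
qed

context group
begin

definition center :: "'a set" where
  "center = {z \<in> carrier G. \<forall>g\<in>carrier G. g \<otimes> z = z \<otimes> g}"

lemma center_normal: "center \<lhd> G"
proof (rule normal_invI)
  show "subgroup center G"
  proof (rule subgroupI)
    show "center \<noteq> {}" by (auto simp: center_def intro!: exI[of _ \<one>])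
    fix a assume a: "a \<in> center"
    then have ac: "a \<in> carrier G" and com: "\<And>g. g \<in> carrier G \<Longrightarrow> g \<otimes> a = a \<otimes> g" by (auto simp: center_def)
    have "g \<otimes> inv a = inv a \<otimes> g" if g: "g \<in> carrier G" for g
    proof -
      have "inv a \<otimes> (g \<otimes> a) \<otimes> inv a = inv a \<otimes> (a \<otimes> g) \<otimes> inv a" using com[OF g] by simp
      then show ?thesis using g ac by (simp add: m_assoc)
    qed
    then show "inv a \<in> center" using ac by (auto simp: center_def)
    fix b assume b: "b \<in> center"
    then have bc: "b \<in> carrier G" and comb: "\<And>g. g \<in> carrier G \<Longrightarrow> g \<otimes> b = b \<otimes> g" by (auto simp: center_def)
    have "g \<otimes> (a \<otimes> b) = (a \<otimes> b) \<otimes> g" if g: "g \<in> carrier G" for g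
    proof -
      have "g \<otimes> (a \<otimes> b) = (g \<otimes> a) \<otimes> b" using g ac bc by (simp add: m_assoc)
      also have "\<dots> = a \<otimes> (g \<otimes> b)" using g ac bc com[OF g] by (simp add: m_assoc)
      also have "\<dots> = (a \<otimes> b) \<otimes> g" using g ac bc comb[OF g] by (simp add: m_assoc)
      finally show ?thesis .
    qed
    then show "a \<otimes> b \<in> center" using ac bc by (auto simp: center_def)
  qed (auto simp: center_def)
  fix x h assume x: "x \<in> carrier G" and h: "h \<in> center"
  then have "x \<otimes> h \<otimes> inv x = h" by (auto simp: center_def m_assoc)
  then show "x \<otimes> h \<otimes> inv x \<in> center" using h by simp
qed

lemma centralizer_subgroup:
  assumes z: "z \<in> carrier G"
  shows "subgroup {g \<in> carrier G. g \<otimes> z = z \<otimes> g} G"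
    and "card (conj_class z) * card {g \<in> carrier G. g \<otimes> z = z \<otimes> g} = card (carrier G)"
proof -
  let ?\<phi> = "\<lambda>g. (\<lambda>h \<in> carrier G. g \<otimes> h \<otimes> inv g)"
  interpret act: group_action G "carrier G" ?\<phi> by (rule action_by_conjugation)
  have stab: "stabilizer G ?\<phi> z = {g \<in> carrier G. g \<otimes> z = z \<otimes> g}"
  proof -
    have "g \<otimes> z \<otimes> inv g = z \<longleftrightarrow> g \<otimes> z = z \<otimes> g" if "g \<in> carrier G" for g
      using inv_solve_right'[of z "g \<otimes> z" g] that z by auto
    then show ?thesis using z by (auto simp: stabilizer_def)
  qed
  have "orbit G ?\<phi> z = conj_class z"
    using z by (auto simp: orbit_def conj_class_def)
  then show "card (conj_class z) * card {g \<in> carrier G. g \<otimes> z = z \<otimes> g} = card (carrier G)"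
    using act.orbit_stabilizer_theorem[OF z] stab by (simp add: Coset.order_def)
  show "subgroup {g \<in> carrier G. g \<otimes> z = z \<otimes> g} G"
    using act.stabilizer_subgroup[OF z] stab by simp
qed

lemma card_subgroup_dvd:
  assumes "subgroup H G" shows "card H dvd card (carrier G)"
  using lagrange[OF assms] by (metis dvd_triv_right Coset.order_def)

text \<open>The class equation: the classes of non-central elements have sizes divisible by \<open>p\<close>.\<close>
lemma prime_power_order_center:
  assumes p: "prime (p::nat)" and card: "card (carrier G) = p ^ n" and n: "n \<ge> 1"
  shows "\<exists>z\<in>center. z \<noteq> \<one>"
proof (rule ccontr)
  assume no: "\<not> ?thesis"
  have fin: "finite (carrier G)" using card p by (metis card.infinite power_not_zero not_prime_0)
  let ?\<phi> = "\<lambda>g. (\<lambda>h \<in> carrier G. g \<otimes> h \<otimes> inv g)"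
  interpret act: group_action G "carrier G" ?\<phi> by (rule action_by_conjugation)
  define Os where "Os = orbits G (carrier G) ?\<phi>"
  have U: "\<Union>Os = carrier G" unfolding Os_def by (rule act.orbits_coverture)
  have disj: "pairwise disjnt Os"
    using act.disjoint_union unfolding pairwise_def disjnt_def Os_def by blast
  have O_conj: "Os = conj_class ` carrier G"
    by (auto simp: Os_def orbits_def orbit_def conj_class_def image_iff)
  have finO: "finite Os" using fin by (simp add: O_conj)
  have finB: "finite B" if "B \<in> Os" for B
    by (rule finite_subset[OF _ fin]) (use U that in auto)
  have one: "conj_class \<one> = {\<one>}" by (auto simp: conj_class_def)
  have dv: "p dvd card B" if B: "B \<in> Os - {{\<one>}}" for B
  proof -
    obtain z where z: "z \<in> carrier G" "B = conj_class z" using B O_conj by auto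
    have z1: "z \<noteq> \<one>" using z B one by auto
    have "card B dvd p ^ n" using centralizer_subgroup(2)[OF z(1)] z card by (metis dvd_triv_left)
    then obtain j where j: "card B = p ^ j" using p by (auto simp: divides_primepow_nat)
    have "j \<noteq> 0"
    proof
      assume "j = 0"
      then have "card B = 1" using j by simp
      moreover have "z \<in> B" using z by (auto simp: conj_class_def intro!: image_eqI[of _ _ \<one>])
      ultimately have Bz: "B = {z}" by (metis card_1_singletonE singletonD)
      have "g \<otimes> z = z \<otimes> g" if g: "g \<in> carrier G" for g
      proof -
        have "g \<otimes> z \<otimes> inv g \<in> B" using z g by (auto simp: conj_class_def)
        then have "g \<otimes> z \<otimes> inv g = z" using Bz by simp
        then show ?thesis using g z by (metis inv_solve_right m_closed)
      qed
      then have "z \<in> center" using z by (auto simp: center_def)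
      then show False using no z1 by auto
    qed
    then show ?thesis using j by (simp add: dvd_power)
  qed
  have "card (carrier G) = (\<Sum>B\<in>Os. card B)"
    using card_Union_disjoint[of Os] disj finB U by simp
  also have "\<dots> = card {\<one>} + (\<Sum>B\<in>Os - {{\<one>}}. card B)"
    by (rule sum.remove[OF finO]) (use O_conj one in auto)
  finally have "p ^ n = 1 + (\<Sum>B\<in>Os - {{\<one>}}. card B)" using card by simp
  moreover have "p dvd (\<Sum>B\<in>Os - {{\<one>}}. card B)" by (rule dvd_sum[OF dv])
  moreover have "p dvd p ^ n" using n by (simp add: dvd_power)
  ultimately have "p dvd 1" by (metis dvd_add_left_iff)
  then show False using p by simp
qed


lemma quotient_normal_lift:
  assumes K: "K \<lhd> G" and N: "N \<lhd> G Mod K"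
  defines "L \<equiv> {g \<in> carrier G. K #> g \<in> N}"
  shows "L \<lhd> G" "K \<subseteq> L"
    and "N \<noteq> {K} \<Longrightarrow> K \<noteq> L" "N \<noteq> carrier (G Mod K) \<Longrightarrow> L \<noteq> carrier G"
proof -
  interpret K: normal K G by (rule K)
  interpret Q: group "G Mod K" by (rule K.factorgroup_is_group)
  interpret h: group_hom G "G Mod K" "\<lambda>a. K #> a"
    by (intro group_hom.intro group_hom_axioms.intro is_group Q.is_group K.r_coset_hom_Mod)
  interpret N: normal N "G Mod K" by (rule N)
  show "L \<lhd> G" unfolding L_def by (rule h.normal_preimage[OF N])
  have K1: "K #> k = K" if "k \<in> K" for k
    using coset_join2[OF _ K.subgroup_axioms that] that by simp
  show "K \<subseteq> L" using K1 N.one_closed by (auto simp: L_def)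
  show "K \<noteq> L" if ne: "N \<noteq> {K}"
  proof -
    obtain n where n: "n \<in> N" "n \<noteq> K" using ne N.one_closed by auto
    then obtain a where "a \<in> carrier G" "n = K #> a" using N.subset by (auto simp: carrier_FactGroup)
    then show ?thesis using n K1 by (auto simp: L_def)
  qed
  show "L \<noteq> carrier G" if ne: "N \<noteq> carrier (G Mod K)"
  proof -
    obtain n where n: "n \<in> carrier (G Mod K)" "n \<notin> N" using ne N.subset by blast
    then obtain a where "a \<in> carrier G" "n = K #> a" by (auto simp: carrier_FactGroup)
    then show ?thesis using n by (auto simp: L_def)
  qed
qed

lemma quotient_facts:
  assumes K: "K \<lhd> G"
  shows "group (G Mod K)" "group_hom G (G Mod K) (\<lambda>a. K #> a)"
    and "card (carrier (G Mod K)) * card K = card (carrier G)"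
    and "finite (carrier G) \<Longrightarrow> finite (carrier (G Mod K))"
    and "K \<noteq> carrier G \<Longrightarrow> carrier (G Mod K) \<noteq> {K}"
    and "\<And>a. a \<in> carrier G \<Longrightarrow> K #> a = K \<longleftrightarrow> a \<in> K"
proof -
  interpret K: normal K G by (rule K)
  show gQ: "group (G Mod K)" by (rule K.factorgroup_is_group)
  show "group_hom G (G Mod K) (\<lambda>a. K #> a)"
    by (intro group_hom.intro group_hom_axioms.intro is_group gQ K.r_coset_hom_Mod)
  show "card (carrier (G Mod K)) * card K = card (carrier G)"
    using lagrange[OF K.subgroup_axioms] by (simp add: FactGroup_def Coset.order_def)
  show "finite (carrier G) \<Longrightarrow> finite (carrier (G Mod K))" by (simp add: carrier_FactGroup)
  show iff: "K #> a = K \<longleftrightarrow> a \<in> K" if "a \<in> carrier G" for a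
    using that coset_join1[OF _ that K.subgroup_axioms] coset_join2[OF that K.subgroup_axioms] K.subset by blast
  show "carrier (G Mod K) \<noteq> {K}" if ne: "K \<noteq> carrier G"
  proof -
    obtain g where g: "g \<in> carrier G" "g \<notin> K" using ne K.subset by blast
    then have "K #> g \<in> carrier (G Mod K)" "K #> g \<noteq> K" using iff by (auto simp: carrier_FactGroup)
    then show ?thesis by blast
  qed
qed

text \<open>An element \<open>z\<close> in the center of a Sylow subgroup has a centralizer containing that subgroup, so the
size of its class is a power of the other prime. The quotients of elements of this class generate a
normal subgroup, which is proper; if it is trivial, then \<open>z\<close> is central.\<close>
lemma two_primes_not_simple:
  assumes fin: "finite (carrier G)" and big: "carrier G \<noteq> {\<one>}"
    and pq: "prime (p::nat)" "prime q" "p \<noteq> q"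
    and primes: "\<And>t. prime t \<Longrightarrow> t dvd card (carrier G) \<Longrightarrow> t = p \<or> t = q"
  shows "center = carrier G \<or> (\<exists>N. N \<lhd> G \<and> N \<noteq> {\<one>} \<and> N \<noteq> carrier G)"
proof -
  have "{\<one>} \<subset> carrier G" using big one_closed by blast
  then have "card {\<one>} < card (carrier G)" by (rule psubset_card_mono[OF fin])
  then have c1: "card (carrier G) > 1" by simp
  obtain r where r: "prime r" "r dvd card (carrier G)"
    using c1 prime_factor_nat[of "card (carrier G)"] by auto
  obtain s where s: "prime s" "s \<noteq> r" "\<And>t. prime t \<Longrightarrow> t dvd card (carrier G) \<Longrightarrow> t = r \<or> t = s"
    using pq primes r by metis
  obtain i j where ij: "card (carrier G) = r ^ i * s ^ j"
    using product_of_powers_of_two_prime_divisors[of "card (carrier G)" r s] s(3) c1 by auto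
  have i: "i \<ge> 1"
  proof (rule ccontr)
    assume "\<not> ?thesis"
    then have "r dvd s ^ j" using r ij by (simp add: not_le)
    then have "r dvd s" using r(1) prime_dvd_power by blast
    then show False using r s primes_dvd_imp_eq by blast
  qed
  have "Coset.order G = r ^ i * s ^ j" using ij by (simp add: Coset.order_def)
  then obtain P where P: "subgroup P G" "card P = r ^ i"
    using sylow_thm[OF r(1) is_group _ fin] by blast
  interpret P: group "G\<lparr>carrier := P\<rparr>" by (rule subgroup.subgroup_is_group[OF P(1) is_group])
  obtain z where "z \<in> P.center" "z \<noteq> \<one>"
    using P.prime_power_order_center[OF r(1) _ i] P(2) by auto
  then have z: "z \<in> P" "z \<noteq> \<one>" and zP: "\<And>g. g \<in> P \<Longrightarrow> g \<otimes> z = z \<otimes> g"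
    by (auto simp: P.center_def)
  have zG: "z \<in> carrier G" using z P(1) subgroup.subset by blast
  let ?Z = "{g \<in> carrier G. g \<otimes> z = z \<otimes> g}"
  have "P \<subseteq> ?Z" using zP P(1) subgroup.subset by blast
  then have "subgroup P (G\<lparr>carrier := ?Z\<rparr>)"
    using subgroup_incl P(1) centralizer_subgroup(1)[OF zG] by blast
  then have "card P dvd card ?Z"
    using group.card_subgroup_dvd[OF subgroup.subgroup_is_group[OF centralizer_subgroup(1)[OF zG] is_group]]
    by fastforce
  then obtain d where d: "card ?Z = r ^ i * d" using P(2) by (auto elim: dvdE)
  have "r ^ i * (card (conj_class z) * d) = r ^ i * s ^ j"
    using centralizer_subgroup(2)[OF zG] unfolding d ij by (simp add: mult.left_commute)
  then have "card (conj_class z) * d = s ^ j" using prime_gt_0_nat[OF r(1)] by simp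
  then have "card (conj_class z) dvd s ^ j" by (metis dvd_triv_left)
  then obtain k where k: "card (conj_class z) = s ^ k" using s(1) by (auto simp: divides_primepow_nat)
  let ?S = "{inv h \<otimes> h' |h h'. h \<in> conj_class z \<and> h' \<in> conj_class z}"
  have gens: "?S \<subseteq> carrier G" using conj_class_carrier[OF zG] by blast
  have N: "generate G ?S \<lhd> G"
  proof (rule normal_generateI[OF gens])
    fix x g assume "x \<in> ?S" and g: "g \<in> carrier G"
    then obtain h h' where h: "h \<in> conj_class z" "h' \<in> conj_class z" "x = inv h \<otimes> h'" by blast
    have hc: "h \<in> carrier G" "h' \<in> carrier G" using h conj_class_carrier[OF zG] by auto
    have "g \<otimes> x \<otimes> inv g = inv (g \<otimes> h \<otimes> inv g) \<otimes> (g \<otimes> h' \<otimes> inv g)"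
      using hc g unfolding h(3) by (simp add: inv_mult_group m_assoc)
    then show "g \<otimes> x \<otimes> inv g \<in> ?S" using conj_class_conj[OF zG _ g] h by blast
  qed
  have proper: "generate G ?S \<noteq> carrier G"
    by (rule prime_power_class_differences_generate_proper[OF fin zG z(2) s(1) k])
  show ?thesis
  proof (cases "generate G ?S = {\<one>}")
    case False
    then show ?thesis using N proper by blast
  next
    case True
    have "g \<otimes> z = z \<otimes> g" if g: "g \<in> carrier G" for g
    proof -
      have "z \<in> conj_class z" using zG by (auto simp: conj_class_def intro!: image_eqI[of _ _ \<one>])
      moreover have "g \<otimes> z \<otimes> inv g \<in> conj_class z" using g by (auto simp: conj_class_def)
      ultimately have "inv z \<otimes> (g \<otimes> z \<otimes> inv g) \<in> generate G ?S" by (blast intro: generate.incl)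
      then have "inv z \<otimes> (g \<otimes> z \<otimes> inv g) = \<one>" using True by simp
      then have "z \<otimes> (inv z \<otimes> (g \<otimes> z \<otimes> inv g)) \<otimes> g = z \<otimes> \<one> \<otimes> g" by simp
      then show ?thesis using g zG by (simp add: m_assoc)
    qed
    then have "z \<in> center" using zG by (simp add: center_def)
    then have "center \<noteq> {\<one>}" using z(2) by blast
    then show ?thesis using center_normal by blast
  qed
qed

text \<open>The quotient by a maximal proper normal subgroup \<open>K\<close> has no proper normal subgroups, hence is abelian.\<close>
lemma two_primes_nonperfect:
  assumes fin: "finite (carrier G)" and big: "carrier G \<noteq> {\<one>}"
    and pq: "prime (p::nat)" "prime q" "p \<noteq> q"
    and primes: "\<And>t. prime t \<Longrightarrow> t dvd card (carrier G) \<Longrightarrow> t = p \<or> t = q"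
  shows "derived G (carrier G) \<noteq> carrier G"
proof -
  define \<N> where "\<N> = {N. N \<lhd> G \<and> N \<noteq> carrier G}"
  have "{\<one>} \<in> \<N>" using big one_is_normal by (auto simp: \<N>_def)
  moreover have "\<N> \<subseteq> Pow (carrier G)"
    using normal_imp_subgroup subgroup.subset by (fastforce simp: \<N>_def)
  ultimately obtain K where K: "K \<in> \<N>" and max: "\<And>N. N \<in> \<N> \<Longrightarrow> K \<subseteq> N \<Longrightarrow> N = K"
    using finite_has_maximal[of \<N>] fin by (metis empty_iff finite_Pow_iff finite_subset)
  have Kn: "K \<lhd> G" "K \<noteq> carrier G" using K by (auto simp: \<N>_def)
  note Q = quotient_facts[OF Kn(1)]
  interpret Q: group "G Mod K" by (rule Q(1))
  interpret h: group_hom G "G Mod K" "\<lambda>a. K #> a" by (rule Q(2))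
  have prQ: "t = p \<or> t = q" if "prime t" "t dvd card (carrier (G Mod K))" for t
    using primes[OF that(1)] that(2) Q(3) by (metis dvd_mult2)
  have "Q.center = carrier (G Mod K)"
  proof (rule ccontr)
    assume "Q.center \<noteq> carrier (G Mod K)"
    then obtain N where N: "N \<lhd> G Mod K" "N \<noteq> {K}" "N \<noteq> carrier (G Mod K)"
      using Q.two_primes_not_simple[OF Q(4)[OF fin] _ pq prQ] Q(5)[OF Kn(2)] by auto
    note L = quotient_normal_lift[OF Kn(1) N(1)]
    show False using max[OF _ L(2)] L(1,3,4) N by (auto simp: \<N>_def)
  qed
  note ab = this
  have "derived_set G (carrier G) \<subseteq> K"
  proof
    fix x assume "x \<in> derived_set G (carrier G)"
    then obtain a b where ab': "a \<in> carrier G" "b \<in> carrier G" "x = a \<otimes> b \<otimes> inv a \<otimes> inv b" by auto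
    let ?a = "K #> a" and ?b = "K #> b"
    have abQ: "?a \<in> carrier (G Mod K)" "?b \<in> carrier (G Mod K)" using ab' by (auto intro: h.hom_closed)
    then have com: "?a \<otimes>\<^bsub>G Mod K\<^esub> ?b = ?b \<otimes>\<^bsub>G Mod K\<^esub> ?a" using ab by (auto simp: Q.center_def)
    have "K #> x = ?a \<otimes>\<^bsub>G Mod K\<^esub> ?b \<otimes>\<^bsub>G Mod K\<^esub> inv\<^bsub>G Mod K\<^esub> ?a \<otimes>\<^bsub>G Mod K\<^esub> inv\<^bsub>G Mod K\<^esub> ?b"
      using ab' by (simp only: h.hom_mult h.hom_inv m_closed inv_closed)
    also have "\<dots> = \<one>\<^bsub>G Mod K\<^esub>" unfolding com using abQ
      by (simp only: Q.m_assoc Q.inv_closed Q.m_closed Q.r_inv Q.l_inv Q.r_one Q.inv_mult_cancel)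
    finally have "K #> x = K" by (simp only: one_FactGroup)
    moreover have "x \<in> carrier G" using ab' by simp
    ultimately show "x \<in> K" using Q(6) by blast
  qed
  then have "derived G (carrier G) \<subseteq> K" unfolding derived_def
    by (rule generate_subgroup_incl[OF _ normal_imp_subgroup[OF Kn(1)]])
  then show ?thesis using Kn normal_imp_subgroup[OF Kn(1)] subgroup.subset by blast
qed

text \<open>A minimal normal subgroup \<open>A\<close> is abelian, because its derived subgroup is smaller and also normal in the
group. Its elements with \<open>r\<close>-th power one form a subgroup that is invariant under conjugation.\<close>
lemma two_primes_normal_elementary:
  assumes fin: "finite (carrier G)" and nontriv: "carrier G \<noteq> {\<one>}"
    and pq: "prime (p::nat)" "prime q" "p \<noteq> q"
    and primes: "\<And>t. prime t \<Longrightarrow> t dvd card (carrier G) \<Longrightarrow> t = p \<or> t = q"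
  shows "\<exists>N r. N \<lhd> G \<and> N \<noteq> {\<one>} \<and> (r = p \<or> r = q) \<and> (\<forall>x\<in>N. x [^] r = \<one>)"
proof -
  define \<N> where "\<N> = {N. N \<lhd> G \<and> N \<noteq> {\<one>}}"
  have "carrier G \<in> \<N>" using nontriv normal_self by (simp add: \<N>_def)
  then obtain A where A: "A \<in> \<N>" and min: "\<And>N. N \<in> \<N> \<Longrightarrow> card A \<le> card N"
    using exists_least_iff[of "\<lambda>n. \<exists>N\<in>\<N>. card N = n"] by (metis leI)
  interpret A: normal A G using A by (simp add: \<N>_def)
  have A1: "A \<noteq> {\<one>}" using A by (simp add: \<N>_def)
  have finA: "finite A" using A.subset fin finite_subset by blast
  have dvd: "card A dvd card (carrier G)" by (rule card_subgroup_dvd[OF A.subgroup_axioms])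
  have "derived (G\<lparr>carrier := A\<rparr>) (carrier (G\<lparr>carrier := A\<rparr>)) \<noteq> carrier (G\<lparr>carrier := A\<rparr>)"
    by (rule group.two_primes_nonperfect[OF A.subgroup_is_group[OF is_group] _ _ pq])
       (use finA A1 primes dvd in \<open>auto intro: dvd_trans\<close>)
  then have ne: "derived G A \<noteq> A" using derived_consistent[OF order_refl A.subgroup_axioms] by simp
  have "derived G A \<subseteq> A" by (rule derived_incl[OF order_refl A.subgroup_axioms])
  then have "card (derived G A) < card A" using ne finA by (intro psubset_card_mono) auto
  moreover have "derived G A \<lhd> G" by (rule derived_is_normal[OF A.normal_axioms])
  ultimately have der: "derived G A = {\<one>}" using min[of "derived G A"] by (auto simp: \<N>_def)
  have Ac: "a \<in> carrier G" if "a \<in> A" for a using that by simp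
  have com: "a \<otimes> b = b \<otimes> a" if ab: "a \<in> A" "b \<in> A" for a b
  proof -
    have "a \<otimes> b \<otimes> inv a \<otimes> inv b \<in> derived G A" unfolding derived_def
      by (rule generate.incl) (use ab in blast)
    then have "a \<otimes> b \<otimes> inv a \<otimes> inv b = \<one>" using der by simp
    then have "a \<otimes> b \<otimes> inv a \<otimes> inv b \<otimes> (b \<otimes> a) = b \<otimes> a" using ab Ac by simp
    then show ?thesis using ab Ac by (simp add: m_assoc)
  qed
  obtain x where x: "x \<in> A" "x \<noteq> \<one>" using A1 A.one_closed by blast
  have xc: "x \<in> carrier G" using x by simp
  have ox: "ord x \<noteq> 1" using x(2) ord_eq_1[OF xc] by simp
  then obtain r where r: "prime r" "r dvd ord x" using prime_factor_nat by blast
  have "ord x dvd card (carrier G)" using ord_dvd_group_order[OF xc] by (simp add: Coset.order_def)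
  then have rpq: "r = p \<or> r = q" using primes r dvd_trans by blast
  obtain k where k: "ord x = r * k" using r(2) by (elim dvdE)
  define N where "N = {a \<in> A. a [^] r = \<one>}"
  have "N \<lhd> G"
  proof (rule normal_invI)
    show "subgroup N G"
    proof (rule subgroupI)
      show "N \<noteq> {}" using A.one_closed by (auto simp: N_def intro!: exI[of _ \<one>])
      fix a b assume a: "a \<in> N"
      then show "inv a \<in> N" using Ac by (auto simp: N_def nat_pow_inv)
      assume b: "b \<in> N"
      show "a \<otimes> b \<in> N" using a b com[of a b] Ac by (auto simp: N_def pow_mult_distrib)
    qed (use Ac in \<open>auto simp: N_def\<close>)
    fix g a assume g: "g \<in> carrier G" and a: "a \<in> N"
    have ac: "a \<in> carrier G" using a Ac by (auto simp: N_def)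
    have "(g \<otimes> a \<otimes> inv g) [^] i = g \<otimes> a [^] i \<otimes> inv g" for i :: nat
      by (induction i) (use g ac in \<open>simp_all add: m_assoc\<close>)
    then show "g \<otimes> a \<otimes> inv g \<in> N" using a g A.inv_op_closed2[OF g] by (auto simp: N_def)
  qed
  moreover have "x [^] k \<in> N"
  proof -
    have "x [^] k \<in> A" using x A.subgroup_axioms by (metis int_pow_int subgroup_int_pow_closed)
    moreover have "(x [^] k) [^] r = \<one>"
      using xc k pow_ord_eq_1[OF xc] by (simp add: nat_pow_pow mult.commute)
    ultimately show ?thesis by (simp add: N_def)
  qed
  moreover have "x [^] k \<noteq> \<one>"
  proof
    assume "x [^] k = \<one>"
    then have "ord x dvd k" using pow_eq_id[OF xc] by blast
    moreover have "k > 0" using k ord_ge_1[OF fin xc] by (cases k) auto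
    ultimately have "ord x \<le> k" by (simp add: dvd_imp_le)
    then show False using k \<open>k > 0\<close> prime_gt_1_nat[OF r(1)] by simp
  qed
  ultimately show ?thesis using rpq by (intro exI[of _ N] exI[of _ r]) (auto simp: N_def)
qed

lemma two_primes_normal_extension:
  assumes fin: "finite (carrier G)" and K: "K \<lhd> G" "K \<noteq> carrier G"
    and pq: "prime (p::nat)" "prime q" "p \<noteq> q"
    and primes: "\<And>t. prime t \<Longrightarrow> t dvd card (carrier G) \<Longrightarrow> t = p \<or> t = q"
  shows "\<exists>L r. L \<lhd> G \<and> K \<subset> L \<and> (r = p \<or> r = q) \<and> (\<forall>x\<in>L. x [^] r \<in> K)"
proof -
  note Q = quotient_facts[OF K(1)]
  interpret Q: group "G Mod K" by (rule Q(1))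
  interpret h: group_hom G "G Mod K" "\<lambda>a. K #> a" by (rule Q(2))
  have prQ: "t = p \<or> t = q" if "prime t" "t dvd card (carrier (G Mod K))" for t
    using primes[OF that(1)] that(2) Q(3) by (metis dvd_mult2)
  have nontriv: "carrier (G Mod K) \<noteq> {\<one>\<^bsub>G Mod K\<^esub>}" using Q(5)[OF K(2)] by simp
  obtain N r where N: "N \<lhd> G Mod K" "N \<noteq> {\<one>\<^bsub>G Mod K\<^esub>}" "r = p \<or> r = q" "\<forall>x\<in>N. x [^]\<^bsub>G Mod K\<^esub> r = \<one>\<^bsub>G Mod K\<^esub>"
    using Q.two_primes_normal_elementary[OF Q(4)[OF fin] nontriv pq prQ] by blast
  define L where "L = {g \<in> carrier G. K #> g \<in> N}"
  note lift = quotient_normal_lift[OF K(1) N(1), folded L_def]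
  have "x [^] r \<in> K" if x: "x \<in> L" for x
  proof -
    have xc: "x \<in> carrier G" "K #> x \<in> N" using x by (auto simp: L_def)
    have "K #> (x [^] r) = (K #> x) [^]\<^bsub>G Mod K\<^esub> r" using h.hom_nat_pow[OF xc(1)] by simp
    also have "\<dots> = K" using N(4) xc by simp
    finally show ?thesis using Q(6) xc by simp
  qed
  moreover have "K \<subset> L" using lift N(2) by auto
  ultimately show ?thesis using N(3) lift(1) by blast
qed

text \<open>For finite groups this is nilpotency: \<open>L / K\<close> is a non-trivial central subgroup of the quotient by \<open>K\<close>. It
is written with commutators in the group itself, to be applied without passing to quotients.\<close>
definition hypercentral :: bool where
  "hypercentral \<longleftrightarrow> (\<forall>K. K \<lhd> G \<longrightarrow> K \<noteq> carrier G \<longrightarrow>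
     (\<exists>L. L \<lhd> G \<and> K \<subset> L \<and> (\<forall>l\<in>L. \<forall>g\<in>carrier G. g \<otimes> l \<otimes> inv g \<otimes> inv l \<in> K)))"

lemma central_quotient_lift:
  assumes K: "K \<lhd> G" and z: "z \<in> group.center (G Mod K)" "z \<noteq> K"
  shows "\<exists>L. L \<lhd> G \<and> K \<subset> L \<and> (\<forall>l\<in>L. \<forall>g\<in>carrier G. g \<otimes> l \<otimes> inv g \<otimes> inv l \<in> K)"
proof -
  note Q = quotient_facts[OF K]
  interpret Q: group "G Mod K" by (rule Q(1))
  interpret h: group_hom G "G Mod K" "\<lambda>a. K #> a" by (rule Q(2))
  define L where "L = {g \<in> carrier G. K #> g \<in> Q.center}"
  note lift = quotient_normal_lift[OF K Q.center_normal, folded L_def]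
  have "K \<subset> L" using lift z by auto
  moreover have "g \<otimes> l \<otimes> inv g \<otimes> inv l \<in> K" if l: "l \<in> L" and g: "g \<in> carrier G" for l g
  proof -
    have lc: "l \<in> carrier G" "K #> l \<in> Q.center" using l by (auto simp: L_def)
    let ?g = "K #> g" and ?l = "K #> l"
    have gQ: "?g \<in> carrier (G Mod K)" using g by (rule h.hom_closed)
    have lQ: "?l \<in> carrier (G Mod K)" using lc by (intro h.hom_closed)
    have com: "?g \<otimes>\<^bsub>G Mod K\<^esub> ?l = ?l \<otimes>\<^bsub>G Mod K\<^esub> ?g" using lc(2) gQ by (auto simp: Q.center_def)
    have "K #> (g \<otimes> l \<otimes> inv g \<otimes> inv l) = ?g \<otimes>\<^bsub>G Mod K\<^esub> ?l \<otimes>\<^bsub>G Mod K\<^esub> inv\<^bsub>G Mod K\<^esub> ?g \<otimes>\<^bsub>G Mod K\<^esub> inv\<^bsub>G Mod K\<^esub> ?l"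
      using g lc(1) by (simp only: h.hom_mult h.hom_inv m_closed inv_closed)
    also have "\<dots> = \<one>\<^bsub>G Mod K\<^esub>" unfolding com using gQ lQ
      by (simp only: Q.m_assoc Q.inv_closed Q.m_closed Q.r_inv Q.l_inv Q.r_one Q.inv_mult_cancel)
    finally have "K #> (g \<otimes> l \<otimes> inv g \<otimes> inv l) = K" by (simp only: one_FactGroup)
    moreover have "g \<otimes> l \<otimes> inv g \<otimes> inv l \<in> carrier G" using g lc(1) by simp
    ultimately show ?thesis using Q(6) by blast
  qed
  ultimately show ?thesis using lift(1) by blast
qed

lemma prime_power_order_hypercentral:
  assumes p: "prime (p::nat)" and card: "card (carrier G) = p ^ n"
  shows "hypercentral"
  unfolding hypercentral_def
proof (intro allI impI)
  fix K assume K: "K \<lhd> G" "K \<noteq> carrier G"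
  have fin: "finite (carrier G)" using card p by (metis card.infinite power_not_zero not_prime_0)
  note Q = quotient_facts[OF K(1)]
  interpret Q: group "G Mod K" by (rule Q(1))
  have "card (carrier (G Mod K)) dvd p ^ n" using Q(3) card by (metis dvd_triv_left)
  then obtain m where m: "card (carrier (G Mod K)) = p ^ m" using p by (auto simp: divides_primepow_nat)
  have "m \<noteq> 0"
  proof
    assume "m = 0"
    then have "card K = card (carrier G)" using Q(3) m by simp
    then have "K = carrier G"
      by (intro card_subset_eq[OF fin subgroup.subset[OF normal_imp_subgroup[OF K(1)]]])
    then show False using K(2) by simp
  qed
  then have m1: "m \<ge> 1" by simp
  obtain z where z: "z \<in> Q.center" "z \<noteq> K"
    using Q.prime_power_order_center[OF p m m1] by auto
  then show "\<exists>L. L \<lhd> G \<and> K \<subset> L \<and> (\<forall>l\<in>L. \<forall>g\<in>carrier G. g \<otimes> l \<otimes> inv g \<otimes> inv l \<in> K)"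
    by (rule central_quotient_lift[OF K(1)])
qed

section \<open>Subgroups of hypercentral groups\<close>


text \<open>Normality of \<open>K\<close> in the subgroup \<open>U\<close>, expressed inside the ambient group so that different
subgroups \<open>U\<close> can be compared without changing the carrier.\<close>
definition normalized_in :: "'a set \<Rightarrow> 'a set \<Rightarrow> bool" where
  "normalized_in U K \<longleftrightarrow> subgroup K G \<and> K \<subseteq> U \<and> (\<forall>u\<in>U. \<forall>k\<in>K. u \<otimes> k \<otimes> inv u \<in> K)"

lemma normalized_in_iff:
  assumes U: "subgroup U G"
  shows "normalized_in U K \<longleftrightarrow> K \<lhd> G\<lparr>carrier := U\<rparr>"
proof -
  interpret U: group "G\<lparr>carrier := U\<rparr>" by (rule subgroup.subgroup_is_group[OF U is_group])
  have "subgroup K (G\<lparr>carrier := U\<rparr>) \<longleftrightarrow> subgroup K G \<and> K \<subseteq> U"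
    using incl_subgroup[OF U] subgroup_incl[OF _ U] subgroup.subset[of K "G\<lparr>carrier := U\<rparr>"] by auto
  then show ?thesis
    unfolding normalized_in_def U.normal_inv_iff using m_inv_consistent[OF U] by auto
qed

lemma set_mult_subgroup:
  assumes M: "subgroup M G" and L: "subgroup L G"
    and norm: "\<And>m l. m \<in> M \<Longrightarrow> l \<in> L \<Longrightarrow> m \<otimes> l \<otimes> inv m \<in> L"
  shows "subgroup (M <#> L) G"
proof (rule subgroupI)
  have Mc: "m \<in> carrier G" if "m \<in> M" for m using that subgroup.subset[OF M] by blast
  have Lc: "l \<in> carrier G" if "l \<in> L" for l using that subgroup.subset[OF L] by blast
  show "M <#> L \<subseteq> carrier G" using Mc Lc by (auto simp: set_mult_def)
  show "M <#> L \<noteq> {}" using subgroup.one_closed[OF M] subgroup.one_closed[OF L] by (auto simp: set_mult_def)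
  fix a assume "a \<in> M <#> L"
  then obtain m l where a: "m \<in> M" "l \<in> L" "a = m \<otimes> l" by (auto simp: set_mult_def)
  have im: "inv m \<in> M" using a subgroup.m_inv_closed[OF M] by blast
  have il: "inv l \<in> L" using a subgroup.m_inv_closed[OF L] by blast
  have "inv a = inv m \<otimes> (m \<otimes> inv l \<otimes> inv m)"
    using a Mc Lc by (simp add: inv_mult_group m_assoc)
  then show "inv a \<in> M <#> L" using im norm[OF a(1) il] by (auto simp: set_mult_def)
  fix b assume "b \<in> M <#> L"
  then obtain m' l' where b: "m' \<in> M" "l' \<in> L" "b = m' \<otimes> l'" by (auto simp: set_mult_def)
  have im': "inv m' \<in> M" using b subgroup.m_inv_closed[OF M] by blast
  have "a \<otimes> b = (m \<otimes> m') \<otimes> ((inv m' \<otimes> l \<otimes> inv (inv m')) \<otimes> l')"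
    using a b Mc Lc by (simp add: m_assoc)
  moreover have "(inv m' \<otimes> l \<otimes> inv (inv m')) \<otimes> l' \<in> L"
    using norm[OF im' a(2)] b subgroup.m_closed[OF L] by blast
  moreover have "m \<otimes> m' \<in> M" using a b subgroup.m_closed[OF M] by blast
  ultimately show "a \<otimes> b \<in> M <#> L" by (auto simp: set_mult_def)
qed

lemma set_mult_supsets:
  assumes "subgroup M G" "subgroup L G"
  shows "M \<subseteq> M <#> L" "L \<subseteq> M <#> L"
proof -
  show "M \<subseteq> M <#> L"
    using assms subgroup.one_closed[OF assms(2)] subgroup.subset[OF assms(1)]
    by (force simp: set_mult_def)
  show "L \<subseteq> M <#> L"
    using assms subgroup.one_closed[OF assms(1)] subgroup.subset[OF assms(2)]
    by (force simp: set_mult_def)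
qed

lemma subgroup_nat_pow_closed: "subgroup U G \<Longrightarrow> u \<in> U \<Longrightarrow> u [^] (k::nat) \<in> U"
  by (metis int_pow_int subgroup_int_pow_closed)

lemma power_mod_normalized:
  fixes k :: nat
  assumes U: "subgroup U G" and L: "normalized_in U L" and a: "a \<in> U" "l \<in> L"
  shows "(a \<otimes> l) [^] k \<otimes> inv (a [^] k) \<in> L"
proof (induction k)
  case 0
  then show ?case using L by (auto simp: normalized_in_def subgroup.one_closed)
next
  case (Suc k)
  have Ls: "subgroup L G" and Ln: "\<And>u k. u \<in> U \<Longrightarrow> k \<in> L \<Longrightarrow> u \<otimes> k \<otimes> inv u \<in> L"
    using L by (auto simp: normalized_in_def)
  have ac: "a \<in> carrier G" and lc: "l \<in> carrier G"
    using a subgroup.subset[OF U] subgroup.subset[OF Ls] by auto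
  have "(a \<otimes> l) [^] Suc k \<otimes> inv (a [^] Suc k)
      = ((a \<otimes> l) [^] k \<otimes> inv (a [^] k)) \<otimes> (a [^] Suc k \<otimes> l \<otimes> inv (a [^] Suc k))"
    using ac lc by (simp add: inv_mult_group m_assoc)
  moreover have "a [^] Suc k \<otimes> l \<otimes> inv (a [^] Suc k) \<in> L"
    by (rule Ln[OF subgroup_nat_pow_closed[OF U a(1)] a(2)])
  ultimately show ?case using Suc subgroup.m_closed[OF Ls] by simp
qed

lemma normalizer_subgroup:
  assumes fin: "finite (carrier G)" and P: "subgroup P G"
  shows "subgroup {g \<in> carrier G. \<forall>x\<in>P. g \<otimes> x \<otimes> inv g \<in> P} G" (is "subgroup ?N G")
proof (rule subgroupI)
  have Pc: "x \<in> carrier G" if "x \<in> P" for x using that subgroup.subset[OF P] by blast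
  show "?N \<noteq> {}" using Pc by (auto intro!: exI[of _ \<one>])
  fix a assume a: "a \<in> ?N"
  have "(\<lambda>x. a \<otimes> x \<otimes> inv a) ` P = P"
  proof (rule endo_inj_surj)
    show "finite P" using fin subgroup.subset[OF P] finite_subset by blast
    show "inj_on (\<lambda>x. a \<otimes> x \<otimes> inv a) P" using a Pc by (auto simp: inj_on_def)
  qed (use a in auto)
  then have surj: "\<exists>y\<in>P. x = a \<otimes> y \<otimes> inv a" if "x \<in> P" for x using that by blast
  have "inv a \<otimes> x \<otimes> inv (inv a) \<in> P" if xP: "x \<in> P" for x
  proof -
    obtain y where y: "y \<in> P" "x = a \<otimes> y \<otimes> inv a" using surj[OF xP] by blast
    then have "inv a \<otimes> x \<otimes> inv (inv a) = y" using a Pc by (simp add: m_assoc)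
    then show ?thesis using y by simp
  qed
  then show "inv a \<in> ?N" using a by simp
  fix b assume b: "b \<in> ?N"
  have "a \<otimes> b \<otimes> x \<otimes> inv (a \<otimes> b) \<in> P" if x: "x \<in> P" for x
  proof -
    have "a \<otimes> b \<otimes> x \<otimes> inv (a \<otimes> b) = a \<otimes> (b \<otimes> x \<otimes> inv b) \<otimes> inv a"
      using a b Pc[OF x] by (simp add: inv_mult_group m_assoc)
    then show ?thesis using a b x by simp
  qed
  then show "a \<otimes> b \<in> ?N" using a b by simp
qed auto

text \<open>Let \<open>K\<close> be maximal among the normal subgroups inside \<open>M\<close>. A larger normal \<open>L\<close> with \<open>L / K\<close> central is not
contained in \<open>M\<close>, and it normalizes \<open>M\<close> because commutators with \<open>L\<close> fall into \<open>K\<close>.\<close>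
lemma hypercentral_normalizer_grows:
  assumes fin: "finite (carrier G)" and hyp: hypercentral and M: "subgroup M G" "M \<noteq> carrier G"
  shows "\<exists>y\<in>carrier G - M. \<forall>m\<in>M. y \<otimes> m \<otimes> inv y \<in> M"
proof -
  define \<K> where "\<K> = {K. K \<lhd> G \<and> K \<subseteq> M}"
  have "{\<one>} \<in> \<K>" using one_is_normal subgroup.one_closed[OF M(1)] by (auto simp: \<K>_def)
  moreover have "\<K> \<subseteq> Pow M" by (auto simp: \<K>_def)
  moreover have "finite (Pow M)" using fin subgroup.subset[OF M(1)] finite_subset by auto
  ultimately obtain K where K: "K \<in> \<K>" and max: "\<And>N. N \<in> \<K> \<Longrightarrow> K \<subseteq> N \<Longrightarrow> N = K"
    using finite_has_maximal[of \<K>] by (metis empty_iff finite_subset)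
  have Kn: "K \<lhd> G" "K \<subseteq> M" using K by (auto simp: \<K>_def)
  then have "K \<noteq> carrier G" using M subgroup.subset[OF M(1)] by blast
  then have "\<exists>L. L \<lhd> G \<and> K \<subset> L \<and> (\<forall>l\<in>L. \<forall>g\<in>carrier G. g \<otimes> l \<otimes> inv g \<otimes> inv l \<in> K)"
    using hyp Kn(1) unfolding hypercentral_def by simp
  then obtain L where L: "L \<lhd> G" "K \<subset> L"
    and com': "\<forall>l\<in>L. \<forall>g\<in>carrier G. g \<otimes> l \<otimes> inv g \<otimes> inv l \<in> K" by (elim exE conjE)
  have com: "g \<otimes> l \<otimes> inv g \<otimes> inv l \<in> K" if "l \<in> L" "g \<in> carrier G" for l g
    using com' that by simp
  have "\<not> L \<subseteq> M" using max[of L] L by (auto simp: \<K>_def)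
  then obtain y where y: "y \<in> L" "y \<notin> M" by blast
  have yc: "y \<in> carrier G" using y subgroup.subset[OF normal_imp_subgroup[OF L(1)]] by blast
  have "y \<otimes> m \<otimes> inv y \<in> M" if m: "m \<in> M" for m
  proof -
    have mc: "m \<in> carrier G" using m subgroup.subset[OF M(1)] by blast
    have "m \<otimes> y \<otimes> inv m \<otimes> inv y \<in> M" using com[OF y(1) mc] Kn by blast
    then have "inv (m \<otimes> y \<otimes> inv m \<otimes> inv y) \<otimes> m \<in> M"
      using subgroup.m_inv_closed[OF M(1)] subgroup.m_closed[OF M(1)] m by blast
    moreover have "inv (m \<otimes> y \<otimes> inv m \<otimes> inv y) \<otimes> m = y \<otimes> m \<otimes> inv y"
      using mc yc by (simp add: inv_mult_group m_assoc)
    ultimately show ?thesis by simp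
  qed
  then show ?thesis using y yc by blast
qed

text \<open>A maximal proper subgroup above \<open>M\<close> is normal, since its normalizer is larger.\<close>
lemma hypercentral_proper_subgroup_in_normal:
  assumes fin: "finite (carrier G)" and hyp: hypercentral and M: "subgroup M G" "M \<noteq> carrier G"
  shows "\<exists>N. N \<lhd> G \<and> M \<subseteq> N \<and> N \<noteq> carrier G"
proof -
  define \<N> where "\<N> = {N. subgroup N G \<and> M \<subseteq> N \<and> N \<noteq> carrier G}"
  have "M \<in> \<N>" using M by (simp add: \<N>_def)
  moreover have "\<N> \<subseteq> Pow (carrier G)" using subgroup.subset by (fastforce simp: \<N>_def)
  ultimately obtain N where N: "N \<in> \<N>" and max: "\<And>N'. N' \<in> \<N> \<Longrightarrow> N \<subseteq> N' \<Longrightarrow> N' = N"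
    using finite_has_maximal[of \<N>] fin by (metis empty_iff finite_Pow_iff finite_subset)
  have Ns: "subgroup N G" "M \<subseteq> N" "N \<noteq> carrier G" using N by (auto simp: \<N>_def)
  let ?Z = "{g \<in> carrier G. \<forall>x\<in>N. g \<otimes> x \<otimes> inv g \<in> N}"
  obtain y where y: "y \<in> carrier G - N" "\<forall>m\<in>N. y \<otimes> m \<otimes> inv y \<in> N"
    using hypercentral_normalizer_grows[OF fin hyp Ns(1,3)] by blast
  have NZ: "N \<subseteq> ?Z"
    using subgroup.subset[OF Ns(1)] subgroup.m_closed[OF Ns(1)] subgroup.m_inv_closed[OF Ns(1)] by blast
  have "?Z = carrier G"
  proof (rule ccontr)
    assume "?Z \<noteq> carrier G"
    then have "?Z \<in> \<N>" using normalizer_subgroup[OF fin Ns(1)] Ns(2) NZ unfolding \<N>_def by blast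
    then have "?Z = N" using max NZ by blast
    then show False using y by blast
  qed
  then have "N \<lhd> G" using Ns(1) by (intro normal_invI) auto
  then show ?thesis using Ns by blast
qed

text \<open>Let \<open>P\<close> be maximal among the subgroups consisting of \<open>p\<close>-elements. It contains all \<open>p\<close>-elements of its
normalizer \<open>?M\<close>, hence is invariant under everything that normalizes \<open>?M\<close>. So \<open>?M\<close> is its own
normalizer, which makes it the whole group.\<close>
lemma hypercentral_p_elements_subgroup:
  assumes fin: "finite (carrier G)" and hyp: hypercentral
  shows "subgroup {x \<in> carrier G. \<exists>k. x [^] ((p::nat) ^ k) = \<one>} G"
proof -
  let ?E = "{x \<in> carrier G. \<exists>k. x [^] (p ^ k) = \<one>}"
  define \<P> where "\<P> = {P. subgroup P G \<and> P \<subseteq> ?E}"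
  have "{\<one>} \<in> \<P>" using triv_subgroup by (auto simp: \<P>_def)
  moreover have "\<P> \<subseteq> Pow (carrier G)" by (auto simp: \<P>_def)
  ultimately obtain P where P: "P \<in> \<P>" and max: "\<And>P'. P' \<in> \<P> \<Longrightarrow> P \<subseteq> P' \<Longrightarrow> P' = P"
    using finite_has_maximal[of \<P>] fin by (metis empty_iff finite_Pow_iff finite_subset)
  have Ps: "subgroup P G" "P \<subseteq> ?E" using P by (auto simp: \<P>_def)
  let ?M = "{g \<in> carrier G. \<forall>x\<in>P. g \<otimes> x \<otimes> inv g \<in> P}"
  have Ms: "subgroup ?M G" by (rule normalizer_subgroup[OF fin Ps(1)])
  have PM: "P \<subseteq> ?M"
    using subgroup.subset[OF Ps(1)] subgroup.m_closed[OF Ps(1)] subgroup.m_inv_closed[OF Ps(1)] by blast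
  have nP: "normalized_in ?M P" using Ps(1) PM by (auto simp: normalized_in_def)
  have in_P: "y \<in> P" if y: "y \<in> ?M" "y \<in> ?E" for y
  proof -
    have yc: "y \<in> carrier G" using y by simp
    obtain k where k: "y [^] (p ^ k) = \<one>" using y by blast
    let ?Y = "generate G {y}"
    have Y: "subgroup ?Y G" using yc by (intro generate_is_subgroup) auto
    have YM: "?Y \<subseteq> ?M" using generate_subgroup_incl[OF _ Ms] y by blast
    have Yk: "u [^] (p ^ k) = \<one>" if u: "u \<in> ?Y" for u
    proof -
      obtain i :: int where "u = y [^] i" using u generate_pow[OF yc] by auto
      then show ?thesis using yc k
        by (metis int_pow_int int_pow_one int_pow_pow mult.commute)
    qed
    have S: "subgroup (?Y <#> P) G"
      using YM by (intro set_mult_subgroup[OF Y Ps(1)]) blast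
    have "?Y <#> P \<subseteq> ?E"
    proof
      fix x assume x: "x \<in> ?Y <#> P"
      then obtain u v where uv: "u \<in> ?Y" "v \<in> P" "x = u \<otimes> v" by (auto simp: set_mult_def)
      have xc: "x \<in> carrier G" using x subgroup.subset[OF S] by blast
      have "x [^] (p ^ k) \<otimes> inv (u [^] (p ^ k)) \<in> P"
        unfolding uv(3) by (rule power_mod_normalized[OF Ms nP]) (use uv YM in auto)
      then have "x [^] (p ^ k) \<in> P" using Yk[OF uv(1)] xc by simp
      then obtain j where "(x [^] (p ^ k)) [^] (p ^ j) = \<one>" using Ps(2) by blast
      then have "x [^] (p ^ (k + j)) = \<one>" using xc by (simp add: nat_pow_pow power_add)
      then show "x \<in> ?E" using xc by blast
    qed
    then have "?Y <#> P = P" using max[of "?Y <#> P"] S set_mult_supsets[OF Y Ps(1)] by (simp add: \<P>_def)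
    then have "?Y \<subseteq> P" using set_mult_supsets(1)[OF Y Ps(1)] by simp
    then show ?thesis by (auto intro: generate.incl)
  qed
  have "?M = carrier G"
  proof (rule ccontr)
    assume "?M \<noteq> carrier G"
    then obtain y where y: "y \<in> carrier G - ?M" "\<forall>m\<in>?M. y \<otimes> m \<otimes> inv y \<in> ?M"
      using hypercentral_normalizer_grows[OF fin hyp Ms] by blast
    have "y \<otimes> x \<otimes> inv y \<in> P" if x: "x \<in> P" for x
    proof (rule in_P)
      show "y \<otimes> x \<otimes> inv y \<in> ?M" using y(2) PM x by blast
      have xc: "x \<in> carrier G" using x subgroup.subset[OF Ps(1)] by blast
      have yc: "y \<in> carrier G" using y by blast
      have "(y \<otimes> x \<otimes> inv y) [^] i = y \<otimes> x [^] i \<otimes> inv y" for i :: nat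
        by (induction i) (use xc yc in \<open>simp_all add: m_assoc\<close>)
      moreover obtain k where "x [^] (p ^ k) = \<one>" using x Ps(2) by blast
      ultimately have "(y \<otimes> x \<otimes> inv y) [^] (p ^ k) = \<one>" using yc by simp
      then show "y \<otimes> x \<otimes> inv y \<in> ?E" using xc yc by blast
    qed
    then show False using y by blast
  qed
  then have "?E \<subseteq> P" using in_P by blast
  then have "?E = P" using Ps(2) by blast
  then show ?thesis using Ps(1) by simp
qed

text \<open>All fibers of the multiplication map \<open>H \<times> K \<rightarrow> H K\<close> have the size of \<open>H \<inter> K\<close>.\<close>
lemma card_set_mult_dvd:
  assumes H: "subgroup H G" and K: "subgroup K G" and fin: "finite (carrier G)"
  shows "card (H <#> K) dvd card H * card K"
proof -
  have Hc: "h \<in> carrier G" if "h \<in> H" for h using that subgroup.subset[OF H] by blast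
  have Kc: "k \<in> carrier G" if "k \<in> K" for k using that subgroup.subset[OF K] by blast
  have finHK: "finite H" "finite K" using fin subgroup.subset[OF H] subgroup.subset[OF K] finite_subset by auto
  let ?F = "\<lambda>y. {hk \<in> H \<times> K. fst hk \<otimes> snd hk = y}"
  have card_F: "card (?F y) = card (H \<inter> K)" if y: "y \<in> H <#> K" for y
  proof -
    obtain h k where hk: "h \<in> H" "k \<in> K" "y = h \<otimes> k" using y by (auto simp: set_mult_def)
    have "bij_betw (\<lambda>x. (h \<otimes> x, inv x \<otimes> k)) (H \<inter> K) (?F y)"
    proof (rule bij_betwI[where g = "\<lambda>hk. inv h \<otimes> fst hk"])
      show "(\<lambda>x. (h \<otimes> x, inv x \<otimes> k)) \<in> H \<inter> K \<rightarrow> ?F y"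
        using hk Hc Kc subgroup.m_closed[OF H] subgroup.m_closed[OF K] subgroup.m_inv_closed[OF K]
        by (auto simp: m_assoc)
      show "(\<lambda>hk. inv h \<otimes> fst hk) \<in> ?F y \<rightarrow> H \<inter> K"
      proof
        fix w assume "w \<in> ?F y"
        then obtain a b where w: "w = (a, b)" "a \<in> H" "b \<in> K" "a \<otimes> b = h \<otimes> k" using hk by auto
        have "inv h \<otimes> a = k \<otimes> inv b"
        proof -
          have "inv h \<otimes> a = inv h \<otimes> (a \<otimes> b) \<otimes> inv b"
            using hk(1) w(2,3) Hc Kc by (simp add: m_assoc)
          also have "\<dots> = k \<otimes> inv b" unfolding w(4) using hk(1,2) w(3) Hc Kc by (simp add: m_assoc)
          finally show ?thesis .
        qed
        moreover have "inv h \<otimes> a \<in> H" using hk w subgroup.m_closed[OF H] subgroup.m_inv_closed[OF H] by blast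
        moreover have "k \<otimes> inv b \<in> K" using hk w subgroup.m_closed[OF K] subgroup.m_inv_closed[OF K] by blast
        ultimately show "inv h \<otimes> fst w \<in> H \<inter> K" using w by simp
      qed
      show "inv h \<otimes> fst (h \<otimes> x, inv x \<otimes> k) = x" if "x \<in> H \<inter> K" for x
        using that hk Hc by simp
      show "(h \<otimes> (inv h \<otimes> fst w), inv (inv h \<otimes> fst w) \<otimes> k) = w" if wF: "w \<in> ?F y" for w
      proof -
        obtain a b where w: "w = (a, b)" "a \<in> H" "b \<in> K" "a \<otimes> b = h \<otimes> k" using wF hk by auto
        have "inv (inv h \<otimes> a) \<otimes> k = inv a \<otimes> (h \<otimes> k)" using hk(1,2) w(2) Hc Kc by (simp add: inv_mult_group m_assoc)
        also have "\<dots> = b" unfolding w(4)[symmetric] using w(2,3) Hc Kc by simp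
        finally show ?thesis using w(1,2) hk(1) Hc by simp
      qed
    qed
    from bij_betw_same_card[OF this] show ?thesis by (rule HOL.sym)
  qed
  have "H \<times> K = (\<Union>y\<in>H <#> K. ?F y)"
  proof (intro equalityI subsetI)
    fix w assume w: "w \<in> H \<times> K"
    have "fst w \<otimes> snd w \<in> H <#> K"
      unfolding set_mult_def using w by (cases w) auto
    then show "w \<in> (\<Union>y\<in>H <#> K. ?F y)" using w by simp
  qed simp
  then have "card (H \<times> K) = card (\<Union>y\<in>H <#> K. ?F y)" by (rule arg_cong)
  also have "\<dots> = (\<Sum>y\<in>H <#> K. card (?F y))"
  proof (rule card_UN_disjoint)
    show "finite (H <#> K)"
      by (rule finite_subset[OF _ fin]) (use Hc Kc in \<open>auto simp: set_mult_def\<close>)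
  qed (use finHK in auto)
  also have "\<dots> = card (H <#> K) * card (H \<inter> K)" using card_F by simp
  finally show ?thesis by (metis card_cartesian_product dvd_triv_left)
qed

end

section \<open>Permutable families of p-subgroups\<close>

lemma (in group) subgroup_conj_closed:
  "subgroup U G \<Longrightarrow> g \<in> U \<Longrightarrow> l \<in> U \<Longrightarrow> g \<otimes> l \<otimes> inv g \<in> U"
  by (simp add: subgroup.m_closed subgroup.m_inv_closed)

text \<open>Permutable \<open>p\<close>-subgroups, one for each prime \<open>p\<close> in \<open>Ps\<close>, together with their products \<open>H A\<close> for the sets \<open>A\<close>
of primes. The subgroups \<open>H A\<close> are Hall subgroups of \<open>H Ps\<close>.\<close>
locale hall_family = group G for G (structure) +
  fixes Ps :: "nat set" and H :: "nat set \<Rightarrow> 'a set"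
  assumes finite_group: "finite (carrier G)"
    and finite_primes: "finite Ps"
    and primes: "\<And>p. p \<in> Ps \<Longrightarrow> prime p"
    and H_subgroup: "\<And>A. A \<subseteq> Ps \<Longrightarrow> subgroup (H A) G"
    and H_Un: "\<And>A B. A \<subseteq> Ps \<Longrightarrow> B \<subseteq> Ps \<Longrightarrow> H (A \<union> B) = H A <#> H B"
    and H_prime: "\<And>p. p \<in> Ps \<Longrightarrow> \<exists>n. card (H {p}) = p ^ n"
    and H_empty: "H {} = {\<one>}"
begin

lemma H_carrier: "A \<subseteq> Ps \<Longrightarrow> x \<in> H A \<Longrightarrow> x \<in> carrier G"
  using H_subgroup subgroup.subset by blast

lemma H_mono:
  assumes "A \<subseteq> B" "B \<subseteq> Ps" shows "H A \<subseteq> H B"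
proof -
  have "H B = H A <#> H B" using H_Un[of A B] assms by (simp add: Un_absorb1)
  then show ?thesis using set_mult_supsets(1)[of "H A" "H B"] H_subgroup assms by (metis subset_trans)
qed

text \<open>By Burnside's theorem there is \<open>L\<close>, normal in \<open>H {p,q}\<close>, such that \<open>L / K\<close> is non-trivial and has
exponent \<open>r\<close>, one of the two primes; let \<open>s\<close> be the other one. An element \<open>l\<close> of \<open>L\<close> is \<open>x y\<close> with \<open>x\<close> in
\<open>H {r}\<close> and \<open>y\<close> in \<open>H {s}\<close>. As \<open>y = x\<^sup>-\<^sup>1 l\<close>, a power of \<open>y\<close> with exponent a power of \<open>r\<close> lies in \<open>L\<close>, and a
further one in \<open>K\<close>. The order of \<open>y\<close> is prime to \<open>r\<close>, so \<open>y\<close> itself lies in \<open>K\<close>. Thus the prime to remove is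
\<open>s\<close>.\<close>
lemma two_prime_extension:
  assumes pq: "p \<in> Ps" "q \<in> Ps" "p \<noteq> q"
    and K: "normalized_in (H {p,q}) K" "K \<noteq> H {p,q}"
  shows "\<exists>r\<in>{p,q}. \<exists>L. normalized_in (H {p,q}) L \<and> K \<subset> L \<and> L \<subseteq> K <#> H ({p,q} - {r})"
proof -
  let ?U = "H {p,q}"
  have U: "subgroup ?U G" using H_subgroup pq by simp
  interpret U: group "G\<lparr>carrier := ?U\<rparr>" by (rule subgroup.subgroup_is_group[OF U is_group])
  have P: "subgroup (H {p}) G" and Q: "subgroup (H {q}) G" using H_subgroup pq by simp_all
  obtain a b where ab: "card (H {p}) = p ^ a" "card (H {q}) = q ^ b" using H_prime pq by blast
  have Uprod: "H {p,q} = H {p} <#> H {q}" "H {p,q} = H {q} <#> H {p}"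
    using H_Un[of "{p}" "{q}"] H_Un[of "{q}" "{p}"] pq by (simp_all add: insert_commute)
  have finU: "finite ?U" using finite_group subgroup.subset[OF U] finite_subset by blast
  have primesU: "t = p \<or> t = q" if t: "prime t" "t dvd card (carrier (G\<lparr>carrier := ?U\<rparr>))" for t
  proof -
    have "card ?U dvd p ^ a * q ^ b"
      using card_set_mult_dvd[OF P Q finite_group] ab Uprod(1) by simp
    then have "t dvd p ^ a * q ^ b" using t(2) dvd_trans by simp
    then have "t dvd p \<or> t dvd q" using t(1) by (metis prime_dvd_mult_iff prime_dvd_power)
    then show ?thesis using t(1) primes pq primes_dvd_imp_eq by blast
  qed
  have Kn: "K \<lhd> G\<lparr>carrier := ?U\<rparr>" using K normalized_in_iff[OF U] by simp
  have "\<exists>L r. L \<lhd> G\<lparr>carrier := ?U\<rparr> \<and> K \<subset> L \<and> (r = p \<or> r = q) \<and> (\<forall>x\<in>L. x [^]\<^bsub>G\<lparr>carrier := ?U\<rparr>\<^esub> r \<in> K)"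
    by (rule U.two_primes_normal_extension[OF _ Kn _ primes[OF pq(1)] primes[OF pq(2)] pq(3) primesU])
      (use finU K in simp_all)
  then obtain L r where L: "L \<lhd> G\<lparr>carrier := ?U\<rparr>" "K \<subset> L" "r = p \<or> r = q"
    and pow': "\<forall>x\<in>L. x [^]\<^bsub>G\<lparr>carrier := ?U\<rparr>\<^esub> r \<in> K" by blast
  have Ln: "normalized_in ?U L" using L normalized_in_iff[OF U] by simp
  have LU: "L \<subseteq> ?U" and Ls: "subgroup L G" using Ln by (auto simp: normalized_in_def)
  have Ks: "subgroup K G" and KU: "K \<subseteq> ?U" and Knorm: "\<And>u k. u \<in> ?U \<Longrightarrow> k \<in> K \<Longrightarrow> u \<otimes> k \<otimes> inv u \<in> K"
    using K(1) by (auto simp: normalized_in_def)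
  have pow: "x [^] r \<in> K" if "x \<in> L" for x
    using pow' that by (simp add: nat_pow_consistent[symmetric])
  define s where "s = (if r = p then q else p)"
  have rs: "r \<in> Ps" "s \<in> Ps" "r \<noteq> s" "{p,q} = {r,s}" using L(3) pq by (auto simp: s_def)
  obtain i where i: "card (H {r}) = r ^ i" using H_prime rs by blast
  obtain j where j: "card (H {s}) = s ^ j" using H_prime rs by blast
  have ord_dvd: "x [^] card (H A) = \<one>" if x: "A \<subseteq> Ps" "x \<in> H A" for x A
  proof -
    interpret A: group "G\<lparr>carrier := H A\<rparr>" by (rule subgroup.subgroup_is_group[OF H_subgroup[OF x(1)] is_group])
    have "x [^]\<^bsub>G\<lparr>carrier := H A\<rparr>\<^esub> card (H A) = \<one>"
      using A.pow_order_eq_1[of x] x by (simp add: Coset.order_def)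
    then show ?thesis by (simp add: nat_pow_consistent[symmetric])
  qed
  have "L \<subseteq> K <#> H {r}"
  proof
    fix l assume l: "l \<in> L"
    have "H {p,q} = H {r} <#> H {s}" using Uprod L(3) by (cases "r = p") (simp_all add: s_def)
    then have "l \<in> H {r} <#> H {s}" using l LU by blast
    then obtain x y where xy: "x \<in> H {r}" "y \<in> H {s}" "l = x \<otimes> y" by (auto simp: set_mult_def)
    have xc: "x \<in> carrier G" by (rule H_carrier[OF _ xy(1)]) (use rs in simp)
    have yc: "y \<in> carrier G" by (rule H_carrier[OF _ xy(2)]) (use rs in simp)
    have "H {r} \<subseteq> ?U" by (rule H_mono) (use rs pq in auto)
    then have xU: "x \<in> ?U" using xy(1) by blast
    have yl: "y = inv x \<otimes> l" using xy(3) xc yc by simp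
    have "y [^] (r ^ i) \<otimes> inv (inv x [^] (r ^ i)) \<in> L" unfolding yl
      by (rule power_mod_normalized[OF U Ln subgroup.m_inv_closed[OF U xU] l])
    moreover have "inv x [^] (r ^ i) = \<one>"
      using ord_dvd[of "{r}" x] xy(1) i rs xc by (simp add: nat_pow_inv)
    ultimately have "y [^] (r ^ i) \<in> L" using yc by simp
    then have yK: "y [^] (r ^ i * r) \<in> K" using pow yc by (metis nat_pow_pow)
    have ys: "y [^] (s ^ j) = \<one>" using ord_dvd[of "{s}" y] xy(2) j rs by simp
    have "coprime (int (r ^ i * r)) (int (s ^ j))"
      using primes_coprime[OF primes[OF rs(1)] primes[OF rs(2)] rs(3)] by simp
    then obtain u v where uv: "u * int (r ^ i * r) + v * int (s ^ j) = 1"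
      by (metis bezout_int coprime_imp_gcd_eq_1)
    have "y = y [^] (u * int (r ^ i * r) + v * int (s ^ j))" using uv yc by simp
    also have "\<dots> = (y [^] (r ^ i * r)) [^] u \<otimes> (y [^] (s ^ j)) [^] v"
      using yc by (simp add: int_pow_mult int_pow_pow mult.commute flip: int_pow_int)
    also have "\<dots> = (y [^] (r ^ i * r)) [^] u" using ys yc by simp
    finally have "y = (y [^] (r ^ i * r)) [^] u" .
    then have yK: "y \<in> K" using subgroup_int_pow_closed[OF Ks yK, of u] by simp
    have "l = (x \<otimes> y \<otimes> inv x) \<otimes> x" using xy(3) xc yc by (simp add: m_assoc)
    then show "l \<in> K <#> H {r}" using Knorm[OF xU yK] xy(1) unfolding set_mult_def by blast
  qed
  moreover have "{p,q} - {s} = {r}" using rs by auto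
  moreover have "s \<in> {p,q}" using rs by auto
  ultimately show ?thesis using Ln L(2) by metis
qed

text \<open>By induction on \<open>A\<close>, with one prime removed in \<open>A1\<close>. If \<open>K\<close> contains \<open>H A1\<close>, then \<open>H A\<close> itself serves as
\<open>L\<close>. Otherwise the induction hypothesis for \<open>K \<inter> H A1\<close> gives \<open>L1\<close>, normal in \<open>H A1\<close>, and \<open>L\<close> is
generated by \<open>K\<close> and the conjugates of \<open>L1\<close> in \<open>H A\<close>. These conjugates do not leave the subgroup
\<open>K H (A - {p3})\<close> that contains \<open>L1\<close>, because \<open>H A = H (A - {p3}) H A1\<close>: conjugation by the second factor
preserves \<open>L1\<close>, and the first factor lies in that subgroup.\<close>
lemma normal_extension_in_smaller_family:
  "A \<subseteq> Ps \<Longrightarrow> card A \<ge> 2 \<Longrightarrow> normalized_in (H A) K \<Longrightarrow> K \<noteq> H A \<Longrightarrow>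
   \<exists>r\<in>A. \<exists>L. normalized_in (H A) L \<and> K \<subset> L \<and> L \<subseteq> K <#> H (A - {r})"
proof (induction "card A" arbitrary: A K rule: less_induct)
  case less
  note A = less.prems(1) and K = less.prems(3,4)
  have finA: "finite A" using A finite_primes finite_subset by blast
  have Us: "subgroup (H A) G" by (rule H_subgroup[OF A])
  have Ks: "subgroup K G" and KU: "K \<subseteq> H A" and Knorm: "\<And>u k. u \<in> H A \<Longrightarrow> k \<in> K \<Longrightarrow> u \<otimes> k \<otimes> inv u \<in> K"
    using K(1) by (auto simp: normalized_in_def)
  show ?case
  proof (cases "card A = 2")
    case True
    then obtain p q where pq: "A = {p,q}" "p \<noteq> q" by (meson card_2_iff)
    show ?thesis using two_prime_extension[of p q K] pq A K by simp
  next
    case False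
    then have c3: "card A \<ge> 3" using less.prems(2) by simp
    then obtain p1 where p1: "p1 \<in> A" by fastforce
    define A1 where "A1 = A - {p1}"
    have A1: "A1 \<subseteq> Ps" "A1 \<subseteq> A" "card A1 = card A - 1" using A p1 finA by (auto simp: A1_def)
    have A1s: "subgroup (H A1) G" by (rule H_subgroup[OF A1(1)])
    have H1A: "H A1 \<subseteq> H A" by (rule H_mono[OF A1(2) A])
    have A_split: "H A = H B <#> H C" if "B \<union> C = A" for B C
      using H_Un[of B C] that A by blast
    define K1 where "K1 = K \<inter> H A1"
    have K1n: "normalized_in (H A1) K1" unfolding normalized_in_def
    proof (intro conjI ballI)
      show "subgroup K1 G" unfolding K1_def by (rule subgroups_Inter_pair[OF Ks A1s])
      fix u k assume u: "u \<in> H A1" and k: "k \<in> K1"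
      have "u \<otimes> k \<otimes> inv u \<in> K" using Knorm u k H1A by (auto simp: K1_def)
      moreover have "u \<otimes> k \<otimes> inv u \<in> H A1"
        by (rule subgroup_conj_closed[OF A1s u]) (use k in \<open>simp add: K1_def\<close>)
      ultimately show "u \<otimes> k \<otimes> inv u \<in> K1" by (simp add: K1_def)
    qed (simp add: K1_def)
    show ?thesis
    proof (cases "K1 = H A1")
      case True
      have "A1 \<noteq> {}" using A1(3) c3 by auto
      then obtain p2 where p2: "p2 \<in> A1" by blast
      have "H A \<subseteq> K <#> H (A - {p2})"
      proof -
        have "H A = H A1 <#> H (A - {p2})"
          by (rule A_split) (use p2 p1 in \<open>auto simp: A1_def\<close>)
        then show ?thesis using True mono_set_mult[of "H A1" K "H (A - {p2})" "H (A - {p2})" G] by (auto simp: K1_def)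
      qed
      moreover have "normalized_in (H A) (H A)"
        using Us subgroup_conj_closed[OF Us] by (simp add: normalized_in_def)
      moreover have "p2 \<in> A" using p2 A1 by blast
      ultimately show ?thesis using KU K(2) by blast
    next
      case ne: False
      have "\<exists>r\<in>A1. \<exists>L. normalized_in (H A1) L \<and> K1 \<subset> L \<and> L \<subseteq> K1 <#> H (A1 - {r})"
        by (rule less.hyps[OF _ A1(1) _ K1n ne]) (use A1(3) c3 in simp_all)
      then obtain p3 L1 where p3: "p3 \<in> A1"
        and L1: "normalized_in (H A1) L1" "K1 \<subset> L1" "L1 \<subseteq> K1 <#> H (A1 - {p3})" by blast
      have p3A: "p3 \<in> A" using p3 A1 by blast
      let ?H2 = "H (A - {p3})"
      have H2s: "subgroup ?H2 G" by (rule H_subgroup) (use A in blast)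
      have H2A: "?H2 \<subseteq> H A" by (rule H_mono) (use A in auto)
      let ?KH = "?H2 <#> K"
      have KHs: "subgroup ?KH G"
        by (rule set_mult_subgroup[OF H2s Ks]) (use Knorm H2A in blast)
      have KH_eq: "?KH = K <#> ?H2"
      proof (rule Set.set_eqI)
        fix x
        show "x \<in> ?KH \<longleftrightarrow> x \<in> K <#> ?H2"
        proof
          assume "x \<in> ?KH"
          then obtain h k where hk: "h \<in> ?H2" "k \<in> K" "x = h \<otimes> k" by (auto simp: set_mult_def)
          have c: "h \<in> carrier G" "k \<in> carrier G" using hk subgroup.subset[OF H2s] subgroup.subset[OF Ks] by auto
          have "x = (h \<otimes> k \<otimes> inv h) \<otimes> h" using hk c by (simp add: m_assoc)
          then show "x \<in> K <#> ?H2" using Knorm[of h k] hk H2A unfolding set_mult_def by blast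
        next
          assume "x \<in> K <#> ?H2"
          then obtain h k where hk: "h \<in> ?H2" "k \<in> K" "x = k \<otimes> h" by (auto simp: set_mult_def)
          have c: "h \<in> carrier G" "k \<in> carrier G" using hk subgroup.subset[OF H2s] subgroup.subset[OF Ks] by auto
          have ih: "inv h \<in> H A" using hk H2A subgroup.m_inv_closed[OF H2s] by blast
          have "x = h \<otimes> (inv h \<otimes> k \<otimes> inv (inv h))" using hk c by (simp add: m_assoc)
          then show "x \<in> ?KH" using Knorm[OF ih hk(2)] hk(1) unfolding set_mult_def by blast
        qed
      qed
      have L1KH: "L1 \<subseteq> ?KH"
      proof -
        have "H (A1 - {p3}) \<subseteq> ?H2" by (rule H_mono) (use A A1 in auto)
        then have "K1 <#> H (A1 - {p3}) \<subseteq> K <#> ?H2" by (intro mono_set_mult) (auto simp: K1_def)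
        then show ?thesis using L1(3) KH_eq by simp
      qed
      have L1s: "subgroup L1 G" and L1U: "L1 \<subseteq> H A1"
        and L1norm: "\<And>u k. u \<in> H A1 \<Longrightarrow> k \<in> L1 \<Longrightarrow> u \<otimes> k \<otimes> inv u \<in> L1"
        using L1(1) by (auto simp: normalized_in_def)
      have L1c: "x \<in> carrier G" if "x \<in> L1" for x using that subgroup.subset[OF L1s] by blast
      have Uc: "x \<in> carrier G" if "x \<in> H A" for x using that H_carrier[OF A] by blast
      define S where "S = K \<union> {g \<otimes> l \<otimes> inv g |g l. g \<in> H A \<and> l \<in> L1}"
      have SU: "S \<subseteq> H A"
        using KU L1U H1A subgroup_conj_closed[OF Us] unfolding S_def by auto
      have conj_KH: "g \<otimes> l \<otimes> inv g \<in> ?KH" if gl: "g \<in> H A" "l \<in> L1" for g l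
      proof -
        have "H A = ?H2 <#> H A1" by (rule A_split) (use p1 p3 in \<open>auto simp: A1_def\<close>)
        then obtain h2 h1 where g: "h2 \<in> ?H2" "h1 \<in> H A1" "g = h2 \<otimes> h1" using gl(1) by (auto simp: set_mult_def)
        have c: "h2 \<in> carrier G" "h1 \<in> carrier G" "l \<in> carrier G"
          using g gl(2) L1c subgroup.subset[OF H2s] subgroup.subset[OF A1s] by auto
        have eq: "g \<otimes> l \<otimes> inv g = h2 \<otimes> (h1 \<otimes> l \<otimes> inv h1) \<otimes> inv h2"
          unfolding g(3) using c by (simp add: inv_mult_group m_assoc)
        have m: "h1 \<otimes> l \<otimes> inv h1 \<in> ?KH" using L1norm[OF g(2) gl(2)] L1KH by blast
        have "h2 \<in> ?KH" using g(1) set_mult_supsets(1)[OF H2s Ks] by (rule rev_subsetD)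
        then show ?thesis unfolding eq
          using m by (rule subgroup_conj_closed[OF KHs])
      qed
      define L where "L = generate G S"
      have Sc: "S \<subseteq> carrier G" using SU Uc by blast
      have L_U: "L \<subseteq> H A" unfolding L_def by (rule generate_subgroup_incl[OF SU Us])
      interpret U: group "G\<lparr>carrier := H A\<rparr>" by (rule subgroup.subgroup_is_group[OF Us is_group])
      have "generate (G\<lparr>carrier := H A\<rparr>) S \<lhd> G\<lparr>carrier := H A\<rparr>"
      proof (rule U.normal_generateI)
        fix h g assume h: "h \<in> S" and "g \<in> carrier (G\<lparr>carrier := H A\<rparr>)"
        then have g: "g \<in> H A" by simp
        have "g \<otimes> h \<otimes> inv g \<in> S"
        proof (cases "h \<in> K")
          case True
          then show ?thesis using Knorm g by (auto simp: S_def)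
        next
          case False
          then obtain g' l where gl: "g' \<in> H A" "l \<in> L1" "h = g' \<otimes> l \<otimes> inv g'" using h by (auto simp: S_def)
          have "g \<otimes> h \<otimes> inv g = (g \<otimes> g') \<otimes> l \<otimes> inv (g \<otimes> g')"
            unfolding gl(3) using g gl(1,2) Uc L1c by (simp add: inv_mult_group m_assoc)
          then show ?thesis using gl(2) subgroup.m_closed[OF Us g gl(1)] unfolding S_def by blast
        qed
        then show "g \<otimes>\<^bsub>G\<lparr>carrier := H A\<rparr>\<^esub> h \<otimes>\<^bsub>G\<lparr>carrier := H A\<rparr>\<^esub> inv\<^bsub>G\<lparr>carrier := H A\<rparr>\<^esub> g \<in> S"
          using g Us by simp
      qed (use SU in simp)
      moreover have "generate (G\<lparr>carrier := H A\<rparr>) S = L"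
        unfolding L_def by (rule generate_consistent[OF SU Us])
      ultimately have "normalized_in (H A) L" using normalized_in_iff[OF Us] by simp
      moreover have "K \<subset> L"
      proof
        show "K \<subseteq> L" unfolding L_def S_def by (auto intro: generate.incl)
        obtain l where l: "l \<in> L1" "l \<notin> K1" using L1(2) by blast
        have "\<one> \<otimes> l \<otimes> inv \<one> \<in> S" using l(1) subgroup.one_closed[OF Us] unfolding S_def by blast
        then have "l \<in> L" unfolding L_def using L1c[OF l(1)] by (auto intro: generate.incl)
        moreover have "l \<notin> K" using l L1U by (auto simp: K1_def)
        ultimately show "K \<noteq> L" by blast
      qed
      moreover have "L \<subseteq> K <#> ?H2" unfolding L_def KH_eq[symmetric]
        by (rule generate_subgroup_incl[OF _ KHs])
          (use conj_KH set_mult_supsets(2)[OF H2s Ks] in \<open>auto simp: S_def\<close>)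
      ultimately show ?thesis using p3A by blast
    qed
  qed
qed

text \<open>The outer induction is on \<open>A\<close>, the inner one on the index of \<open>M\<close> in \<open>H A\<close>. For a single prime, \<open>H A\<close> is a
\<open>p\<close>-group, and a proper \<open>M\<close> lies in a proper normal subgroup, which would contain all its
conjugates and hence \<open>H A\<close>. For more primes, let \<open>K\<close> be maximal among the normal subgroups of \<open>H A\<close> inside
\<open>M\<close>, and take a larger normal \<open>L\<close> inside \<open>K H B\<close> with \<open>B = A - {r}\<close>. Then \<open>M L\<close> is larger than
\<open>M\<close>, so it is \<open>H A\<close> by the inner induction, and \<open>H A = M H B\<close>. Consequently every conjugate of \<open>M\<close>
in \<open>H A\<close> is already a conjugate by an element of \<open>H B\<close>, so \<open>M \<inter> H B\<close> satisfies the hypotheses for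
\<open>B\<close>. By the outer induction \<open>M\<close> contains \<open>H B\<close>, and therefore \<open>M = H A\<close>.\<close>
theorem conjugates_of_proper_subgroup:
  "A \<subseteq> Ps \<Longrightarrow> subgroup M G \<Longrightarrow> M \<subseteq> H A \<Longrightarrow>
   (\<And>p. p \<in> A \<Longrightarrow> H {p} \<subseteq> generate G (H {p} \<inter> {g \<otimes> m \<otimes> inv g |g m. g \<in> H A \<and> m \<in> M})) \<Longrightarrow>
   M = H A"
proof (induction "card A" arbitrary: A M rule: less_induct)
  case less
  note A = less.prems(1)
  have finA: "finite A" using A finite_primes finite_subset by blast
  have Us: "subgroup (H A) G" by (rule H_subgroup[OF A])
  have finU: "finite (H A)" using finite_group subgroup.subset[OF Us] finite_subset by blast
  interpret U: group "G\<lparr>carrier := H A\<rparr>" by (rule subgroup.subgroup_is_group[OF Us is_group])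
  have Uc: "x \<in> carrier G" if "x \<in> H A" for x using that H_carrier[OF A] by blast
  let ?conj = "\<lambda>M. {g \<otimes> m \<otimes> inv g |g m. g \<in> H A \<and> m \<in> M}"
  have "subgroup M G \<Longrightarrow> M \<subseteq> H A \<Longrightarrow> (\<And>p. p \<in> A \<Longrightarrow> H {p} \<subseteq> generate G (H {p} \<inter> ?conj M)) \<Longrightarrow> M = H A" for M
  proof (induction "card (H A) - card M" arbitrary: M rule: less_induct)
    case inner: less
    note M = inner.prems(1,2) and gen = inner.prems(3)
    show "M = H A"
    proof (rule ccontr)
      assume ne: "M \<noteq> H A"
      have Mc: "x \<in> carrier G" if "x \<in> M" for x using that M Uc by blast
      have "A \<noteq> {}"
      proof
        assume "A = {}"
        then show False using ne H_empty M subgroup.one_closed[OF M(1)] by auto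
      qed
      then consider p where "A = {p}" | "card A \<ge> 2"
        using finA by (metis One_nat_def Suc_1 Suc_leI card_1_singletonE card_gt_0_iff le_neq_implies_less)
      then show False
      proof cases
        case 1
        obtain n where n: "card (H {p}) = p ^ n" using H_prime 1 A by auto
        have p: "prime p" using primes 1 A by auto
        have "U.hypercentral"
          by (rule U.prime_power_order_hypercentral[OF p, of n]) (use n 1 in simp)
        moreover have "subgroup M (G\<lparr>carrier := H A\<rparr>)" by (rule subgroup_incl[OF M(1) Us M(2)])
        ultimately obtain N where N: "N \<lhd> G\<lparr>carrier := H A\<rparr>" "M \<subseteq> N" "N \<noteq> H A"
          using U.hypercentral_proper_subgroup_in_normal finU ne by auto
        have Nn: "normalized_in (H A) N" using N normalized_in_iff[OF Us] by simp
        then have Ns: "subgroup N G" by (simp add: normalized_in_def)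
        have "generate G (H {p} \<inter> ?conj M) \<subseteq> N"
          by (rule generate_subgroup_incl[OF _ Ns]) (use Nn N(2) in \<open>auto simp: normalized_in_def\<close>)
        then have "H A \<subseteq> N" using gen[of p] 1 by auto
        then show False using N(3) Nn by (auto simp: normalized_in_def)
      next
        case 2
        define \<K> where "\<K> = {K. normalized_in (H A) K \<and> K \<subseteq> M}"
        have "normalized_in (H A) {\<one>}"
          using triv_subgroup subgroup.one_closed[OF Us] Uc by (auto simp: normalized_in_def)
        then have "{\<one>} \<in> \<K>" using subgroup.one_closed[OF M(1)] by (simp add: \<K>_def)
        moreover have "finite \<K>"
          by (rule finite_subset[of _ "Pow (H A)"]) (use finU M in \<open>auto simp: \<K>_def\<close>)
        ultimately obtain K where K: "K \<in> \<K>" and max: "\<And>N. N \<in> \<K> \<Longrightarrow> K \<subseteq> N \<Longrightarrow> N = K"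
          using finite_has_maximal[of \<K>] by (metis empty_iff)
        have Kn: "normalized_in (H A) K" "K \<subseteq> M" using K by (auto simp: \<K>_def)
        have "K \<noteq> H A" using Kn M ne by blast
        then obtain r L where r: "r \<in> A" and L: "normalized_in (H A) L" "K \<subset> L" "L \<subseteq> K <#> H (A - {r})"
          using normal_extension_in_smaller_family[OF A 2 Kn(1)] by blast
        have Ls: "subgroup L G" "L \<subseteq> H A" and Ln: "\<And>u k. u \<in> H A \<Longrightarrow> k \<in> L \<Longrightarrow> u \<otimes> k \<otimes> inv u \<in> L"
          using L(1) by (auto simp: normalized_in_def)
        have "\<not> L \<subseteq> M" using max[of L] L by (auto simp: \<K>_def)
        let ?MN = "M <#> L"
        have prod_sub: "subgroup ?MN G" by (rule set_mult_subgroup[OF M(1) Ls(1)]) (use Ln M in blast)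
        have prod_U: "?MN \<subseteq> H A" using M Ls subgroup.m_closed[OF Us] by (auto simp: set_mult_def)
        have le_prod: "M \<subseteq> ?MN" "L \<subseteq> ?MN" using set_mult_supsets[OF M(1) Ls(1)] by auto
        then have "M \<subset> ?MN" using \<open>\<not> L \<subseteq> M\<close> by blast
        moreover have "finite ?MN" using prod_U finU finite_subset by blast
        ultimately have "card M < card ?MN" by (intro psubset_card_mono)
        moreover have "card ?MN \<le> card (H A)" using prod_U finU by (intro card_mono)
        ultimately have less: "card (H A) - card ?MN < card (H A) - card M" by simp
        have prod_eq: "?MN = H A"
        proof (rule inner.hyps[OF less prod_sub prod_U])
          fix p assume p: "p \<in> A"
          have "?conj M \<subseteq> ?conj ?MN" using le_prod by blast
          then show "H {p} \<subseteq> generate G (H {p} \<inter> ?conj ?MN)"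
            using gen[OF p] mono_generate[of "H {p} \<inter> ?conj M" "H {p} \<inter> ?conj ?MN"] by blast
        qed
        define B where "B = A - {r}"
        have B: "B \<subseteq> Ps" "B \<subseteq> A" using A by (auto simp: B_def)
        have Bs: "subgroup (H B) G" by (rule H_subgroup[OF B(1)])
        have BA: "H B \<subseteq> H A" by (rule H_mono[OF B(2) A])
        have Bc: "x \<in> carrier G" if "x \<in> H B" for x using that BA Uc by blast
        have split: "\<exists>m\<in>M. \<exists>b\<in>H B. g = m \<otimes> b" if g: "g \<in> H A" for g
        proof -
          have "g \<in> M <#> L" using g by (simp only: prod_eq)
          then obtain m l where ml: "m \<in> M" "l \<in> L" "g = m \<otimes> l" by (auto simp: set_mult_def)
          have "l \<in> K <#> H B" using ml(2) L(3) by (auto simp: B_def)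
          then obtain k b where kb: "k \<in> K" "b \<in> H B" "l = k \<otimes> b" by (auto simp: set_mult_def)
          have kM: "k \<in> M" using kb Kn by blast
          have "g = (m \<otimes> k) \<otimes> b" unfolding ml(3) kb(3) using ml(1) kM kb(2) Mc Bc by (simp add: m_assoc)
          then show ?thesis using subgroup.m_closed[OF M(1) ml(1) kM] kb(2) by blast
        qed
        define M' where "M' = M \<inter> H B"
        have M's: "subgroup M' G" unfolding M'_def by (rule subgroups_Inter_pair[OF M(1) Bs])
        have "M' = H B"
        proof (rule less.hyps[OF _ B(1) M's])
          show "card B < card A" unfolding B_def by (rule card_Diff1_less[OF finA r])
          show "M' \<subseteq> H B" by (simp add: M'_def)
          fix p assume p: "p \<in> B"
          have pB: "H {p} \<subseteq> H B" by (rule H_mono) (use p B in auto)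
          have "H {p} \<inter> ?conj M \<subseteq> H {p} \<inter> {g \<otimes> m \<otimes> inv g |g m. g \<in> H B \<and> m \<in> M'}"
          proof
            fix x assume x: "x \<in> H {p} \<inter> ?conj M"
            then obtain g m where gm: "g \<in> H A" "m \<in> M" "x = g \<otimes> m \<otimes> inv g" by blast
            obtain m1 b where mb: "m1 \<in> M" "b \<in> H B" "inv g = m1 \<otimes> b"
              using split[OF subgroup.m_inv_closed[OF Us gm(1)]] by blast
            have c: "g \<in> carrier G" "m \<in> carrier G" "m1 \<in> carrier G" "b \<in> carrier G"
              using gm mb Uc Mc Bc by auto
            have "g = inv (inv g)" using c by simp
            also have "\<dots> = inv b \<otimes> inv m1" unfolding mb(3) using c by (simp add: inv_mult_group)
            finally have g: "g = inv b \<otimes> inv m1" .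
            define y where "y = inv m1 \<otimes> m \<otimes> m1"
            have yM: "y \<in> M" unfolding y_def
              using mb(1) gm(2) subgroup.m_closed[OF M(1)] subgroup.m_inv_closed[OF M(1)] by blast
            have xy: "x = inv b \<otimes> y \<otimes> inv (inv b)"
              unfolding gm(3) y_def g using c by (simp add: inv_mult_group m_assoc)
            have "y = b \<otimes> x \<otimes> inv b" unfolding xy using c yM Mc by (simp add: m_assoc)
            moreover have "x \<in> H B" using x pB by blast
            ultimately have "y \<in> H B"
              using subgroup_conj_closed[OF Bs mb(2)] by simp
            then have "y \<in> M'" using yM by (simp add: M'_def)
            then show "x \<in> H {p} \<inter> {g \<otimes> m \<otimes> inv g |g m. g \<in> H B \<and> m \<in> M'}"
              using x xy subgroup.m_inv_closed[OF Bs mb(2)] by blast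
          qed
          then show "H {p} \<subseteq> generate G (H {p} \<inter> {g \<otimes> m \<otimes> inv g |g m. g \<in> H B \<and> m \<in> M'})"
            using gen[of p] p B mono_generate by blast
        qed
        then have "H B \<subseteq> M" by (auto simp: M'_def)
        have "H A \<subseteq> M"
        proof
          fix g assume "g \<in> H A"
          then obtain m b where "m \<in> M" "b \<in> H B" "g = m \<otimes> b" using split by blast
          then show "g \<in> M" using \<open>H B \<subseteq> M\<close> subgroup.m_closed[OF M(1)] by blast
        qed
        then show False using ne M by blast
      qed
    qed
  qed
  then show ?case using less.prems by blast
qed

end

section \<open>Square-free solutions of the Yang--Baxter equation\<close>

locale square_free_solution =
  fixes X :: "'a set" and r :: "'a \<times> 'a \<Rightarrow> 'a \<times> 'a"
  assumes solution: "solution X r" and square_free: "square_free X r"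
begin

abbreviation l where "l \<equiv> lam r"
abbreviation rh where "rh \<equiv> rho r"
abbreviation s where "s \<equiv> sigma X r"

lemma finite_X: "finite X" and X_nonempty: "X \<noteq> {}"
  using solution by (auto simp: solution_def)

lemma r_eq: "r (x, y) = (l x y, rh y x)"
  by (simp add: lam_def rho_def)

lemma l_bij: "x \<in> X \<Longrightarrow> bij_betw (l x) X X" and rh_bij: "x \<in> X \<Longrightarrow> bij_betw (rh x) X X"
  using solution by (auto simp: solution_def)

lemma l_closed [simp]: "x \<in> X \<Longrightarrow> y \<in> X \<Longrightarrow> l x y \<in> X"
  using l_bij by (auto simp: bij_betw_def)

lemma rh_closed [simp]: "x \<in> X \<Longrightarrow> y \<in> X \<Longrightarrow> rh x y \<in> X"
  using rh_bij by (auto simp: bij_betw_def)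

lemma l_inject: "x \<in> X \<Longrightarrow> y \<in> X \<Longrightarrow> z \<in> X \<Longrightarrow> l x y = l x z \<longleftrightarrow> y = z"
  using l_bij[of x] by (auto simp: bij_betw_def inj_on_def)

lemma l_surj:
  assumes "x \<in> X" "y \<in> X" obtains u where "u \<in> X" "y = l x u"
  using l_bij[OF assms(1)] assms(2) by (auto simp: bij_betw_def)

lemma braid:
  assumes "x \<in> X" "y \<in> X" "z \<in> X"
  shows braid_1: "l (l x y) (l (rh y x) z) = l x (l y z)"
    and braid_2: "rh (l (rh y x) z) (l x y) = l (rh (l y z) x) (rh z y)"
    and braid_3: "rh z (rh y x) = rh (rh z y) (rh (l y z) x)"
proof -
  have "(x, y, z) \<in> X \<times> X \<times> X" using assms by simp
  then have "(r_id r \<circ> id_r r \<circ> r_id r) (x, y, z) = (id_r r \<circ> r_id r \<circ> id_r r) (x, y, z)"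
    using solution unfolding solution_def by blast
  then show "l (l x y) (l (rh y x) z) = l x (l y z)"
    and "rh (l (rh y x) z) (l x y) = l (rh (l y z) x) (rh z y)"
    and "rh z (rh y x) = rh (rh z y) (rh (l y z) x)"
    by (auto simp: r_id_def id_r_def r_eq)
qed

lemma s_l:
  assumes "x \<in> X" "u \<in> X"
  shows "s (l x u) x = l (l x u) (rh u x)"
proof -
  have "inv_into X (l x) (l x u) = u"
    using inv_into_f_f[of "l x" X u] l_bij[OF assms(1)] assms(2) by (simp add: bij_betw_def)
  then show ?thesis by (simp add: sigma_def)
qed

lemma s_closed [simp]:
  assumes "y \<in> X" "x \<in> X" shows "s y x \<in> X"
proof -
  obtain u where "u \<in> X" "y = l x u" using l_surj[OF assms(2,1)] by blast
  then show ?thesis using assms s_l[of x u] by simp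
qed

text \<open>The maps \<open>\<lambda>\<^sub>w\<close> are automorphisms of the derived rack.\<close>
lemma s_equivariant:
  assumes "w \<in> X" "x \<in> X" "y \<in> X"
  shows "s (l w y) (l w x) = l w (s y x)"
proof -
  obtain u where u: "u \<in> X" "y = l x u" using l_surj[OF assms(2,3)] by blast
  let ?a = "l w x" and ?w' = "rh x w"
  have b: "l w y = l ?a (l ?w' u)" using braid_1[of w x u] assms u by simp
  have "s (l w y) ?a = l (l w y) (rh (l ?w' u) ?a)"
    unfolding b by (rule s_l) (use assms u in simp_all)
  also have "rh (l ?w' u) ?a = l (rh y w) (rh u x)" using braid_2[of w x u] assms u by simp
  also have "l (l w y) (l (rh y w) (rh u x)) = l w (l y (rh u x))"
    by (rule braid_1) (use assms u in simp_all)
  also have "l y (rh u x) = s y x" using s_l[OF assms(2) u(1)] u by simp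
  finally show ?thesis .
qed

text \<open>With \<open>y = \<lambda>\<^sub>x u\<close> and \<open>z = \<lambda>\<^sub>x \<lambda>\<^sub>u v\<close>, both sides are expressed through the common value of the two
sides of the braid relation at \<open>(x, u, v)\<close>.\<close>
lemma s_rack:
  assumes "x \<in> X" "y \<in> X" "z \<in> X"
  shows "s z (s y x) = s (s z y) (s z x)"
proof -
  obtain u where u: "u \<in> X" "y = l x u" using l_surj[OF assms(1,2)] by blast
  obtain z' where z': "z' \<in> X" "z = l x z'" using l_surj[OF assms(1,3)] by blast
  obtain v where v: "v \<in> X" "z' = l u v" using l_surj[OF u(1) z'(1)] by blast
  define b where "b = rh u x"
  define q where "q = rh (l u v) x"
  define t where "t = rh v u"
  have cl [simp]: "b \<in> X" "q \<in> X" "t \<in> X" using assms u v by (simp_all add: b_def q_def t_def)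
  note [simp] = assms u(1) v(1)
  have z1: "z = l y (l b v)" using braid_1[of x u v] u z' v by (simp add: b_def)
  have z2: "z = l x (l u v)" using z' v by simp
  have p: "rh (l b v) y = l q t" using braid_2[of x u v] u by (simp add: b_def q_def t_def)
  have 3: "rh v b = rh t q" using braid_3[of x u v] by (simp add: b_def q_def t_def)
  have "s z (s y x) = s z (l y b)" using s_l[of x u] u by (simp add: b_def)
  also have "\<dots> = l y (s (l b v) b)" unfolding z1 by (rule s_equivariant) simp_all
  also have "\<dots> = l y (l (l b v) (rh v b))" using s_l[of b v] by simp
  also have "\<dots> = l z (l (l q t) (rh t q))"
    using braid_1[of y "l b v" "rh v b"] by (simp add: z1[symmetric] p 3)
  finally have lhs: "s z (s y x) = l z (l (l q t) (rh t q))" .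
  have szx: "s z x = l z q" unfolding z2 using s_l[of x "l u v"] by (simp add: q_def)
  have "s z y = l x (s (l u v) u)" unfolding z2 u(2) by (rule s_equivariant) simp_all
  also have "\<dots> = l x (l (l u v) t)" using s_l[of u v] by (simp add: t_def)
  also have "\<dots> = l z (l q t)" using braid_1[of x "l u v" t] by (simp add: z2 q_def)
  finally have "s (s z y) (s z x) = s (l z (l q t)) (l z q)" using szx by simp
  also have "\<dots> = l z (s (l q t) q)" by (rule s_equivariant) simp_all
  also have "\<dots> = l z (l (l q t) (rh t q))" using s_l[of q t] by simp
  finally show ?thesis using lhs by simp
qed

text \<open>For \<open>y = \<lambda>\<^sub>x u\<close>, the points \<open>y\<close> and \<open>\<sigma>\<^sub>y x = \<lambda>\<^sub>y \<rho>\<^sub>u x\<close> determine \<open>r (x, u)\<close>, hence \<open>x\<close>.\<close>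
lemma s_bij:
  assumes y: "y \<in> X" shows "bij_betw (s y) X X"
proof -
  have "inj_on (s y) X"
  proof (rule inj_onI)
    fix x x' assume x: "x \<in> X" "x' \<in> X" and eq: "s y x = s y x'"
    obtain u where u: "u \<in> X" "y = l x u" using l_surj[OF x(1) y] by blast
    obtain u' where u': "u' \<in> X" "y = l x' u'" using l_surj[OF x(2) y] by blast
    have "l y (rh u x) = l y (rh u' x')" using eq s_l[OF x(1) u(1)] s_l[OF x(2) u'(1)] u(2) u'(2) by simp
    then have "rh u x = rh u' x'" using l_inject y x u u' by simp
    then have "r (x, u) = r (x', u')" using u u' by (simp add: r_eq)
    moreover have "inj_on r (X \<times> X)" using solution by (simp add: solution_def bij_betw_def)
    ultimately show "x = x'" using x u u' by (auto dest!: inj_onD)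
  qed
  moreover have "s y ` X \<subseteq> X" using y by auto
  ultimately show ?thesis using finite_X by (simp add: bij_betw_def endo_inj_surj)
qed

lemma l_self [simp]: "x \<in> X \<Longrightarrow> l x x = x" and rh_self [simp]: "x \<in> X \<Longrightarrow> rh x x = x"
  using square_free by (auto simp: square_free_def lam_def rho_def)

lemma s_self [simp]: "x \<in> X \<Longrightarrow> s x x = x"
  using s_l[of x x] by simp

text \<open>This identity makes the permutations \<open>\<tau>\<^sub>x\<close> below satisfy the relations of the derived monoid. With
\<open>c = \<lambda>\<^sub>b a\<close>, the braid relation gives \<open>\<lambda>\<^sub>c \<lambda>\<^sub>b = \<lambda>\<^sub>d \<lambda>\<^sub>e\<close> for \<open>d = \<lambda>\<^sub>c b\<close> and \<open>e = \<rho>\<^sub>b c\<close>. Evaluated at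
suitable points, it identifies \<open>e\<close> and \<open>d\<close> as \<open>\<sigma>\<^sub>b a\<close> and \<open>\<lambda>\<^sub>e b\<close>, because \<open>\<lambda>\<^sub>e e = e\<close> and \<open>\<lambda>\<^sub>d d = d\<close> in a
square-free solution.\<close>
lemma l_exchange:
  assumes "a \<in> X" "b \<in> X" "z \<in> X"
  shows "l (l b a) (l b z) = l (l (s b a) b) (l (s b a) z)"
proof -
  note [simp] = assms
  define c where "c = l b a"
  define d where "d = l c b"
  define e where "e = rh b c"
  have cl [simp]: "c \<in> X" "d \<in> X" "e \<in> X" by (simp_all add: c_def d_def e_def)
  have fac: "l c (l b w) = l d (l e w)" if "w \<in> X" for w
    using braid_1[of c b w] that by (simp add: d_def e_def)
  have c: "c = l c (l b a)" by (simp flip: c_def)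
  have d: "d = l c (l b b)" by (simp add: d_def)
  have "l d e = s d c" using s_l[of c b] by (simp add: d_def e_def)
  also have "s d c = s (l c (l b b)) (l c (l b a))" using c d by simp
  also have "\<dots> = l c (l b (s b a))" using s_equivariant by (simp del: l_self)
  also have "\<dots> = l d (l e (s b a))" by (rule fac) simp
  finally have "l e e = l e (s b a)" using l_inject[of d e "l e (s b a)"] by simp
  then have e: "e = s b a" using l_inject[of e e "s b a"] by simp
  have "l d d = l d (l e b)" using fac[of b] d by simp
  then have "d = l e b" using l_inject[of d d "l e b"] by simp
  then show ?thesis using fac[of z] e by (simp flip: c_def)
qed

text \<open>For \<open>r (x, y) = (a, b)\<close> one has \<open>\<lambda>\<^sub>a b = \<sigma>\<^sub>a x\<close>, so invariance under the \<open>\<lambda>\<close> and the \<open>\<sigma>\<close> controls the second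
component as well. On a finite set the complement inherits the invariance.\<close>
lemma decomposable_of_invariant:
  assumes Y: "Y \<subseteq> X" "Y \<noteq> {}" "Y \<noteq> X"
    and inv_l: "\<And>x y. x \<in> X \<Longrightarrow> y \<in> Y \<Longrightarrow> l x y \<in> Y"
    and inv_s: "\<And>x y. x \<in> X \<Longrightarrow> y \<in> Y \<Longrightarrow> s x y \<in> Y"
  shows "decomposable X r"
proof -
  have compl: "f z \<in> X - Y" if f: "bij_betw f X X" "\<And>y. y \<in> Y \<Longrightarrow> f y \<in> Y" and z: "z \<in> X - Y" for f z
  proof -
    have "inj_on f Y" using f(1) Y(1) inj_on_subset by (auto simp: bij_betw_def)
    then have "f ` Y = Y" using f(2) finite_subset[OF Y(1) finite_X] by (intro endo_inj_surj) auto
    moreover have "f z \<notin> f ` Y" using f(1) Y(1) z by (auto simp: bij_betw_def inj_on_def)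
    moreover have "f z \<in> X" using f(1) z by (auto simp: bij_betw_def)
    ultimately show ?thesis by simp
  qed
  have closed: "r ` (W \<times> W) \<subseteq> W \<times> W"
    if W: "W \<subseteq> X" and Wl: "\<And>x y. x \<in> X \<Longrightarrow> y \<in> W \<Longrightarrow> l x y \<in> W"
      and Ws: "\<And>x y. x \<in> X \<Longrightarrow> y \<in> W \<Longrightarrow> s x y \<in> W"
      and Wc: "\<And>x y. x \<in> X \<Longrightarrow> y \<in> X - W \<Longrightarrow> l x y \<in> X - W" for W
  proof clarify
    fix x y a b assume xy: "x \<in> W" "y \<in> W" and "(a, b) = r (x, y)"
    then have ab: "a = l x y" "b = rh y x" by (simp_all add: r_eq)
    have xyX: "x \<in> X" "y \<in> X" using xy W by auto
    have "s a x = l a b" using s_l[OF xyX] ab by simp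
    then have "l a b \<in> W" using Ws[of a x] xy xyX ab by simp
    then have "b \<in> W" using Wc[of a b] xyX ab by auto
    then show "a \<in> W \<and> b \<in> W" using Wl xyX xy ab by simp
  qed
  let ?Z = "X - Y"
  have "r ` (Y \<times> Y) \<subseteq> Y \<times> Y"
    by (rule closed) (use Y inv_l inv_s compl[OF l_bij] in auto)
  moreover have "r ` (?Z \<times> ?Z) \<subseteq> ?Z \<times> ?Z"
  proof (rule closed)
    show "l x y \<in> X - (X - Y)" if "x \<in> X" "y \<in> X - (X - Y)" for x y
      using inv_l[of x y] that by auto
  qed (use compl[OF l_bij] compl[OF s_bij] inv_l inv_s in auto)
  ultimately show ?thesis unfolding decomposable_def using Y by (intro exI[of _ Y] exI[of _ ?Z]) auto
qed

end

section \<open>Finite group images of Malcev nilpotent monoids\<close>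

context group
begin

text \<open>In a finite group the inverses of generators are powers, so no step for inverses is needed.\<close>
lemma finite_generate_induct:
  assumes fin: "finite (carrier G)" and E: "E \<subseteq> carrier G"
    and one: "P \<one>" and step: "\<And>e g. e \<in> E \<Longrightarrow> g \<in> generate G E \<Longrightarrow> P g \<Longrightarrow> P (e \<otimes> g)"
    and g: "g \<in> generate G E"
  shows "P g"
proof -
  have c: "x \<in> carrier G" if "x \<in> generate G E" for x using generate_in_carrier[OF E that] .
  have sub: "subgroup (generate G E) G" by (rule generate_is_subgroup[OF E])
  have pow: "h \<in> generate G E \<Longrightarrow> P h \<Longrightarrow> P (e [^] k \<otimes> h)" if e: "e \<in> E" for e h and k :: nat
  proof (induction k)
    case (Suc k)
    have ec: "e \<in> carrier G" "e \<in> generate G E" using e E by (auto intro: generate.incl)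
    have "e [^] Suc k \<otimes> h = e \<otimes> (e [^] k \<otimes> h)"
      using nat_pow_Suc2[OF ec(1)] ec c[OF Suc.prems(1)] by (simp add: m_assoc)
    moreover have "e [^] k \<otimes> h \<in> generate G E"
      using subgroup_nat_pow_closed[OF sub ec(2)] subgroup.m_closed[OF sub] Suc.prems(1) by blast
    ultimately show ?case using step[OF e] Suc by simp
  qed (use c in simp)
  have "\<forall>h\<in>generate G E. P h \<longrightarrow> P (g \<otimes> h)"
    using g
  proof (induction rule: generate.induct)
    case (inv e)
    have ec: "e \<in> carrier G" using inv E by auto
    obtain k where k: "ord e = Suc k" using ord_ge_1[OF fin ec] by (cases "ord e") auto
    have "e [^] Suc k = \<one>" unfolding k[symmetric] by (rule pow_ord_eq_1[OF ec])
    then have "inv e = e [^] k" using ec by (intro inv_equality) auto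
    then show ?case using pow[OF inv] by simp
  next
    case (eng g1 g2)
    have g: "g1 \<in> carrier G" "g2 \<in> carrier G" using eng c by auto
    show ?case
    proof (intro ballI impI)
      fix h assume h: "h \<in> generate G E" "P h"
      have "g2 \<otimes> h \<in> generate G E" using eng h by (intro generate.eng)
      then have "P (g1 \<otimes> (g2 \<otimes> h))" using eng.IH h by blast
      then show "P (g1 \<otimes> g2 \<otimes> h)" using g c[OF h(1)] by (simp add: m_assoc)
    qed
  qed (use c step in auto)
  then have "P (g \<otimes> \<one>)" using one by (auto intro: generate.one)
  then show ?thesis using c[OF g] by simp
qed

text \<open>The exchange rule moves a generator from \<open>F\<close> to the right of any element of \<open>generate G E\<close>, at the cost
of changing both, and so sorts every word in the generators.\<close>
lemma generate_Un_exchange: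
  assumes fin: "finite (carrier G)" and E: "E \<subseteq> carrier G" "F \<subseteq> carrier G"
    and exchange: "\<And>e f. e \<in> E \<Longrightarrow> f \<in> F \<Longrightarrow> \<exists>e'\<in>E. \<exists>f'\<in>F. f \<otimes> e = e' \<otimes> f'"
  shows "generate G (E \<union> F) = generate G E <#> generate G F"
proof
  have EF: "E \<union> F \<subseteq> carrier G" using E by simp
  have cE: "x \<in> carrier G" if "x \<in> generate G E" for x using generate_in_carrier[OF E(1) that] .
  have cF: "x \<in> carrier G" if "x \<in> generate G F" for x using generate_in_carrier[OF E(2) that] .
  have swap: "\<forall>f\<in>F. \<exists>e'\<in>generate G E. \<exists>f'\<in>F. f \<otimes> e = e' \<otimes> f'" if "e \<in> generate G E" for e
  proof (rule finite_generate_induct[OF fin E(1) _ _ that])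
    show "\<forall>f\<in>F. \<exists>e'\<in>generate G E. \<exists>f'\<in>F. f \<otimes> \<one> = e' \<otimes> f'"
    proof
      fix f assume f: "f \<in> F"
      then have "f \<otimes> \<one> = \<one> \<otimes> f" using E by auto
      then show "\<exists>e'\<in>generate G E. \<exists>f'\<in>F. f \<otimes> \<one> = e' \<otimes> f'" using f generate.one by blast
    qed
    fix e g assume e: "e \<in> E" and g: "g \<in> generate G E" and IH: "\<forall>f\<in>F. \<exists>e'\<in>generate G E. \<exists>f'\<in>F. f \<otimes> g = e' \<otimes> f'"
    show "\<forall>f\<in>F. \<exists>e'\<in>generate G E. \<exists>f'\<in>F. f \<otimes> (e \<otimes> g) = e' \<otimes> f'"
    proof
      fix f assume f: "f \<in> F"
      obtain e1 f1 where 1: "e1 \<in> E" "f1 \<in> F" "f \<otimes> e = e1 \<otimes> f1" using exchange[OF e f] by blast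
      obtain e2 f2 where 2: "e2 \<in> generate G E" "f2 \<in> F" "f1 \<otimes> g = e2 \<otimes> f2" using IH 1 by blast
      have c: "e \<in> carrier G" "f \<in> carrier G" "g \<in> carrier G" "e1 \<in> carrier G" "f1 \<in> carrier G"
        "e2 \<in> carrier G" "f2 \<in> carrier G" using e f g 1(1,2) 2(1,2) E cE by auto
      have "f \<otimes> (e \<otimes> g) = (f \<otimes> e) \<otimes> g" using c by (simp add: m_assoc)
      also have "\<dots> = e1 \<otimes> (f1 \<otimes> g)" unfolding 1(3) using c by (simp add: m_assoc)
      also have "\<dots> = (e1 \<otimes> e2) \<otimes> f2" unfolding 2(3) using c by (simp add: m_assoc)
      finally have "f \<otimes> (e \<otimes> g) = (e1 \<otimes> e2) \<otimes> f2" .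
      moreover have "e1 \<otimes> e2 \<in> generate G E" by (rule generate.eng[OF generate.incl[OF 1(1)] 2(1)])
      ultimately show "\<exists>e'\<in>generate G E. \<exists>f'\<in>F. f \<otimes> (e \<otimes> g) = e' \<otimes> f'" using 2(2) by blast
    qed
  qed
  show "generate G (E \<union> F) \<subseteq> generate G E <#> generate G F"
  proof
    fix g assume "g \<in> generate G (E \<union> F)"
    then show "g \<in> generate G E <#> generate G F"
    proof (rule finite_generate_induct[OF fin EF, rotated 2])
      have "\<one> = \<one> \<otimes> \<one>" by simp
      then show "\<one> \<in> generate G E <#> generate G F" unfolding set_mult_def using generate.one by blast
      fix e g assume e: "e \<in> E \<union> F" and "g \<in> generate G E <#> generate G F"
      then obtain a b where ab: "a \<in> generate G E" "b \<in> generate G F" "g = a \<otimes> b" by (auto simp: set_mult_def)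
      note c = cE[OF ab(1)] cF[OF ab(2)]
      show "e \<otimes> g \<in> generate G E <#> generate G F"
      proof (cases "e \<in> E")
        case True
        then have "e \<otimes> g = (e \<otimes> a) \<otimes> b" unfolding ab(3) using c E by (simp add: m_assoc subset_iff)
        moreover have "e \<otimes> a \<in> generate G E" by (rule generate.eng[OF generate.incl[OF True] ab(1)])
        ultimately show ?thesis unfolding set_mult_def using ab(2) by blast
      next
        case False
        then have eF: "e \<in> F" using e by simp
        obtain a' f where f: "a' \<in> generate G E" "f \<in> F" "e \<otimes> a = a' \<otimes> f" using swap[OF ab(1)] eF by blast
        have c': "e \<in> carrier G" "a' \<in> carrier G" "f \<in> carrier G" using eF f(1,2) E cE by auto
        have "e \<otimes> g = (e \<otimes> a) \<otimes> b" unfolding ab(3) using c c' by (simp add: m_assoc)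
        also have "\<dots> = a' \<otimes> (f \<otimes> b)" unfolding f(3) using c c' by (simp add: m_assoc)
        finally have "e \<otimes> g = a' \<otimes> (f \<otimes> b)" .
        moreover have "f \<otimes> b \<in> generate G F" by (rule generate.eng[OF generate.incl[OF f(2)] ab(2)])
        ultimately show ?thesis unfolding set_mult_def using f(1) by blast
      qed
    qed
  qed
  show "generate G E <#> generate G F \<subseteq> generate G (E \<union> F)"
  proof
    fix g assume "g \<in> generate G E <#> generate G F"
    then obtain a b where ab: "a \<in> generate G E" "b \<in> generate G F" "g = a \<otimes> b" by (auto simp: set_mult_def)
    have "a \<in> generate G (E \<union> F)" "b \<in> generate G (E \<union> F)"
      using ab mono_generate[of E "E \<union> F"] mono_generate[of F "E \<union> F"] by auto
    then show "g \<in> generate G (E \<union> F)" unfolding ab(3) by (rule generate.eng)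
  qed
qed

end

fun word_product :: "('g, 'b) monoid_scheme \<Rightarrow> ('a \<Rightarrow> 'g) \<Rightarrow> 'a list \<Rightarrow> 'g" where
  "word_product G t [] = \<one>\<^bsub>G\<^esub>"
| "word_product G t (x # w) = t x \<otimes>\<^bsub>G\<^esub> word_product G t w"

lemma (in group) word_product_closed:
  "t ` X \<subseteq> carrier G \<Longrightarrow> w \<in> lists X \<Longrightarrow> word_product G t w \<in> carrier G"
  by (induction w) auto

lemma (in group) word_product_append:
  "t ` X \<subseteq> carrier G \<Longrightarrow> u \<in> lists X \<Longrightarrow> v \<in> lists X \<Longrightarrow>
   word_product G t (u @ v) = word_product G t u \<otimes> word_product G t v"
  by (induction u) (auto simp: m_assoc word_product_closed image_subset_iff)

lemma (in group) word_product_cong: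
  assumes t: "t ` X \<subseteq> carrier G"
    and R: "\<And>a b. (a, b) \<in> R \<Longrightarrow> word_product G t a = word_product G t b"
    and uv: "(u, v) \<in> pres_cong X R"
  shows "word_product G t u = word_product G t v"
  using uv by induction (auto simp: word_product_append[OF t] R)

text \<open>Suppose that the center is trivial. If the values \<open>\<alpha> \<noteq> \<beta>\<close> of two words could not be kept apart by a step of
the Malcev recursion, then \<open>\<alpha> g \<beta> = \<beta> g \<alpha>\<close> for all \<open>g\<close>; in particular \<open>\<alpha>\<close> and \<open>\<beta>\<close> commute, and it follows that
\<open>\<beta>\<^sup>-\<^sup>1 \<alpha>\<close> is central, so \<open>\<alpha> = \<beta>\<close>. Hence a suitable sequence of words keeps them apart forever, and the
monoid is not nilpotent.\<close>
lemma (in group) malcev_nilpotent_center_nontrivial: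
  assumes t: "t ` X \<subseteq> carrier G"
    and R: "\<And>a b. (a, b) \<in> R \<Longrightarrow> word_product G t a = word_product G t b"
    and surj: "\<And>g. g \<in> carrier G \<Longrightarrow> \<exists>w\<in>lists X. word_product G t w = g"
    and nil: "malcev_nilpotent (presented_monoid X R)"
    and nontriv: "carrier G \<noteq> {\<one>}"
  shows "center \<noteq> {\<one>}"
proof
  assume triv: "center = {\<one>}"
  let ?\<psi> = "word_product G t"
  let ?A = "presented_monoid X R"
  let ?c = "\<lambda>u. pres_cong X R `` {u}"
  note closed = word_product_closed[OF t] and app = word_product_append[OF t]
  have car: "?c u \<in> carrier ?A" if "u \<in> lists X" for u
    using that by (auto simp: presented_monoid_def quotient_def)
  have step: "\<exists>w\<in>lists X. ?\<psi> (a @ w @ b) \<noteq> ?\<psi> (b @ w @ a)"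
    if ab: "a \<in> lists X" "b \<in> lists X" "?\<psi> a \<noteq> ?\<psi> b" for a b
  proof (rule ccontr)
    assume "\<not> ?thesis"
    then have eq: "?\<psi> (a @ w @ b) = ?\<psi> (b @ w @ a)" if "w \<in> lists X" for w using that by blast
    define \<alpha> where "\<alpha> = ?\<psi> a"
    define \<beta> where "\<beta> = ?\<psi> b"
    have c: "\<alpha> \<in> carrier G" "\<beta> \<in> carrier G" using ab closed by (auto simp: \<alpha>_def \<beta>_def)
    have eqg: "\<alpha> \<otimes> (g \<otimes> \<beta>) = \<beta> \<otimes> (g \<otimes> \<alpha>)" if gc: "g \<in> carrier G" for g
    proof -
      obtain w where w: "w \<in> lists X" "?\<psi> w = g" using surj[OF gc] by blast
      have "\<alpha> \<otimes> (g \<otimes> \<beta>) = ?\<psi> (a @ w @ b)" using w ab(1,2) by (simp add: app \<alpha>_def \<beta>_def)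
      also have "\<dots> = ?\<psi> (b @ w @ a)" by (rule eq[OF w(1)])
      also have "\<dots> = \<beta> \<otimes> (g \<otimes> \<alpha>)" using w ab(1,2) by (simp add: app \<alpha>_def \<beta>_def)
      finally show ?thesis .
    qed
    have com: "\<alpha> \<otimes> \<beta> = \<beta> \<otimes> \<alpha>" using eqg[OF one_closed] c by simp
    define u where "u = inv \<beta> \<otimes> \<alpha>"
    have u: "u \<in> carrier G" using c by (simp add: u_def)
    have u2: "u = \<alpha> \<otimes> inv \<beta>"
    proof -
      have "u = inv \<beta> \<otimes> (\<alpha> \<otimes> \<beta>) \<otimes> inv \<beta>" using c by (simp add: u_def m_assoc)
      also have "\<dots> = inv \<beta> \<otimes> (\<beta> \<otimes> \<alpha>) \<otimes> inv \<beta>" by (simp only: com)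
      also have "\<dots> = \<alpha> \<otimes> inv \<beta>" using c by (simp add: m_assoc)
      finally show ?thesis .
    qed
    have "g \<otimes> u = u \<otimes> g" if g: "g \<in> carrier G" for g
    proof -
      have "u \<otimes> g = inv \<beta> \<otimes> (\<alpha> \<otimes> (g \<otimes> \<beta>)) \<otimes> inv \<beta>" using c g by (simp add: u_def m_assoc)
      also have "\<dots> = inv \<beta> \<otimes> (\<beta> \<otimes> (g \<otimes> \<alpha>)) \<otimes> inv \<beta>" by (simp only: eqg[OF g])
      also have "\<dots> = g \<otimes> u" using c g by (simp add: u2 m_assoc)
      finally show ?thesis by simp
    qed
    then have "u \<in> center" using u by (simp add: center_def)
    then have "u = \<one>" using triv by simp
    then have "\<beta> \<otimes> (inv \<beta> \<otimes> \<alpha>) = \<beta>" using c by (simp add: u_def)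
    then have "\<alpha> = \<beta>" using c by simp
    then show False using ab by (simp add: \<alpha>_def \<beta>_def)
  qed
  \<comment> \<open>\<open>W\<close> chooses a separating word for a pair of words with different values, and \<open>p\<close> runs the recursion
    on words, starting from a word for some \<open>g \<noteq> 1\<close> and the empty word.\<close>
  define W where "W ab = (SOME w. w \<in> lists X \<and> ?\<psi> (fst ab @ w @ snd ab) \<noteq> ?\<psi> (snd ab @ w @ fst ab))" for ab
  obtain g where g: "g \<in> carrier G" "g \<noteq> \<one>" using nontriv one_closed by blast
  obtain a0 where a0: "a0 \<in> lists X" "?\<psi> a0 = g" using surj[OF g(1)] by blast
  define p where "p = rec_nat (a0, []) (\<lambda>_ ab. (fst ab @ W ab @ snd ab, snd ab @ W ab @ fst ab))"
  have p0: "p 0 = (a0, [])" by (simp add: p_def)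
  have pS: "p (Suc i) = (fst (p i) @ W (p i) @ snd (p i), snd (p i) @ W (p i) @ fst (p i))" for i
    by (simp add: p_def)
  have inv: "fst (p i) \<in> lists X \<and> snd (p i) \<in> lists X \<and> ?\<psi> (fst (p i)) \<noteq> ?\<psi> (snd (p i))" for i
  proof (induction i)
    case 0
    show ?case using a0 g by (simp add: p0)
  next
    case (Suc i)
    have "\<exists>w. w \<in> lists X \<and> ?\<psi> (fst (p i) @ w @ snd (p i)) \<noteq> ?\<psi> (snd (p i) @ w @ fst (p i))"
      using step[of "fst (p i)" "snd (p i)"] Suc by blast
    from someI_ex[OF this] show ?case using Suc by (simp add: pS W_def)
  qed
  have W: "W (p i) \<in> lists X" for i
  proof -
    have "\<exists>w. w \<in> lists X \<and> ?\<psi> (fst (p i) @ w @ snd (p i)) \<noteq> ?\<psi> (snd (p i) @ w @ fst (p i))"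
      using step[of "fst (p i)" "snd (p i)"] inv[of i] by blast
    from someI_ex[OF this] show ?thesis by (simp add: W_def)
  qed
  \<comment> \<open>The factor used in the step to \<open>i + 1\<close> is \<open>w (i + 1)\<close>, whence the shift.\<close>
  define w where "w i = ?c (W (p (i - 1)))" for i
  have seq: "malcev_seq ?A w (?c a0) (?c []) i = (?c (fst (p i)), ?c (snd (p i)))" for i
  proof (induction i)
    case 0
    show ?case by (simp add: p0)
  next
    case (Suc i)
    then show ?case using inv[of i] W[of i]
      by (simp add: pS w_def presented_monoid_mult)
  qed
  obtain n where n: "\<And>x y w. x \<in> carrier ?A \<Longrightarrow> y \<in> carrier ?A \<Longrightarrow> (\<forall>i\<in>{1..n}. w i \<in> carrier ?A) \<Longrightarrow>
      fst (malcev_seq ?A w x y n) = snd (malcev_seq ?A w x y n)"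
    using nil unfolding malcev_nilpotent_def by blast
  have "fst (malcev_seq ?A w (?c a0) (?c []) n) = snd (malcev_seq ?A w (?c a0) (?c []) n)"
    by (rule n) (use car a0 W in \<open>auto simp: w_def\<close>)
  then have "?c (fst (p n)) = ?c (snd (p n))" by (simp add: seq)
  then have "(fst (p n), snd (p n)) \<in> pres_cong X R"
    by (rule eq_equiv_class[OF _ equiv_pres_cong]) (use inv[of n] in blast)
  then have "?\<psi> (fst (p n)) = ?\<psi> (snd (p n))" by (rule word_product_cong[rotated 2]) (fact t R)+
  then show False using inv by blast
qed

text \<open>Every quotient of the group is also a homomorphic image of the monoid, so its center is not trivial
unless the quotient is.\<close>
lemma (in group) malcev_nilpotent_hypercentral:
  assumes fin: "finite (carrier G)" and t: "t ` X \<subseteq> carrier G" and gen: "carrier G = generate G (t ` X)"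
    and R: "\<And>a b. (a, b) \<in> R \<Longrightarrow> word_product G t a = word_product G t b"
    and RX: "\<And>a b. (a, b) \<in> R \<Longrightarrow> a \<in> lists X \<and> b \<in> lists X"
    and nil: "malcev_nilpotent (presented_monoid X R)"
  shows "hypercentral"
  unfolding hypercentral_def
proof (intro allI impI)
  fix K assume K: "K \<lhd> G" "K \<noteq> carrier G"
  note Q = quotient_facts[OF K(1)]
  interpret Q: group "G Mod K" by (rule Q(1))
  interpret h: group_hom G "G Mod K" "\<lambda>a. K #> a" by (rule Q(2))
  define t' where "t' x = K #> t x" for x
  have t': "t' ` X \<subseteq> carrier (G Mod K)" using t h.hom_closed by (auto simp: t'_def)
  have prod: "word_product (G Mod K) t' w = K #> word_product G t w" if "w \<in> lists X" for w
    using that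
  proof (induction w)
    case Nil
    then show ?case using h.hom_one by simp
  next
    case (Cons x w)
    then have c: "t x \<in> carrier G" "word_product G t w \<in> carrier G"
      using t word_product_closed[OF t] by auto
    show ?case using h.hom_mult[OF c] Cons by (simp add: t'_def)
  qed
  have surjG: "\<exists>w\<in>lists X. word_product G t w = g" if "g \<in> carrier G" for g
  proof (rule finite_generate_induct[OF fin t])
    show "g \<in> generate G (t ` X)" using that gen by simp
    show "\<exists>w\<in>lists X. word_product G t w = \<one>" by (rule bexI[of _ "[]"]) auto
    fix e g assume "e \<in> t ` X" "\<exists>w\<in>lists X. word_product G t w = g"
    then obtain x w where "x \<in> X" "e = t x" "w \<in> lists X" "word_product G t w = g" by blast
    then show "\<exists>w\<in>lists X. word_product G t w = e \<otimes> g" by (intro bexI[of _ "x # w"]) auto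
  qed
  have "Q.center \<noteq> {\<one>\<^bsub>G Mod K\<^esub>}"
  proof (rule Q.malcev_nilpotent_center_nontrivial[OF t' _ _ nil])
    show "word_product (G Mod K) t' a = word_product (G Mod K) t' b" if "(a, b) \<in> R" for a b
      using R[OF that] RX[OF that] prod by simp
    show "\<exists>w\<in>lists X. word_product (G Mod K) t' w = g" if gc: "g \<in> carrier (G Mod K)" for g
    proof -
      obtain a where a: "a \<in> carrier G" "g = K #> a" using gc by (auto simp: carrier_FactGroup)
      obtain w where "w \<in> lists X" "word_product G t w = a" using surjG[OF a(1)] by blast
      then show ?thesis using a prod by (intro bexI[of _ w]) auto
    qed
    show "carrier (G Mod K) \<noteq> {\<one>\<^bsub>G Mod K\<^esub>}" using Q(5)[OF K(2)] by simp
  qed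
  moreover have "\<one>\<^bsub>G Mod K\<^esub> \<in> Q.center" by (simp add: Q.center_def del: one_FactGroup mult_FactGroup)
  ultimately obtain z where "z \<in> Q.center" "z \<noteq> K" by auto
  then show "\<exists>L. L \<lhd> G \<and> K \<subset> L \<and> (\<forall>l\<in>L. \<forall>g\<in>carrier G. g \<otimes> l \<otimes> inv g \<otimes> inv l \<in> K)"
    by (rule central_quotient_lift[OF K(1)])
qed

lemma (in group) rack_image_hypercentral:
  assumes fin: "finite (carrier G)" and t: "t ` X \<subseteq> carrier G"
    and rel: "\<And>x y. x \<in> X \<Longrightarrow> y \<in> X \<Longrightarrow> sigma X r y x \<in> X \<and> t x \<otimes> t y = t y \<otimes> t (sigma X r y x)"
    and nil: "malcev_nilpotent (derived_monoid X r)"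
  shows "group.hypercentral (G\<lparr>carrier := generate G (t ` X)\<rparr>)"
proof -
  let ?N = "generate G (t ` X)"
  have N: "subgroup ?N G" by (rule generate_is_subgroup[OF t])
  interpret N: group "G\<lparr>carrier := ?N\<rparr>" by (rule subgroup.subgroup_is_group[OF N is_group])
  have tN: "t ` X \<subseteq> ?N" by (auto intro: generate.incl)
  show ?thesis
  proof (rule N.malcev_nilpotent_hypercentral[OF _ _ _ _ _ nil[unfolded derived_monoid_def]])
    show "finite (carrier (G\<lparr>carrier := ?N\<rparr>))"
      using fin subgroup.subset[OF N] finite_subset by auto
    show "t ` X \<subseteq> carrier (G\<lparr>carrier := ?N\<rparr>)" using tN by simp
    show "carrier (G\<lparr>carrier := ?N\<rparr>) = generate (G\<lparr>carrier := ?N\<rparr>) (t ` X)"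
      using generate_consistent[OF tN N] by simp
    fix a b assume "(a, b) \<in> {([x, y], [y, sigma X r y x]) |x y. x \<in> X \<and> y \<in> X}"
    then obtain x y where xy: "x \<in> X" "y \<in> X" "a = [x, y]" "b = [y, sigma X r y x]" by blast
    show "a \<in> lists X \<and> b \<in> lists X" using xy rel by auto
    note rl = rel[OF xy(1,2)]
    have c: "t x \<in> carrier G" "t y \<in> carrier G" "t (sigma X r y x) \<in> carrier G"
      using xy(1,2) conjunct1[OF rl] t by auto
    have "word_product (G\<lparr>carrier := ?N\<rparr>) t a = t x \<otimes> t y" unfolding xy(3) using c by simp
    also have "\<dots> = t y \<otimes> t (sigma X r y x)" by (rule conjunct2[OF rl])
    also have "\<dots> = word_product (G\<lparr>carrier := ?N\<rparr>) t b" unfolding xy(4) using c by simp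
    finally show "word_product (G\<lparr>carrier := ?N\<rparr>) t a = word_product (G\<lparr>carrier := ?N\<rparr>) t b" .
  qed
qed

section \<open>The permutation groups of a nilpotent square-free solution\<close>

lemma Bij_apply_closed: "f \<in> carrier (BijGroup S) \<Longrightarrow> x \<in> S \<Longrightarrow> f x \<in> S"
  by (auto simp: BijGroup_def Bij_def bij_betw_def)

lemma Bij_mult_apply:
  "f \<in> carrier (BijGroup S) \<Longrightarrow> g \<in> carrier (BijGroup S) \<Longrightarrow> x \<in> S \<Longrightarrow> (f \<otimes>\<^bsub>BijGroup S\<^esub> g) x = f (g x)"
  by (simp add: BijGroup_def compose_def)

lemma Bij_one_apply: "x \<in> S \<Longrightarrow> \<one>\<^bsub>BijGroup S\<^esub> x = x"
  by (simp add: BijGroup_def)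

lemma Bij_eqI:
  assumes "f \<in> carrier (BijGroup S)" "g \<in> carrier (BijGroup S)" "\<And>x. x \<in> S \<Longrightarrow> f x = g x"
  shows "f = g"
  using assms by (intro extensionalityI[of f S g]) (auto simp: BijGroup_def Bij_def)

lemma Bij_inv_apply:
  assumes "f \<in> carrier (BijGroup S)" "x \<in> S"
  shows "(inv\<^bsub>BijGroup S\<^esub> f) (f x) = x" "f ((inv\<^bsub>BijGroup S\<^esub> f) x) = x"
proof -
  interpret group "BijGroup S" by (rule group_BijGroup)
  show "(inv\<^bsub>BijGroup S\<^esub> f) (f x) = x"
    using Bij_mult_apply[of "inv\<^bsub>BijGroup S\<^esub> f" S f x] assms by (simp add: Bij_one_apply)
  show "f ((inv\<^bsub>BijGroup S\<^esub> f) x) = x"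
    using Bij_mult_apply[of f S "inv\<^bsub>BijGroup S\<^esub> f" x] assms by (simp add: Bij_one_apply)
qed

lemma restrict_in_BijGroup: "bij_betw f S S \<Longrightarrow> restrict f S \<in> carrier (BijGroup S)"
  by (simp add: BijGroup_def Bij_def)

lemma finite_BijGroup:
  assumes "finite S" shows "finite (carrier (BijGroup S))"
proof (rule finite_subset)
  show "carrier (BijGroup S) \<subseteq> S \<rightarrow>\<^sub>E S"
    by (auto simp: BijGroup_def Bij_def bij_betw_def PiE_def)
qed (use assms in \<open>simp add: finite_PiE\<close>)

lemma (in group) card_power_of_p_elements:
  assumes fin: "finite (carrier G)" and p: "prime (p::nat)"
    and el: "\<And>x. x \<in> carrier G \<Longrightarrow> \<exists>k. x [^] (p ^ k) = \<one>"
  shows "\<exists>n. card (carrier G) = p ^ n"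
proof -
  have pos: "card (carrier G) > 0" using fin one_closed by (auto simp: card_gt_0_iff)
  have "t = p" if t: "prime t" "t dvd card (carrier G)" for t
  proof (rule ccontr)
    assume ne: "t \<noteq> p"
    obtain m where m: "card (carrier G) = t * m" using t(2) by (elim dvdE)
    have "Coset.order G = t ^ 1 * m" using m by (simp add: Coset.order_def)
    then obtain P where P: "subgroup P G" "card P = t"
      using sylow_thm[OF t(1) is_group _ fin] by fastforce
    interpret P: group "G\<lparr>carrier := P\<rparr>" by (rule subgroup.subgroup_is_group[OF P(1) is_group])
    have "P \<noteq> {\<one>}" using P(2) prime_gt_1_nat[OF t(1)] by auto
    then obtain x where x: "x \<in> P" "x \<noteq> \<one>" using subgroup.one_closed[OF P(1)] by blast
    have xc: "x \<in> carrier G" using x subgroup.subset[OF P(1)] by blast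
    have "x [^]\<^bsub>G\<lparr>carrier := P\<rparr>\<^esub> t = \<one>"
      using P.pow_order_eq_1[of x] x P(2) by (simp add: Coset.order_def)
    then have "x [^] t = \<one>" by (simp add: nat_pow_consistent[symmetric])
    then have 1: "ord x dvd t" using pow_eq_id[OF xc] by blast
    obtain k where "x [^] (p ^ k) = \<one>" using el[OF xc] by blast
    then have 2: "ord x dvd p ^ k" using pow_eq_id[OF xc] by blast
    have "coprime t (p ^ k)" using primes_coprime[OF t(1) p ne] by simp
    then have "ord x = 1" using 1 2 by (metis coprime_common_divisor_nat nat_dvd_1_iff_1)
    then show False using x(2) ord_eq_1[OF xc] by simp
  qed
  then obtain i j where "card (carrier G) = p ^ i * p ^ j"
    using product_of_powers_of_two_prime_divisors[OF pos, of p p] by blast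
  then show ?thesis by (metis power_add)
qed

locale nilpotent_square_free_solution = square_free_solution X r
  for X :: "'a set" and r :: "'a \<times> 'a \<Rightarrow> 'a \<times> 'a" +
  assumes nilpotent: "malcev_nilpotent (derived_monoid X r)"
begin

abbreviation GX where "GX \<equiv> BijGroup X"

sublocale GX: group GX by (rule group_BijGroup)

lemma finite_GX: "finite (carrier GX)"
  by (rule finite_BijGroup[OF finite_X])

text \<open>The elements of \<open>BijGroup X\<close> are extensional functions, hence the restrictions.\<close>
definition lam_perm where "lam_perm x = restrict (l x) X"
definition sigma_perm where "sigma_perm x = restrict (s x) X"

lemma lam_perm_carrier [simp]: "x \<in> X \<Longrightarrow> lam_perm x \<in> carrier GX"
  unfolding lam_perm_def by (rule restrict_in_BijGroup[OF l_bij])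

lemma sigma_perm_carrier [simp]: "x \<in> X \<Longrightarrow> sigma_perm x \<in> carrier GX"
  unfolding sigma_perm_def by (rule restrict_in_BijGroup[OF s_bij])

lemma lam_perm_apply [simp]: "x \<in> X \<Longrightarrow> lam_perm y x = l y x" and sigma_perm_apply [simp]: "x \<in> X \<Longrightarrow> sigma_perm y x = s y x"
  by (simp_all add: lam_perm_def sigma_perm_def)

definition L where "L = generate GX (lam_perm ` X)"

lemma lam_perm_image: "lam_perm ` X \<subseteq> carrier GX" and sigma_perm_image: "sigma_perm ` X \<subseteq> carrier GX"
  by auto

lemma L_subgroup: "subgroup L GX"
  unfolding L_def by (rule GX.generate_is_subgroup[OF lam_perm_image])

lemma L_carrier: "g \<in> L \<Longrightarrow> g \<in> carrier GX"
  using subgroup.subset[OF L_subgroup] by blast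

lemma lam_perm_L: "x \<in> X \<Longrightarrow> lam_perm x \<in> L"
  unfolding L_def by (auto intro: generate.incl)

lemma L_apply [simp]: "g \<in> L \<Longrightarrow> x \<in> X \<Longrightarrow> g x \<in> X"
  using Bij_apply_closed[OF L_carrier] .

lemma finite_L: "finite L"
  using finite_GX subgroup.subset[OF L_subgroup] finite_subset by blast

lemma L_equivariant:
  assumes "g \<in> L" "x \<in> X" "y \<in> X"
  shows "g (s y x) = s (g y) (g x)"
proof -
  have "\<forall>x\<in>X. \<forall>y\<in>X. g (s y x) = s (g y) (g x)"
  proof (rule GX.finite_generate_induct[OF finite_GX lam_perm_image _ _ assms(1)[unfolded L_def]])
    show "\<forall>x\<in>X. \<forall>y\<in>X. \<one>\<^bsub>GX\<^esub> (s y x) = s (\<one>\<^bsub>GX\<^esub> y) (\<one>\<^bsub>GX\<^esub> x)"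
      by (simp add: Bij_one_apply)
    fix e g assume "e \<in> lam_perm ` X" and g: "g \<in> generate GX (lam_perm ` X)" and IH: "\<forall>x\<in>X. \<forall>y\<in>X. g (s y x) = s (g y) (g x)"
    then obtain w where w: "w \<in> X" "e = lam_perm w" by blast
    have gL: "g \<in> L" using g by (simp add: L_def)
    show "\<forall>x\<in>X. \<forall>y\<in>X. (e \<otimes>\<^bsub>GX\<^esub> g) (s y x) = s ((e \<otimes>\<^bsub>GX\<^esub> g) y) ((e \<otimes>\<^bsub>GX\<^esub> g) x)"
      using IH w gL by (simp add: Bij_mult_apply L_carrier s_equivariant)
  qed
  then show ?thesis using assms by blast
qed

abbreviation GL where "GL \<equiv> BijGroup L"

sublocale GL: group GL by (rule group_BijGroup)

lemma finite_GL: "finite (carrier GL)"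
  by (rule finite_BijGroup[OF finite_L])

text \<open>The permutations \<open>\<tau>\<^sub>x\<close> let the derived monoid act on the set \<open>L\<close>. They move the identity to
\<open>\<lambda>\<^sub>x\<close>, and in general multiply \<open>g\<close> from the left by the generator \<open>\<lambda>\<^sub>y\<close> with \<open>y = g x\<close>. Every generator
arises in this way from some \<open>x\<close>, so orbits of the \<open>\<tau>\<^sub>x\<close> describe subgroups of \<open>L\<close> even though
\<open>L\<close> is not a homomorphic image of the monoid.\<close>
definition \<tau> where "\<tau> x = restrict (\<lambda>g. lam_perm (g x) \<otimes>\<^bsub>GX\<^esub> g) L"

lemma \<tau>_apply: "g \<in> L \<Longrightarrow> \<tau> x g = lam_perm (g x) \<otimes>\<^bsub>GX\<^esub> g"
  by (simp add: \<tau>_def)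

lemma \<tau>_closed: "g \<in> L \<Longrightarrow> x \<in> X \<Longrightarrow> \<tau> x g \<in> L"
  by (simp add: \<tau>_apply subgroup.m_closed[OF L_subgroup] lam_perm_L)

lemma \<tau>_eval: "g \<in> L \<Longrightarrow> x \<in> X \<Longrightarrow> y \<in> X \<Longrightarrow> (\<tau> x g) y = l (g x) (g y)"
  by (simp add: \<tau>_apply Bij_mult_apply L_carrier)

lemma \<tau>_carrier [simp]:
  assumes x: "x \<in> X" shows "\<tau> x \<in> carrier GL"
proof -
  let ?f = "\<lambda>g. lam_perm (g x) \<otimes>\<^bsub>GX\<^esub> g"
  have "inj_on ?f L"
  proof (rule inj_onI)
    fix g g' assume g: "g \<in> L" "g' \<in> L" and eq: "?f g = ?f g'"
    have "(?f g) x = g x" "(?f g') x = g' x" using g x \<tau>_eval[of _ x x] by (simp_all add: \<tau>_apply)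
    then have "g x = g' x" using eq by simp
    then have "lam_perm (g x) \<otimes>\<^bsub>GX\<^esub> g = lam_perm (g x) \<otimes>\<^bsub>GX\<^esub> g'" using eq by simp
    then show "g = g'" using g x by (simp add: L_carrier)
  qed
  moreover have "?f ` L \<subseteq> L" using \<tau>_closed x by (auto simp: \<tau>_apply)
  ultimately have "bij_betw ?f L L" using finite_L by (simp add: bij_betw_def endo_inj_surj)
  then show ?thesis unfolding \<tau>_def by (rule restrict_in_BijGroup)
qed

lemma \<tau>_relation:
  assumes "x \<in> X" "y \<in> X"
  shows "\<tau> x \<otimes>\<^bsub>GL\<^esub> \<tau> y = \<tau> y \<otimes>\<^bsub>GL\<^esub> \<tau> (s y x)"
proof (rule Bij_eqI[where S = L])
  fix g assume g: "g \<in> L"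
  show "(\<tau> x \<otimes>\<^bsub>GL\<^esub> \<tau> y) g = (\<tau> y \<otimes>\<^bsub>GL\<^esub> \<tau> (s y x)) g"
  proof (rule Bij_eqI[where S = X])
    show "(\<tau> x \<otimes>\<^bsub>GL\<^esub> \<tau> y) g \<in> carrier GX" "(\<tau> y \<otimes>\<^bsub>GL\<^esub> \<tau> (s y x)) g \<in> carrier GX"
      using assms g by (simp_all add: Bij_mult_apply \<tau>_closed L_carrier)
    fix z assume z: "z \<in> X"
    show "(\<tau> x \<otimes>\<^bsub>GL\<^esub> \<tau> y) g z = (\<tau> y \<otimes>\<^bsub>GL\<^esub> \<tau> (s y x)) g z"
      using assms g z l_exchange[of "g x" "g y" "g z"]
      by (simp add: Bij_mult_apply \<tau>_closed \<tau>_eval L_equivariant)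
  qed
qed (use assms in simp_all)

text \<open>\<open>\<tau>\<^sub>x g\<close> sends \<open>x\<close> to the same point as \<open>g\<close>, since \<open>\<lambda>\<^sub>y\<close> fixes \<open>y = g x\<close>; so each step multiplies by the same \<open>\<lambda>\<^sub>y\<close>.\<close>
lemma \<tau>_pow_apply:
  assumes x: "x \<in> X"
  shows "g \<in> L \<Longrightarrow> (\<tau> x [^]\<^bsub>GL\<^esub> (k::nat)) g = lam_perm (g x) [^]\<^bsub>GX\<^esub> k \<otimes>\<^bsub>GX\<^esub> g"
proof (induction k arbitrary: g)
  case 0
  then show ?case by (simp add: Bij_one_apply L_carrier)
next
  case (Suc k)
  have g1: "\<tau> x g \<in> L" "(\<tau> x g) x = g x" using Suc.prems x by (simp_all add: \<tau>_closed \<tau>_eval)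
  have "(\<tau> x [^]\<^bsub>GL\<^esub> Suc k) g = (\<tau> x [^]\<^bsub>GL\<^esub> k) (\<tau> x g)"
    using x Suc.prems by (simp add: Bij_mult_apply)
  also have "\<dots> = lam_perm (g x) [^]\<^bsub>GX\<^esub> k \<otimes>\<^bsub>GX\<^esub> (lam_perm (g x) \<otimes>\<^bsub>GX\<^esub> g)"
    using Suc.IH[OF g1(1)] g1(2) Suc.prems by (simp add: \<tau>_apply)
  also have "\<dots> = lam_perm (g x) [^]\<^bsub>GX\<^esub> Suc k \<otimes>\<^bsub>GX\<^esub> g"
    using x Suc.prems by (simp add: GX.m_assoc L_carrier)
  finally show ?case .
qed

definition \<Theta> where "\<Theta> = generate GL (\<tau> ` X)"

lemma \<tau>_image: "\<tau> ` X \<subseteq> carrier GL" by auto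

lemma \<Theta>_subgroup: "subgroup \<Theta> GL"
  unfolding \<Theta>_def by (rule GL.generate_is_subgroup[OF \<tau>_image])

lemma \<Theta>_hypercentral: "group.hypercentral (GL\<lparr>carrier := \<Theta>\<rparr>)"
  unfolding \<Theta>_def
  by (rule GL.rack_image_hypercentral[OF finite_GL \<tau>_image _ nilpotent]) (intro conjI s_closed \<tau>_relation; assumption)

definition N where "N = generate GX (sigma_perm ` X)"

lemma N_subgroup: "subgroup N GX"
  unfolding N_def by (rule GX.generate_is_subgroup[OF sigma_perm_image])

text \<open>By the rack law, the inverses of the \<open>\<sigma>\<^sub>x\<close> satisfy the relations of the derived monoid.\<close>
lemma N_hypercentral: "group.hypercentral (GX\<lparr>carrier := N\<rparr>)"
proof -
  define t where "t x = inv\<^bsub>GX\<^esub> (sigma_perm x)" for x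
  have t: "t ` X \<subseteq> carrier GX" by (auto simp: t_def)
  have rel: "t x \<otimes>\<^bsub>GX\<^esub> t y = t y \<otimes>\<^bsub>GX\<^esub> t (s y x)" if xy: "x \<in> X" "y \<in> X" for x y
  proof -
    have "sigma_perm y \<otimes>\<^bsub>GX\<^esub> sigma_perm x = sigma_perm (s y x) \<otimes>\<^bsub>GX\<^esub> sigma_perm y"
      by (rule Bij_eqI[where S = X]) (use xy in \<open>simp_all add: Bij_mult_apply s_rack[of _ x y]\<close>)
    then have "inv\<^bsub>GX\<^esub> (sigma_perm y \<otimes>\<^bsub>GX\<^esub> sigma_perm x) = inv\<^bsub>GX\<^esub> (sigma_perm (s y x) \<otimes>\<^bsub>GX\<^esub> sigma_perm y)" by simp
    then show ?thesis using xy by (simp add: t_def GX.inv_mult_group)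
  qed
  have "generate GX (t ` X) = N"
  proof
    show "generate GX (t ` X) \<subseteq> N" unfolding N_def
      by (rule GX.generate_subgroup_incl[OF _ GX.generate_is_subgroup[OF sigma_perm_image]])
         (auto simp: t_def intro: generate.inv)
    have "sigma_perm ` X \<subseteq> generate GX (t ` X)"
    proof
      fix y assume "y \<in> sigma_perm ` X"
      then obtain x where x: "x \<in> X" "y = sigma_perm x" by blast
      have "inv\<^bsub>GX\<^esub> (t x) \<in> generate GX (t ` X)" using x by (intro generate.inv) auto
      then show "y \<in> generate GX (t ` X)" using x by (simp add: t_def)
    qed
    then show "N \<subseteq> generate GX (t ` X)" unfolding N_def
      by (rule GX.generate_subgroup_incl[OF _ GX.generate_is_subgroup[OF t]])
  qed
  moreover have "group.hypercentral (GX\<lparr>carrier := generate GX (t ` X)\<rparr>)"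
    by (rule GX.rack_image_hypercentral[OF finite_GX t _ nilpotent]) (intro conjI s_closed rel; assumption)
  ultimately show ?thesis by simp
qed

lemma \<tau>_pow_relation:
  assumes x: "x \<in> X" and y: "y \<in> X"
  obtains x' where "x' \<in> X" "\<tau> x [^]\<^bsub>GL\<^esub> (m::nat) \<otimes>\<^bsub>GL\<^esub> \<tau> y [^]\<^bsub>GL\<^esub> (k::nat) = \<tau> y [^]\<^bsub>GL\<^esub> k \<otimes>\<^bsub>GL\<^esub> \<tau> x' [^]\<^bsub>GL\<^esub> m"
proof -
  have 1: "\<exists>x'\<in>X. \<tau> x \<otimes>\<^bsub>GL\<^esub> \<tau> y [^]\<^bsub>GL\<^esub> k = \<tau> y [^]\<^bsub>GL\<^esub> k \<otimes>\<^bsub>GL\<^esub> \<tau> x'" for k :: nat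
  proof (induction k)
    case 0
    show ?case using x by (intro bexI[of _ x]) simp_all
  next
    case (Suc k)
    then obtain x' where x': "x' \<in> X" "\<tau> x \<otimes>\<^bsub>GL\<^esub> \<tau> y [^]\<^bsub>GL\<^esub> k = \<tau> y [^]\<^bsub>GL\<^esub> k \<otimes>\<^bsub>GL\<^esub> \<tau> x'" by blast
    have "\<tau> x \<otimes>\<^bsub>GL\<^esub> \<tau> y [^]\<^bsub>GL\<^esub> Suc k = (\<tau> x \<otimes>\<^bsub>GL\<^esub> \<tau> y [^]\<^bsub>GL\<^esub> k) \<otimes>\<^bsub>GL\<^esub> \<tau> y"
      using x y by (simp add: GL.m_assoc)
    also have "\<dots> = \<tau> y [^]\<^bsub>GL\<^esub> k \<otimes>\<^bsub>GL\<^esub> (\<tau> x' \<otimes>\<^bsub>GL\<^esub> \<tau> y)"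
      unfolding x'(2) using x'(1) y by (simp add: GL.m_assoc)
    also have "\<dots> = \<tau> y [^]\<^bsub>GL\<^esub> Suc k \<otimes>\<^bsub>GL\<^esub> \<tau> (s y x')"
      unfolding \<tau>_relation[OF x'(1) y] using x'(1) y by (simp add: GL.m_assoc)
    finally show ?case using x'(1) y by (intro bexI[of _ "s y x'"]) simp_all
  qed
  then obtain x' where x': "x' \<in> X" "\<tau> x \<otimes>\<^bsub>GL\<^esub> \<tau> y [^]\<^bsub>GL\<^esub> k = \<tau> y [^]\<^bsub>GL\<^esub> k \<otimes>\<^bsub>GL\<^esub> \<tau> x'" by blast
  define v where "v = \<tau> y [^]\<^bsub>GL\<^esub> k"
  have v: "v \<in> carrier GL" using y by (simp add: v_def)
  have "\<tau> x [^]\<^bsub>GL\<^esub> m \<otimes>\<^bsub>GL\<^esub> v = v \<otimes>\<^bsub>GL\<^esub> \<tau> x' [^]\<^bsub>GL\<^esub> m" for m :: nat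
  proof (induction m)
    case 0
    show ?case using v by simp
  next
    case (Suc m)
    have "\<tau> x [^]\<^bsub>GL\<^esub> Suc m \<otimes>\<^bsub>GL\<^esub> v = \<tau> x [^]\<^bsub>GL\<^esub> m \<otimes>\<^bsub>GL\<^esub> (\<tau> x \<otimes>\<^bsub>GL\<^esub> v)"
      using x v by (simp add: GL.m_assoc)
    also have "\<dots> = (\<tau> x [^]\<^bsub>GL\<^esub> m \<otimes>\<^bsub>GL\<^esub> v) \<otimes>\<^bsub>GL\<^esub> \<tau> x'"
      unfolding v_def x'(2) using x x'(1) y by (simp add: GL.m_assoc)
    also have "\<dots> = v \<otimes>\<^bsub>GL\<^esub> \<tau> x' [^]\<^bsub>GL\<^esub> Suc m"
      unfolding Suc using x'(1) v by (simp add: GL.m_assoc)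
    finally show ?case .
  qed
  then show ?thesis using that x'(1) by (simp add: v_def)
qed

text \<open>The preceding relation between powers of the \<open>\<tau>\<^sub>x\<close>, applied to the identity.\<close>
lemma lam_perm_pow_exchange:
  assumes a: "a \<in> X" and y: "y \<in> X"
  shows "\<exists>b\<in>X. \<exists>c\<in>X. lam_perm a [^]\<^bsub>GX\<^esub> (m::nat) \<otimes>\<^bsub>GX\<^esub> lam_perm y [^]\<^bsub>GX\<^esub> (k::nat)
    = lam_perm b [^]\<^bsub>GX\<^esub> k \<otimes>\<^bsub>GX\<^esub> lam_perm c [^]\<^bsub>GX\<^esub> m"
proof -
  have powL: "lam_perm x [^]\<^bsub>GX\<^esub> (n::nat) \<in> L" if "x \<in> X" for x n
    by (rule GX.subgroup_nat_pow_closed[OF L_subgroup lam_perm_L[OF that]])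
  have oneL: "\<one>\<^bsub>GX\<^esub> \<in> L" by (rule subgroup.one_closed[OF L_subgroup])
  let ?e = "lam_perm y [^]\<^bsub>GX\<^esub> k"
  define x where "x = (inv\<^bsub>GX\<^esub> ?e) a"
  have ec: "?e \<in> carrier GX" using y by simp
  have x: "x \<in> X" unfolding x_def by (rule Bij_apply_closed[OF GX.inv_closed[OF ec] a])
  have ex: "?e x = a" unfolding x_def by (rule Bij_inv_apply(2)[OF ec a])
  obtain x' where x': "x' \<in> X"
    and rel: "\<tau> x [^]\<^bsub>GL\<^esub> m \<otimes>\<^bsub>GL\<^esub> \<tau> y [^]\<^bsub>GL\<^esub> k = \<tau> y [^]\<^bsub>GL\<^esub> k \<otimes>\<^bsub>GL\<^esub> \<tau> x' [^]\<^bsub>GL\<^esub> m"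
    using \<tau>_pow_relation[OF x y] by blast
  have at1: "(\<tau> w [^]\<^bsub>GL\<^esub> (n::nat)) \<one>\<^bsub>GX\<^esub> = lam_perm w [^]\<^bsub>GX\<^esub> n" if "w \<in> X" for w n
    using \<tau>_pow_apply[OF that oneL] that by (simp add: Bij_one_apply)
  have "(\<tau> x [^]\<^bsub>GL\<^esub> m \<otimes>\<^bsub>GL\<^esub> \<tau> y [^]\<^bsub>GL\<^esub> k) \<one>\<^bsub>GX\<^esub> = (\<tau> x [^]\<^bsub>GL\<^esub> m) ?e"
    using Bij_mult_apply[of "\<tau> x [^]\<^bsub>GL\<^esub> m" L "\<tau> y [^]\<^bsub>GL\<^esub> k" "\<one>\<^bsub>GX\<^esub>"] x y oneL at1 by simp
  also have "\<dots> = lam_perm a [^]\<^bsub>GX\<^esub> m \<otimes>\<^bsub>GX\<^esub> ?e" using \<tau>_pow_apply[OF x powL[OF y]] ex by simp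
  finally have lhs: "(\<tau> x [^]\<^bsub>GL\<^esub> m \<otimes>\<^bsub>GL\<^esub> \<tau> y [^]\<^bsub>GL\<^esub> k) \<one>\<^bsub>GX\<^esub> = lam_perm a [^]\<^bsub>GX\<^esub> m \<otimes>\<^bsub>GX\<^esub> ?e" .
  let ?f = "lam_perm x' [^]\<^bsub>GX\<^esub> m"
  have "(\<tau> y [^]\<^bsub>GL\<^esub> k \<otimes>\<^bsub>GL\<^esub> \<tau> x' [^]\<^bsub>GL\<^esub> m) \<one>\<^bsub>GX\<^esub> = (\<tau> y [^]\<^bsub>GL\<^esub> k) ?f"
    using Bij_mult_apply[of "\<tau> y [^]\<^bsub>GL\<^esub> k" L "\<tau> x' [^]\<^bsub>GL\<^esub> m" "\<one>\<^bsub>GX\<^esub>"] x' y oneL at1 by simp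
  also have "\<dots> = lam_perm (?f y) [^]\<^bsub>GX\<^esub> k \<otimes>\<^bsub>GX\<^esub> ?f" by (rule \<tau>_pow_apply[OF y powL[OF x']])
  finally have "lam_perm a [^]\<^bsub>GX\<^esub> m \<otimes>\<^bsub>GX\<^esub> ?e = lam_perm (?f y) [^]\<^bsub>GX\<^esub> k \<otimes>\<^bsub>GX\<^esub> ?f"
    using lhs rel by simp
  moreover have "?f y \<in> X" by (rule L_apply[OF powL[OF x'] y])
  ultimately show ?thesis using x' by blast
qed

text \<open>The number \<open>period\<close> annihilates the permutations \<open>\<lambda>\<^sub>x\<close> of \<open>X\<close> and \<open>\<tau>\<^sub>x\<close> of \<open>L\<close> alike. So the powers with
exponent \<open>cofactor p\<close> are \<open>p\<close>-elements in both groups, and they generate the \<open>p\<close>-parts of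
both kinds of cyclic groups.\<close>
definition period where "period = card (carrier GX) * card (carrier GL)"

definition Ps where "Ps = prime_factors period"

definition cofactor where "cofactor p = period div p ^ multiplicity p period"

definition gens where "gens A = {lam_perm x [^]\<^bsub>GX\<^esub> cofactor p |x p. x \<in> X \<and> p \<in> A}"

definition H where "H A = generate GX (gens A)"

lemma period_pos: "period > 0"
  using finite_GX finite_GL GX.one_closed GL.one_closed by (auto simp: period_def card_gt_0_iff)

lemma lam_perm_pow_period: "x \<in> X \<Longrightarrow> lam_perm x [^]\<^bsub>GX\<^esub> period = \<one>\<^bsub>GX\<^esub>"
  using GX.pow_order_eq_1[of "lam_perm x"] by (simp add: period_def Coset.order_def flip: GX.nat_pow_pow)

lemma \<tau>_pow_period:
  assumes "x \<in> X" shows "\<tau> x [^]\<^bsub>GL\<^esub> period = \<one>\<^bsub>GL\<^esub>"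
proof -
  have "\<tau> x [^]\<^bsub>GL\<^esub> period = (\<tau> x [^]\<^bsub>GL\<^esub> card (carrier GL)) [^]\<^bsub>GL\<^esub> card (carrier GX)"
    using assms by (simp add: period_def GL.nat_pow_pow mult.commute)
  then show ?thesis using GL.pow_order_eq_1[of "\<tau> x"] assms by (simp add: Coset.order_def)
qed

lemma Ps_prime: "p \<in> Ps \<Longrightarrow> prime p"
  by (auto simp: Ps_def)

lemma cofactor_mult: "p ^ multiplicity p period * cofactor p = period"
  by (simp add: cofactor_def multiplicity_dvd)

lemma cofactor_not_dvd: "p \<in> Ps \<Longrightarrow> \<not> p dvd cofactor p"
  unfolding cofactor_def using period_pos Ps_prime[of p] by (intro multiplicity_decompose) auto

lemma gens_carrier: "gens A \<subseteq> carrier GX"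
  by (auto simp: gens_def)

lemma gens_L: "gens A \<subseteq> L"
  by (auto simp: gens_def intro!: GX.subgroup_nat_pow_closed[OF L_subgroup] lam_perm_L)

lemma H_L: "H A \<subseteq> L"
  unfolding H_def by (rule GX.generate_subgroup_incl[OF gens_L L_subgroup])

text \<open>The exponents \<open>i\<close> with \<open>\<lambda>\<^sub>x\<^sup>i\<close> in \<open>H Ps\<close> are the multiples of the least positive one, \<open>n\<close>. They include
all cofactors and \<open>period\<close>, which have no common prime divisor.\<close>
lemma lam_perm_in_H: 
  assumes x: "x \<in> X" shows "lam_perm x \<in> H Ps"
proof -
  have Hs: "subgroup (H Ps) GX" unfolding H_def by (rule GX.generate_is_subgroup[OF gens_carrier])
  define P where "P n \<longleftrightarrow> n > 0 \<and> lam_perm x [^]\<^bsub>GX\<^esub> n \<in> H Ps" for n :: nat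
  define n where "n = (LEAST n. P n)"
  have "P period" using period_pos lam_perm_pow_period[OF x] subgroup.one_closed[OF Hs] by (simp add: P_def)
  then have Pn: "P n" unfolding n_def by (rule LeastI)
  have min: "n \<le> i" if "P i" for i unfolding n_def using that by (rule Least_le)
  have dvd: "n dvd i" if i: "lam_perm x [^]\<^bsub>GX\<^esub> i \<in> H Ps" for i
  proof -
    have "lam_perm x [^]\<^bsub>GX\<^esub> i = lam_perm x [^]\<^bsub>GX\<^esub> (n * (i div n)) \<otimes>\<^bsub>GX\<^esub> lam_perm x [^]\<^bsub>GX\<^esub> (i mod n)"
      using x by (simp add: GX.nat_pow_mult)
    then have "inv\<^bsub>GX\<^esub> (lam_perm x [^]\<^bsub>GX\<^esub> (n * (i div n))) \<otimes>\<^bsub>GX\<^esub> lam_perm x [^]\<^bsub>GX\<^esub> i = lam_perm x [^]\<^bsub>GX\<^esub> (i mod n)"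
      using x by simp
    moreover have "lam_perm x [^]\<^bsub>GX\<^esub> (n * (i div n)) \<in> H Ps"
      using Pn x GX.subgroup_nat_pow_closed[OF Hs, of "lam_perm x [^]\<^bsub>GX\<^esub> n" "i div n"]
      by (simp add: P_def GX.nat_pow_pow)
    ultimately have "lam_perm x [^]\<^bsub>GX\<^esub> (i mod n) \<in> H Ps"
      using i subgroup.m_closed[OF Hs] subgroup.m_inv_closed[OF Hs] by metis
    moreover have "i mod n < n" using Pn by (simp add: P_def)
    ultimately have "i mod n = 0" using min[of "i mod n"] by (auto simp: P_def)
    then show ?thesis by auto
  qed
  have "n = 1"
  proof (rule ccontr)
    assume "n \<noteq> 1"
    then obtain t where t: "prime t" "t dvd n" using prime_factor_nat by blast
    have "t dvd period" using t(2) dvd[of period] lam_perm_pow_period[OF x] subgroup.one_closed[OF Hs] dvd_trans by auto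
    then have tP: "t \<in> Ps" using t(1) period_pos by (simp add: Ps_def prime_factors_dvd)
    have "lam_perm x [^]\<^bsub>GX\<^esub> cofactor t \<in> H Ps"
      unfolding H_def using x tP by (intro generate.incl) (auto simp: gens_def)
    then have "t dvd cofactor t" using dvd t(2) dvd_trans by blast
    then show False using cofactor_not_dvd[OF tP] by simp
  qed
  then show ?thesis using Pn x by (simp add: P_def)
qed

lemma H_Ps: "H Ps = L"
proof
  show "L \<subseteq> H Ps" unfolding L_def
    using GX.generate_subgroup_incl[of "lam_perm ` X" "H Ps"] lam_perm_in_H GX.generate_is_subgroup[OF gens_carrier]
    by (auto simp: H_def)
qed (rule H_L)

text \<open>The \<open>p\<close>-powers of the \<open>\<tau>\<^sub>x\<close> lie in the subgroup of \<open>p\<close>-elements of the nilpotent group \<open>\<Theta>\<close>, so they generate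
a \<open>p\<close>-group \<open>B\<close>. The orbit of the identity under \<open>B\<close> is exactly \<open>H {p}\<close>, because the elements
\<open>\<tau>\<^sub>x\<^sup>k g = \<lambda>\<^sub>y\<^sup>k g\<close> with \<open>y = g x\<close> run through all products of a generator of \<open>H {p}\<close> with \<open>g\<close>. So its size
divides the order of \<open>B\<close>.\<close>
lemma H_prime_card:
  assumes p: "p \<in> Ps" shows "\<exists>n. card (H {p}) = p ^ n"
proof -
  let ?m = "cofactor p"
  define F where "F = {\<tau> x [^]\<^bsub>GL\<^esub> ?m |x. x \<in> X}"
  have FGL: "F \<subseteq> carrier GL" by (auto simp: F_def)
  define B where "B = generate GL F"
  have Bs: "subgroup B GL" unfolding B_def by (rule GL.generate_is_subgroup[OF FGL])
  interpret B: group "GL\<lparr>carrier := B\<rparr>" by (rule subgroup.subgroup_is_group[OF Bs GL.is_group])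
  interpret \<Theta>: group "GL\<lparr>carrier := \<Theta>\<rparr>" by (rule subgroup.subgroup_is_group[OF \<Theta>_subgroup GL.is_group])
  have fin\<Theta>: "finite (carrier (GL\<lparr>carrier := \<Theta>\<rparr>))"
    using finite_GL subgroup.subset[OF \<Theta>_subgroup] finite_subset by auto
  let ?E = "{x \<in> \<Theta>. \<exists>k. x [^]\<^bsub>GL\<^esub> (p ^ k) = \<one>\<^bsub>GL\<^esub>}"
  have "subgroup ?E (GL\<lparr>carrier := \<Theta>\<rparr>)"
    using \<Theta>.hypercentral_p_elements_subgroup[OF fin\<Theta> \<Theta>_hypercentral, of p]
    by (simp add: GL.nat_pow_consistent[symmetric])
  then have Es: "subgroup ?E GL" by (rule GL.incl_subgroup[OF \<Theta>_subgroup])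
  have "F \<subseteq> ?E"
  proof
    fix f assume "f \<in> F"
    then obtain x where x: "x \<in> X" "f = \<tau> x [^]\<^bsub>GL\<^esub> ?m" by (auto simp: F_def)
    have "\<tau> x \<in> \<Theta>" unfolding \<Theta>_def using x by (auto intro: generate.incl)
    then have "f \<in> \<Theta>" using x GL.subgroup_nat_pow_closed[OF \<Theta>_subgroup] by simp
    moreover have "f [^]\<^bsub>GL\<^esub> (p ^ multiplicity p period) = \<one>\<^bsub>GL\<^esub>"
      using x \<tau>_pow_period[OF x(1)] cofactor_mult[of p] by (simp add: GL.nat_pow_pow mult.commute)
    ultimately show "f \<in> ?E" by blast
  qed
  then have BE: "B \<subseteq> ?E" unfolding B_def by (rule GL.generate_subgroup_incl[OF _ Es])
  have finB: "finite (carrier (GL\<lparr>carrier := B\<rparr>))"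
    using finite_GL subgroup.subset[OF Bs] finite_subset by auto
  obtain n where n: "card B = p ^ n"
    using B.card_power_of_p_elements[OF finB Ps_prime[OF p]] BE
    by (auto simp: GL.nat_pow_consistent[symmetric])
  have act: "group_action (GL\<lparr>carrier := B\<rparr>) L (\<lambda>f. f)"
    unfolding group_action_def group_hom_def group_hom_axioms_def
    using B.is_group GL.is_group subgroup.subset[OF Bs] by (auto simp: hom_def)
  have oneL: "\<one>\<^bsub>GX\<^esub> \<in> L" by (rule subgroup.one_closed[OF L_subgroup])
  let ?O = "orbit (GL\<lparr>carrier := B\<rparr>) (\<lambda>f. f) \<one>\<^bsub>GX\<^esub>"
  have O: "?O = {f \<one>\<^bsub>GX\<^esub> |f. f \<in> B}" by (auto simp: orbit_def)
  have Hs: "subgroup (H {p}) GX" unfolding H_def by (rule GX.generate_is_subgroup[OF gens_carrier])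
  have gens_in: "lam_perm x [^]\<^bsub>GX\<^esub> ?m \<in> gens {p}" if "x \<in> X" for x using that by (auto simp: gens_def)
  have "f \<one>\<^bsub>GX\<^esub> \<in> H {p}" if f: "f \<in> B" for f
  proof (rule GL.finite_generate_induct[OF finite_GL FGL _ _ f[unfolded B_def]])
    show "\<one>\<^bsub>GL\<^esub> \<one>\<^bsub>GX\<^esub> \<in> H {p}" using oneL subgroup.one_closed[OF Hs] by (simp add: Bij_one_apply)
    fix e g assume e: "e \<in> F" and g: "g \<in> generate GL F" and IH: "g \<one>\<^bsub>GX\<^esub> \<in> H {p}"
    obtain x where x: "x \<in> X" "e = \<tau> x [^]\<^bsub>GL\<^esub> ?m" using e by (auto simp: F_def)
    have gc: "g \<in> carrier GL" using g subgroup.subset[OF Bs] by (auto simp: B_def)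
    have g1L: "g \<one>\<^bsub>GX\<^esub> \<in> L" using IH H_L by blast
    have "(e \<otimes>\<^bsub>GL\<^esub> g) \<one>\<^bsub>GX\<^esub> = e (g \<one>\<^bsub>GX\<^esub>)" using e FGL gc oneL by (intro Bij_mult_apply) auto
    also have "\<dots> = lam_perm (g \<one>\<^bsub>GX\<^esub> x) [^]\<^bsub>GX\<^esub> ?m \<otimes>\<^bsub>GX\<^esub> g \<one>\<^bsub>GX\<^esub>"
      unfolding x(2) by (rule \<tau>_pow_apply[OF x(1) g1L])
    also have "\<dots> \<in> H {p}"
    proof (rule subgroup.m_closed[OF Hs _ IH])
      show "lam_perm (g \<one>\<^bsub>GX\<^esub> x) [^]\<^bsub>GX\<^esub> ?m \<in> H {p}"
        unfolding H_def by (rule generate.incl[OF gens_in]) (use g1L x in simp)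
    qed
    finally show "(e \<otimes>\<^bsub>GL\<^esub> g) \<one>\<^bsub>GX\<^esub> \<in> H {p}" .
  qed
  moreover have "h \<in> ?O" if h: "h \<in> H {p}" for h
  proof (rule GX.finite_generate_induct[OF finite_GX gens_carrier _ _ h[unfolded H_def]])
    have "\<one>\<^bsub>GL\<^esub> \<in> B" by (rule subgroup.one_closed[OF Bs])
    then show "\<one>\<^bsub>GX\<^esub> \<in> ?O" unfolding O using Bij_one_apply[OF oneL] by (auto intro!: exI[of _ "\<one>\<^bsub>GL\<^esub>"])
    fix e g assume e: "e \<in> gens {p}" and g: "g \<in> generate GX (gens {p})" and "g \<in> ?O"
    then obtain f where f: "f \<in> B" "g = f \<one>\<^bsub>GX\<^esub>" unfolding O by blast
    obtain y where y: "y \<in> X" "e = lam_perm y [^]\<^bsub>GX\<^esub> ?m" using e by (auto simp: gens_def)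
    have gL: "g \<in> L" using g H_L by (auto simp: H_def)
    define x where "x = (inv\<^bsub>GX\<^esub> g) y"
    have x: "x \<in> X" "g x = y"
      unfolding x_def using Bij_apply_closed[OF GX.inv_closed[OF L_carrier[OF gL]] y(1)]
        Bij_inv_apply(2)[OF L_carrier[OF gL] y(1)] by auto
    have \<tau>B: "\<tau> x [^]\<^bsub>GL\<^esub> ?m \<in> B" unfolding B_def using x by (intro generate.incl) (auto simp: F_def)
    have "(\<tau> x [^]\<^bsub>GL\<^esub> ?m \<otimes>\<^bsub>GL\<^esub> f) \<one>\<^bsub>GX\<^esub> = (\<tau> x [^]\<^bsub>GL\<^esub> ?m) g"
      unfolding f(2) using x(1) f(1) subgroup.subset[OF Bs] oneL by (intro Bij_mult_apply) auto
    also have "\<dots> = e \<otimes>\<^bsub>GX\<^esub> g" using \<tau>_pow_apply[OF x(1) gL] x(2) y(2) by simp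
    finally show "e \<otimes>\<^bsub>GX\<^esub> g \<in> ?O" unfolding O
      using subgroup.m_closed[OF Bs \<tau>B f(1)] by (metis (mono_tags, lifting) mem_Collect_eq)
  qed
  ultimately have "?O = H {p}" unfolding O by blast
  moreover have "card ?O * card (stabilizer (GL\<lparr>carrier := B\<rparr>) (\<lambda>f. f) \<one>\<^bsub>GX\<^esub>) = p ^ n"
    using group_action.orbit_stabilizer_theorem[OF act oneL] n by (simp add: Coset.order_def)
  ultimately have "card (H {p}) dvd p ^ n" by (metis dvd_triv_left)
  then show ?thesis using Ps_prime[OF p] by (auto simp: divides_primepow_nat)
qed

text \<open>The exchange of powers of the \<open>\<lambda>\<^sub>x\<close> sorts products of generators.\<close>
lemma H_Un: "H (A \<union> B) = H A <#>\<^bsub>GX\<^esub> H B"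
proof -
  have "gens (A \<union> B) = gens A \<union> gens B" by (auto simp: gens_def)
  moreover have "generate GX (gens A \<union> gens B) = generate GX (gens A) <#>\<^bsub>GX\<^esub> generate GX (gens B)"
  proof (rule GX.generate_Un_exchange[OF finite_GX gens_carrier gens_carrier])
    fix e f assume "e \<in> gens A" "f \<in> gens B"
    then obtain y p a q where y: "y \<in> X" "p \<in> A" "e = lam_perm y [^]\<^bsub>GX\<^esub> cofactor p"
      and a: "a \<in> X" "q \<in> B" "f = lam_perm a [^]\<^bsub>GX\<^esub> cofactor q" by (auto simp: gens_def)
    obtain b c where bc: "b \<in> X" "c \<in> X" "f \<otimes>\<^bsub>GX\<^esub> e = lam_perm b [^]\<^bsub>GX\<^esub> cofactor p \<otimes>\<^bsub>GX\<^esub> lam_perm c [^]\<^bsub>GX\<^esub> cofactor q"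
      using lam_perm_pow_exchange[OF a(1) y(1)] y(3) a(3) by blast
    have "lam_perm b [^]\<^bsub>GX\<^esub> cofactor p \<in> gens A" "lam_perm c [^]\<^bsub>GX\<^esub> cofactor q \<in> gens B"
      using bc y a by (auto simp: gens_def)
    then show "\<exists>e'\<in>gens A. \<exists>f'\<in>gens B. f \<otimes>\<^bsub>GX\<^esub> e = e' \<otimes>\<^bsub>GX\<^esub> f'" using bc(3) by blast
  qed
  ultimately show ?thesis by (simp add: H_def)
qed

sublocale hall: hall_family GX Ps H
proof (intro hall_family.intro hall_family_axioms.intro GX.is_group)
  show "finite (carrier GX)" by (rule finite_GX)
  show "finite Ps" by (simp add: Ps_def)
  show "prime p" if "p \<in> Ps" for p using that by (rule Ps_prime)
  show "subgroup (H A) GX" for A unfolding H_def by (rule GX.generate_is_subgroup[OF gens_carrier])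
  show "H (A \<union> B) = H A <#>\<^bsub>GX\<^esub> H B" for A B by (rule H_Un)
  show "\<exists>n. card (H {p}) = p ^ n" if "p \<in> Ps" for p using that by (rule H_prime_card)
  show "H {} = {\<one>\<^bsub>GX\<^esub>}" by (simp add: H_def gens_def GX.generate_empty)
qed

lemma N_carrier: "n \<in> N \<Longrightarrow> n \<in> carrier GX"
  using subgroup.subset[OF N_subgroup] by blast

lemma L_normalizes_N:
  assumes g: "g \<in> L" and n: "n \<in> N"
  shows "g \<otimes>\<^bsub>GX\<^esub> n \<otimes>\<^bsub>GX\<^esub> inv\<^bsub>GX\<^esub> g \<in> N"
proof (rule GX.finite_generate_induct[OF finite_GX sigma_perm_image _ _ n[unfolded N_def]])
  note gc = L_carrier[OF g]
  show "g \<otimes>\<^bsub>GX\<^esub> \<one>\<^bsub>GX\<^esub> \<otimes>\<^bsub>GX\<^esub> inv\<^bsub>GX\<^esub> g \<in> N" using gc subgroup.one_closed[OF N_subgroup] by simp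
  fix e n assume "e \<in> sigma_perm ` X" and n: "n \<in> generate GX (sigma_perm ` X)" and IH: "g \<otimes>\<^bsub>GX\<^esub> n \<otimes>\<^bsub>GX\<^esub> inv\<^bsub>GX\<^esub> g \<in> N"
  then obtain y where y: "y \<in> X" "e = sigma_perm y" by blast
  have nc: "n \<in> carrier GX" using n N_carrier by (simp add: N_def)
  have gy: "g y \<in> X" using g y by simp
  have "g \<otimes>\<^bsub>GX\<^esub> sigma_perm y = sigma_perm (g y) \<otimes>\<^bsub>GX\<^esub> g"
    by (rule Bij_eqI[where S = X]) (use y gy gc g in \<open>simp_all add: Bij_mult_apply L_equivariant\<close>)
  then have "g \<otimes>\<^bsub>GX\<^esub> (e \<otimes>\<^bsub>GX\<^esub> n) \<otimes>\<^bsub>GX\<^esub> inv\<^bsub>GX\<^esub> g = sigma_perm (g y) \<otimes>\<^bsub>GX\<^esub> (g \<otimes>\<^bsub>GX\<^esub> n \<otimes>\<^bsub>GX\<^esub> inv\<^bsub>GX\<^esub> g)"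
    using y gy gc nc by (metis GX.inv_closed GX.m_assoc GX.m_closed sigma_perm_carrier)
  moreover have "sigma_perm (g y) \<in> N" unfolding N_def using gy by (auto intro: generate.incl)
  ultimately show "g \<otimes>\<^bsub>GX\<^esub> (e \<otimes>\<^bsub>GX\<^esub> n) \<otimes>\<^bsub>GX\<^esub> inv\<^bsub>GX\<^esub> g \<in> N"
    using IH subgroup.m_closed[OF N_subgroup] by simp
qed

text \<open>Every \<open>\<sigma>\<^sub>x\<close> fixes \<open>x\<close> and so, by transitivity, lies in a conjugate of the stabilizer \<open>M\<close> of \<open>x0\<close>. A proper
normal subgroup of \<open>N\<close> above \<open>M\<close> would contain all generators of \<open>N\<close>; so \<open>M = N\<close>.\<close>
lemma transitive_N_imp_singleton:
  assumes x0: "x0 \<in> X" and trans: "\<And>x. x \<in> X \<Longrightarrow> \<exists>n\<in>N. x = n x0"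
  shows "X = {x0}"
proof -
  interpret N: group "GX\<lparr>carrier := N\<rparr>" by (rule subgroup.subgroup_is_group[OF N_subgroup GX.is_group])
  have finN: "finite (carrier (GX\<lparr>carrier := N\<rparr>))"
    using finite_GX subgroup.subset[OF N_subgroup] finite_subset by auto
  define M where "M = {n \<in> N. n x0 = x0}"
  have Ms: "subgroup M GX"
  proof (rule GX.subgroupI)
    show "M \<subseteq> carrier GX" using N_carrier by (auto simp: M_def)
    show "M \<noteq> {}" using subgroup.one_closed[OF N_subgroup] x0 by (auto simp: M_def Bij_one_apply)
    fix a assume a: "a \<in> M"
    then have "(inv\<^bsub>GX\<^esub> a) (a x0) = x0" using Bij_inv_apply(1)[OF N_carrier x0, of a] by (simp add: M_def)
    then show "inv\<^bsub>GX\<^esub> a \<in> M" using a subgroup.m_inv_closed[OF N_subgroup] by (simp add: M_def)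
    fix b assume b: "b \<in> M"
    show "a \<otimes>\<^bsub>GX\<^esub> b \<in> M" using a b x0 subgroup.m_closed[OF N_subgroup]
      by (simp add: M_def Bij_mult_apply N_carrier)
  qed
  have "M = N"
  proof (rule ccontr)
    assume ne: "M \<noteq> N"
    have "subgroup M (GX\<lparr>carrier := N\<rparr>)"
      by (rule GX.subgroup_incl[OF Ms N_subgroup]) (auto simp: M_def)
    then obtain R where R: "R \<lhd> GX\<lparr>carrier := N\<rparr>" "M \<subseteq> R" "R \<noteq> N"
      using N.hypercentral_proper_subgroup_in_normal[OF finN N_hypercentral] ne by auto
    have Rn: "GX.normalized_in N R" using R GX.normalized_in_iff[OF N_subgroup] by simp
    have "sigma_perm ` X \<subseteq> R"
    proof
      fix e assume "e \<in> sigma_perm ` X"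
      then obtain x where x: "x \<in> X" "e = sigma_perm x" by blast
      obtain n where n: "n \<in> N" "x = n x0" using trans[OF x(1)] by blast
      have nc: "n \<in> carrier GX" by (rule N_carrier[OF n(1)])
      have eN: "e \<in> N" unfolding N_def using x by (auto intro: generate.incl)
      let ?k = "inv\<^bsub>GX\<^esub> n \<otimes>\<^bsub>GX\<^esub> e \<otimes>\<^bsub>GX\<^esub> n"
      have ec: "e \<in> carrier GX" using x by simp
      have "?k x0 = (inv\<^bsub>GX\<^esub> n) (e (n x0))"
        using nc ec x0 by (simp add: Bij_mult_apply Bij_apply_closed)
      also have "e (n x0) = n x0" using x n by simp
      also have "(inv\<^bsub>GX\<^esub> n) (n x0) = x0" by (rule Bij_inv_apply(1)[OF nc x0])
      finally have "?k \<in> M" using n(1) eN subgroup.m_closed[OF N_subgroup] subgroup.m_inv_closed[OF N_subgroup]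
        by (simp add: M_def)
      then have "n \<otimes>\<^bsub>GX\<^esub> ?k \<otimes>\<^bsub>GX\<^esub> inv\<^bsub>GX\<^esub> n \<in> R" using Rn R(2) n(1) unfolding GX.normalized_in_def by blast
      moreover have "n \<otimes>\<^bsub>GX\<^esub> ?k \<otimes>\<^bsub>GX\<^esub> inv\<^bsub>GX\<^esub> n = e" using nc ec by (simp add: GX.m_assoc)
      ultimately show "e \<in> R" by simp
    qed
    then have "N \<subseteq> R" unfolding N_def
      by (rule GX.generate_subgroup_incl) (use Rn in \<open>simp add: GX.normalized_in_def\<close>)
    then show False using R(3) Rn by (auto simp: GX.normalized_in_def)
  qed
  then show ?thesis using trans x0 by (auto simp: M_def)
qed

text \<open>If no proper subset is invariant, then \<open>L\<close> permutes the orbits of \<open>N\<close> transitively, and every \<open>\<lambda>\<^sub>x\<close> stabilizes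
the orbit that contains its fixed point \<open>x\<close>. This orbit is the image under some \<open>g\<close> in \<open>L\<close> of the orbit
\<open>Ob\<close>, so \<open>\<lambda>\<^sub>x\<close> and its powers lie in the conjugate by \<open>g\<close> of the stabilizer \<open>M\<close> of \<open>Ob\<close>. Hence \<open>M = L\<close>, and
\<open>Ob\<close> is everything, in contradiction to the intransitivity of \<open>N\<close>.\<close>
theorem decomposable_if_card_gt_1:
  assumes card: "card X > 1"
  shows "decomposable X r"
proof (rule ccontr)
  assume indec: "\<not> decomposable X r"
  have whole: "Y = X" if "Y \<subseteq> X" "Y \<noteq> {}" "\<And>x y. x \<in> X \<Longrightarrow> y \<in> Y \<Longrightarrow> l x y \<in> Y"
    "\<And>x y. x \<in> X \<Longrightarrow> y \<in> Y \<Longrightarrow> s x y \<in> Y" for Y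
    using decomposable_of_invariant[of Y] that indec by blast
  obtain x0 where x0: "x0 \<in> X" using X_nonempty by blast
  define Ob where "Ob = {n x0 |n. n \<in> N}"
  have ObX: "Ob \<subseteq> X" using Bij_apply_closed[OF N_carrier x0] by (auto simp: Ob_def)
  have finOb: "finite Ob" by (rule finite_subset[OF ObX finite_X])
  have x0Ob: "x0 \<in> Ob"
    unfolding Ob_def using subgroup.one_closed[OF N_subgroup] Bij_one_apply[OF x0, symmetric] by (intro CollectI exI conjI)
  have N_Ob: "n z \<in> Ob" if nz: "n \<in> N" "z \<in> Ob" for n z
  proof -
    obtain n' where n': "n' \<in> N" "z = n' x0" using nz(2) by (auto simp: Ob_def)
    have "n z = (n \<otimes>\<^bsub>GX\<^esub> n') x0" using n' nz(1) x0 by (simp add: Bij_mult_apply N_carrier)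
    then show ?thesis using subgroup.m_closed[OF N_subgroup nz(1) n'(1)] unfolding Ob_def by blast
  qed
  have N_trans: "\<exists>n\<in>N. w = n z" if zw: "z \<in> Ob" "w \<in> Ob" for z w
  proof -
    obtain a b where ab: "a \<in> N" "z = a x0" "b \<in> N" "w = b x0" using zw by (auto simp: Ob_def)
    have ac: "a \<in> carrier GX" "b \<in> carrier GX" using ab N_carrier by auto
    have "(b \<otimes>\<^bsub>GX\<^esub> inv\<^bsub>GX\<^esub> a) z = b ((inv\<^bsub>GX\<^esub> a) z)"
      using ac zw(1) ObX by (intro Bij_mult_apply) auto
    also have "(inv\<^bsub>GX\<^esub> a) z = x0" unfolding ab(2) by (rule Bij_inv_apply(1)[OF ac(1) x0])
    finally have "w = (b \<otimes>\<^bsub>GX\<^esub> inv\<^bsub>GX\<^esub> a) z" using ab by simp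
    moreover have "b \<otimes>\<^bsub>GX\<^esub> inv\<^bsub>GX\<^esub> a \<in> N"
      using ab subgroup.m_closed[OF N_subgroup] subgroup.m_inv_closed[OF N_subgroup] by simp
    ultimately show ?thesis by blast
  qed
  have ObneX: "Ob \<noteq> X"
  proof
    assume "Ob = X"
    then have "X = {x0}" by (intro transitive_N_imp_singleton[OF x0]) (auto simp: Ob_def)
    then have "card X = 1" by simp
    then show False using card by simp
  qed
  have surj: "h ` Ob = Ob" if h: "h \<in> L" "\<And>z. z \<in> Ob \<Longrightarrow> h z \<in> Ob" for h
  proof (rule endo_inj_surj[OF finOb])
    have "bij_betw h X X" using L_carrier[OF h(1)] by (simp add: BijGroup_def Bij_def)
    then show "inj_on h Ob" using ObX inj_on_subset by (auto simp: bij_betw_def)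
  qed (use h in auto)
  \<comment> \<open>The union of the translates of \<open>Ob\<close> is invariant under \<open>N\<close>, since \<open>s (g u) (g z) = g (s u z)\<close> for \<open>g\<close> in \<open>L\<close>.\<close>
  have cover: "\<exists>g\<in>L. x \<in> g ` Ob" if x: "x \<in> X" for x
  proof -
    let ?Y = "{g z |g z. g \<in> L \<and> z \<in> Ob}"
    have "?Y = X"
    proof (rule whole)
      show "?Y \<subseteq> X" using ObX by auto
      show "?Y \<noteq> {}" using x0Ob subgroup.one_closed[OF L_subgroup] by blast
      fix x y assume xX: "x \<in> X" and "y \<in> ?Y"
      then obtain g z where g: "g \<in> L" "z \<in> Ob" "y = g z" by blast
      have zX: "z \<in> X" using g ObX by blast
      have "l x y = (lam_perm x \<otimes>\<^bsub>GX\<^esub> g) z" using xX g zX by (simp add: Bij_mult_apply L_carrier)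
      moreover have "lam_perm x \<otimes>\<^bsub>GX\<^esub> g \<in> L" using subgroup.m_closed[OF L_subgroup lam_perm_L[OF xX] g(1)] .
      ultimately show "l x y \<in> ?Y" using g(2) by blast
      define x' where "x' = (inv\<^bsub>GX\<^esub> g) x"
      have x': "x' \<in> X" "g x' = x"
        unfolding x'_def using Bij_apply_closed[OF GX.inv_closed[OF L_carrier[OF g(1)]] xX]
          Bij_inv_apply(2)[OF L_carrier[OF g(1)] xX] by auto
      have "s x y = g (s x' z)" using L_equivariant[OF g(1) zX x'(1)] x' g by simp
      moreover have "s x' z = sigma_perm x' z" using zX by simp
      moreover have "sigma_perm x' \<in> N" unfolding N_def using x' by (auto intro: generate.incl)
      ultimately show "s x y \<in> ?Y" using g(1) N_Ob[OF _ g(2)] by auto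
    qed
    then show ?thesis using x by blast
  qed
  define M where "M = {g \<in> L. \<forall>z\<in>Ob. g z \<in> Ob}"
  have Ms: "subgroup M GX"
  proof (rule GX.subgroupI)
    show "M \<subseteq> carrier GX" using L_carrier by (auto simp: M_def)
    show "M \<noteq> {}" using subgroup.one_closed[OF L_subgroup] ObX by (auto simp: M_def Bij_one_apply subset_iff)
    fix a assume a: "a \<in> M"
    have aL: "a \<in> L" using a by (simp add: M_def)
    have "(inv\<^bsub>GX\<^esub> a) z \<in> Ob" if z: "z \<in> Ob" for z
    proof -
      have "a ` Ob = Ob" by (rule surj[OF aL]) (use a in \<open>simp add: M_def\<close>)
      then obtain w where w: "w \<in> Ob" "z = a w" using z by blast
      then have "(inv\<^bsub>GX\<^esub> a) z = w" using Bij_inv_apply(1)[OF L_carrier[OF aL], of w] ObX by auto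
      then show ?thesis using w by simp
    qed
    then show "inv\<^bsub>GX\<^esub> a \<in> M" using subgroup.m_inv_closed[OF L_subgroup aL] by (simp add: M_def)
    fix b assume b: "b \<in> M"
    have "(a \<otimes>\<^bsub>GX\<^esub> b) z = a (b z)" if "z \<in> Ob" for z
      using a b that ObX L_carrier by (intro Bij_mult_apply) (auto simp: M_def)
    then show "a \<otimes>\<^bsub>GX\<^esub> b \<in> M" using a b subgroup.m_closed[OF L_subgroup] by (simp add: M_def)
  qed
  have "M = H Ps"
  proof (rule hall.conjugates_of_proper_subgroup[OF order_refl Ms])
    show "M \<subseteq> H Ps" using H_Ps by (auto simp: M_def)
    fix p assume p: "p \<in> Ps"
    show "H {p} \<subseteq> generate GX (H {p} \<inter> {g \<otimes>\<^bsub>GX\<^esub> m \<otimes>\<^bsub>GX\<^esub> inv\<^bsub>GX\<^esub> g |g m. g \<in> H Ps \<and> m \<in> M})"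
    proof -
      have "gens {p} \<subseteq> H {p} \<inter> {g \<otimes>\<^bsub>GX\<^esub> m \<otimes>\<^bsub>GX\<^esub> inv\<^bsub>GX\<^esub> g |g m. g \<in> H Ps \<and> m \<in> M}"
      proof
        fix e assume e: "e \<in> gens {p}"
        then have eH: "e \<in> H {p}" unfolding H_def by (rule generate.incl)
        obtain x where x: "x \<in> X" "e = lam_perm x [^]\<^bsub>GX\<^esub> cofactor p" using e by (auto simp: gens_def)
        obtain g z where g: "g \<in> L" "z \<in> Ob" "x = g z" using cover[OF x(1)] by blast
        have gc: "g \<in> carrier GX" and zX: "z \<in> X" using g L_carrier ObX by auto
        have lc: "lam_perm x \<in> carrier GX" using x by simp
        define h where "h = inv\<^bsub>GX\<^esub> g \<otimes>\<^bsub>GX\<^esub> lam_perm x \<otimes>\<^bsub>GX\<^esub> g"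
        have hL: "h \<in> L" unfolding h_def
          using g(1) lam_perm_L[OF x(1)] subgroup.m_closed[OF L_subgroup] subgroup.m_inv_closed[OF L_subgroup] by simp
        have hc: "h \<in> carrier GX" by (rule L_carrier[OF hL])
        have "h z = (inv\<^bsub>GX\<^esub> g) (lam_perm x (g z))"
          unfolding h_def using gc lc zX by (simp add: Bij_mult_apply Bij_apply_closed)
        also have "lam_perm x (g z) = g z" using g(3) x(1) by simp
        also have "(inv\<^bsub>GX\<^esub> g) (g z) = z" by (rule Bij_inv_apply(1)[OF gc zX])
        finally have hz: "h z = z" .
        have "h w \<in> Ob" if w: "w \<in> Ob" for w
        proof -
          obtain n where n: "n \<in> N" "w = n z" using N_trans[OF g(2) w] by blast
          have nc: "n \<in> carrier GX" by (rule N_carrier[OF n(1)])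
          have "h w = (h \<otimes>\<^bsub>GX\<^esub> n) z" using n hc nc zX by (simp add: Bij_mult_apply)
          \<comment> \<open>\<open>h\<close> normalizes \<open>N\<close> and fixes \<open>z\<close>, so it maps the orbit of \<open>z\<close> to itself.\<close>
          also have "h \<otimes>\<^bsub>GX\<^esub> n = (h \<otimes>\<^bsub>GX\<^esub> n \<otimes>\<^bsub>GX\<^esub> inv\<^bsub>GX\<^esub> h) \<otimes>\<^bsub>GX\<^esub> h" using hc nc by (simp add: GX.m_assoc)
          also have "\<dots> z = (h \<otimes>\<^bsub>GX\<^esub> n \<otimes>\<^bsub>GX\<^esub> inv\<^bsub>GX\<^esub> h) (h z)"
            using hc nc zX by (intro Bij_mult_apply) auto
          also have "\<dots> = (h \<otimes>\<^bsub>GX\<^esub> n \<otimes>\<^bsub>GX\<^esub> inv\<^bsub>GX\<^esub> h) z" by (simp only: hz)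
          also have "\<dots> \<in> Ob" by (rule N_Ob[OF L_normalizes_N[OF hL n(1)] g(2)])
          finally show ?thesis .
        qed
        then have hM: "h \<in> M" using hL by (simp add: M_def)
        have "g \<otimes>\<^bsub>GX\<^esub> h [^]\<^bsub>GX\<^esub> k \<otimes>\<^bsub>GX\<^esub> inv\<^bsub>GX\<^esub> g = lam_perm x [^]\<^bsub>GX\<^esub> k" for k :: nat
        proof (induction k)
          case 0
          show ?case using gc by simp
        next
          case (Suc k)
          have "g \<otimes>\<^bsub>GX\<^esub> h [^]\<^bsub>GX\<^esub> Suc k \<otimes>\<^bsub>GX\<^esub> inv\<^bsub>GX\<^esub> g
            = (g \<otimes>\<^bsub>GX\<^esub> h [^]\<^bsub>GX\<^esub> k \<otimes>\<^bsub>GX\<^esub> inv\<^bsub>GX\<^esub> g) \<otimes>\<^bsub>GX\<^esub> (g \<otimes>\<^bsub>GX\<^esub> h \<otimes>\<^bsub>GX\<^esub> inv\<^bsub>GX\<^esub> g)"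
            using gc hc by (simp add: GX.m_assoc)
          also have "g \<otimes>\<^bsub>GX\<^esub> h \<otimes>\<^bsub>GX\<^esub> inv\<^bsub>GX\<^esub> g = lam_perm x"
            unfolding h_def using gc lc by (simp add: GX.m_assoc)
          finally show ?case using Suc by simp
        qed
        then have "e = g \<otimes>\<^bsub>GX\<^esub> h [^]\<^bsub>GX\<^esub> cofactor p \<otimes>\<^bsub>GX\<^esub> inv\<^bsub>GX\<^esub> g" using x(2) by simp
        moreover have "h [^]\<^bsub>GX\<^esub> cofactor p \<in> M" by (rule GX.subgroup_nat_pow_closed[OF Ms hM])
        moreover have "g \<in> H Ps" using g(1) H_Ps by simp
        ultimately show "e \<in> H {p} \<inter> {g \<otimes>\<^bsub>GX\<^esub> m \<otimes>\<^bsub>GX\<^esub> inv\<^bsub>GX\<^esub> g |g m. g \<in> H Ps \<and> m \<in> M}"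
          using eH by blast
      qed
      then show ?thesis unfolding H_def[of "{p}"] by (rule GX.mono_generate)
    qed
  qed
  then have "M = L" by (simp add: H_Ps)
  then have "X \<subseteq> Ob" using cover by (force simp: M_def)
  then show False using ObX ObneX by blast
qed

end

theorem proposition5p4:
  fixes X :: "'a set" and r :: "'a \<times> 'a \<Rightarrow> 'a \<times> 'a"
  assumes "solution X r"
    and "card X > 1"
    and "square_free X r"
    and "malcev_nilpotent (derived_monoid X r)"
  shows "decomposable X r"
proof -
  interpret nilpotent_square_free_solution X r
    by unfold_locales (use assms in auto)
  show ?thesis by (rule decomposable_if_card_gt_1[OF assms(2)])
qed

end
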